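(* Consider Ginibre's ensemble of $N\times N$ complex matrices with independent complex Gaussian entries, normalised so that the eigenvalues (viewed as points of $\mathbb{C}\simeq\mathbb{R}^{2}$) asymptotically are uniformly distributed in the disc of radius $\sqrt{N/\pi}$ (area $N$). In the limit $N\to\infty$ this gives a stationary, ergodic, simple point process in $\mathbb{R}^{2}$ of intensity $1$, whose $2$-point correlation function (relative to Lebesgue measure on $\mathbb{R}^2\times\mathbb{R}^2$) is $\rho(z_1,z_2)=1-e^{-\pi\lvert z_1-z_2\rvert^{2}}$. Then almost every realisation of this process is a point set in the plane of density $1$, with autocorrelation \[ \gamma=\delta_{0}+\bigl(1-e^{-\pi\lvert x\rvert^{2}}\bigr)\lambda \] and diffraction measure \[ \widehat{\gamma}=\delta_{0}+\bigl(1-e^{-\pi\lvert k\rvert^{2}}\bigr)\lambda , \] where $\lambda$ denotes Lebesgue measure on $\mathbb{R}^{2}$.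
   Context: For a point set $\varLambda\subset\mathbb{R}^2$ with Dirac comb $\omega=\sum_{x\in\varLambda}\delta_x$, the autocorrelation is the vague limit $\gamma=\lim_{R\to\infty}(\omega_R*\widetilde{\omega_R})/\mathrm{vol}(B_R)$, where $\omega_R$ is the restriction of $\omega$ to the open disc $B_R$ of radius $R$ about $0$ and $\widetilde{\omega}(g)=\overline{\omega(\widetilde g)}$ with $\widetilde g(x)=\overline{g(-x)}$ for continuous compactly supported $g$. The diffraction measure $\widehat\gamma$ is the Fourier transform of $\gamma$ with kernel $e^{-2\pi i k\cdot x}$. The limiting Ginibre point process is the determinantal point process on $\mathbb{C}$ with correlation kernel $K(z,w)=e^{\pi z\overline{w}}e^{-\pi(\lvert z\rvert^2+\lvert w\rvert^2)/2}$ with respect to Lebesgue measure. *)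

theory Defs
  imports "HOL-Probability.Probability" "HOL-Combinatorics.Permutations"
begin

definition locally_finite_set :: "complex set \<Rightarrow> bool" where
  "locally_finite_set \<Lambda> \<longleftrightarrow> (\<forall>K. compact K \<longrightarrow> finite (\<Lambda> \<inter> K))"

definition Cc :: "(complex \<Rightarrow> complex) \<Rightarrow> bool" where
  "Cc g \<longleftrightarrow> continuous_on UNIV g \<and> (\<exists>C. compact C \<and> (\<forall>x. x \<notin> C \<longrightarrow> g x = 0))"

definition point_process :: "'w measure \<Rightarrow> ('w \<Rightarrow> complex set) \<Rightarrow> bool" where
  "point_process M X \<longleftrightarrow> prob_space M \<and>
     (\<forall>\<omega>\<in>space M. locally_finite_set (X \<omega>)) \<and>
     (\<forall>A\<in>sets borel. bounded A \<longrightarrow>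
        (\<lambda>\<omega>. card (X \<omega> \<inter> A)) \<in> measurable M (count_space UNIV))"

definition ginibre_kernel :: "complex \<Rightarrow> complex \<Rightarrow> complex" where
  "ginibre_kernel z w =
     exp (of_real pi * z * cnj w) * exp (- of_real (pi * ((cmod z)\<^sup>2 + (cmod w)\<^sup>2) / 2))"

text \<open>n-point correlation function det[K(x_i,x_j)]_{i,j<n} (Leibniz formula).\<close>
definition ginibre_corr :: "nat \<Rightarrow> (nat \<Rightarrow> complex) \<Rightarrow> complex" where
  "ginibre_corr n x = (\<Sum>p | p permutes {..<n}.
      of_int (sign p) * (\<Prod>i<n. ginibre_kernel (x i) (x (p i))))"

text \<open>The limiting Ginibre process: the determinantal point process with kernel
  ginibre_kernel, i.e. for every n \<ge> 1 the n-th factorial moment measure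
  (sum over n-tuples of distinct points) has density ginibre_corr n.\<close>
definition ginibre_process :: "'w measure \<Rightarrow> ('w \<Rightarrow> complex set) \<Rightarrow> bool" where
  "ginibre_process M X \<longleftrightarrow> point_process M X \<and>
     (\<forall>n\<ge>1. \<forall>f \<in> borel_measurable (\<Pi>\<^sub>M i\<in>{..<n}. (borel :: complex measure)).
        (\<integral>\<^sup>+\<omega>. (\<integral>\<^sup>+x. f x \<partial>count_space {x \<in> {..<n} \<rightarrow>\<^sub>E X \<omega>. inj_on x {..<n}}) \<partial>M) =
        (\<integral>\<^sup>+x. f x * ennreal (Re (ginibre_corr n x)) \<partial>(\<Pi>\<^sub>M i\<in>{..<n}. (lborel :: complex measure))))"

definition has_density :: "complex set \<Rightarrow> real \<Rightarrow> bool" where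
  "has_density \<Lambda> d \<longleftrightarrow>
     ((\<lambda>R. real (card (\<Lambda> \<inter> ball 0 R)) / measure lborel (ball (0::complex) R)) \<longlongrightarrow> d) at_top"

text \<open>gamma is the autocorrelation of \<Lambda>: vague limit of
  (\<omega>_R * \<omega>_R~)/vol(B_R) = (1/vol B_R) \<Sum>_{x,y \<in> \<Lambda> \<inter> B_R} \<delta>_{x-y}.\<close>
definition autocorrelation :: "complex set \<Rightarrow> complex measure \<Rightarrow> bool" where
  "autocorrelation \<Lambda> \<gamma> \<longleftrightarrow> sets \<gamma> = sets borel \<and>
     (\<forall>g. Cc g \<longrightarrow> integrable \<gamma> g \<and>
        ((\<lambda>R. (\<Sum>x\<in>\<Lambda> \<inter> ball 0 R. \<Sum>y\<in>\<Lambda> \<inter> ball 0 R. g (x - y))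
               / of_real (measure lborel (ball (0::complex) R)))
          \<longlongrightarrow> integral\<^sup>L \<gamma> g) at_top)"

definition fourier :: "(complex \<Rightarrow> complex) \<Rightarrow> complex \<Rightarrow> complex" where
  "fourier g k = (\<integral>x. g x * cis (- 2 * pi * (k \<bullet> x)) \<partial>lborel)"

definition conv :: "(complex \<Rightarrow> complex) \<Rightarrow> (complex \<Rightarrow> complex) \<Rightarrow> complex \<Rightarrow> complex" where
  "conv f g x = (\<integral>y. f y * g (x - y) \<partial>lborel)"

definition reflect_conj :: "(complex \<Rightarrow> complex) \<Rightarrow> complex \<Rightarrow> complex" where
  "reflect_conj g x = cnj (g (- x))"

text \<open>\<mu> is the Fourier transform of the (positive definite) measure \<gamma>
  (Berg--Forst): for all g in C_c, gamma(g * g~) = mu(|g-check|^2),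
  where g-check(k) = g-hat(-k).\<close>
definition measure_fourier_transform :: "complex measure \<Rightarrow> complex measure \<Rightarrow> bool" where
  "measure_fourier_transform \<gamma> \<mu> \<longleftrightarrow> sets \<gamma> = sets borel \<and> sets \<mu> = sets borel \<and>
     (\<forall>g. Cc g \<longrightarrow>
        integrable \<gamma> (conv g (reflect_conj g)) \<and>
        integrable \<mu> (\<lambda>k. (cmod (fourier g (- k)))\<^sup>2) \<and>
        integral\<^sup>L \<gamma> (conv g (reflect_conj g)) =
          of_real (integral\<^sup>L \<mu> (\<lambda>k. (cmod (fourier g (- k)))\<^sup>2)))"

definition dirac_plus_ginibre_density :: "complex measure" where
  "dirac_plus_ginibre_density = measure_of UNIV (sets borel)
     (\<lambda>A. indicator A 0 +
          (\<integral>\<^sup>+x. indicator A x * ennreal (1 - exp (- pi * (cmod x)\<^sup>2)) \<partial>lborel))"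

end

theory Submission
  imports Defs
begin

text \<open>
  Second moment method. The number of pairs of distinct points in the disc of radius \<open>R\<close> whose
  difference lies in a bounded set has a mean given by the 2-point function, and its variance is
  controlled by the 4-point function: a term of the determinant that does not factor over the two
  pairs contains a Gaussian linking them, so the variance is \<open>O(R\<^sup>2)\<close> while the mean is of
  order \<open>R\<^sup>2\<close>. Hence the normalised counts converge almost surely along integer radii, and by
  monotonicity along all radii. Applied to countably many small square cells this yields the
  autocorrelation. For the Fourier transform, the density \<open>1 - exp (- \<pi> |x|\<^sup>2)\<close> together with the
  Dirac measure reduces the claim to Plancherel's identity, to the trivial identity at frequency 0,
  and to the self-duality of the Gaussian; Plancherel's identity in turn is the limit of the
  Gaussian-regularised identity.
\<close>

section \<open>Counting tuples of points\<close>

text \<open>The process is known only through sums over tuples of distinct points, whereas the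
  square of a pair count runs over all pairs of pairs. It is therefore split by coincidences into
  sums over 4-, 3- and 2-tuples. Only the 4-tuples reach order \<open>R^4\<close>, so the bound on
  the 4-point function must have leading constant exactly one: the determinant terms that factor
  reproduce the squared mean and cancel against it. In every other contribution a single point
  ranges freely over the disc and the remaining ones are tied to it. After normalisation the
  variances are O(1/n^2), summable along the integers themselves, where consecutive radii have ratio
  tending to 1, as the passage to all radii demands. The atom at the origin comes from the diagonal
  x = y, which is left out of the pair counts and restored from the density 1. On the Fourier side
  the Dirac and Lebesgue parts exchange roles: the value at 0 of the autocorrelation of a test
  function becomes an integral over frequencies, and its integral becomes a value at frequency
  0.\<close>

lemma nn_integral_count_space_PiE_Suc:
  fixes f :: "(nat \<Rightarrow> 'a) \<Rightarrow> ennreal"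
  shows "(\<integral>\<^sup>+x. f x \<partial>count_space ({..<Suc n} \<rightarrow>\<^sub>E S)) =
    (\<integral>\<^sup>+a. \<integral>\<^sup>+x. f (x(n := a)) \<partial>count_space ({..<n} \<rightarrow>\<^sub>E S) \<partial>count_space S)"
proof -
  let ?T = "{..<n} \<rightarrow>\<^sub>E S"
  let ?g = "\<lambda>(a, x). x(n := a)"
  have bij: "bij_betw ?g (S \<times> ?T) ({..<Suc n} \<rightarrow>\<^sub>E S)"
    unfolding lessThan_Suc PiE_insert_eq
    by (intro bij_betw_imageI inj_combinator) simp_all
  have "(\<integral>\<^sup>+x. f x \<partial>count_space ({..<Suc n} \<rightarrow>\<^sub>E S)) = (\<integral>\<^sup>+p. f (?g p) \<partial>count_space (S \<times> ?T))"
    by (rule nn_integral_bij_count_space[OF bij, symmetric])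
  also have "\<dots> = (\<integral>\<^sup>+a. \<integral>\<^sup>+x. f (?g (a, x)) * indicator (S \<times> ?T) (a, x) \<partial>count_space UNIV \<partial>count_space UNIV)"
    using nn_integral_fst_count_space[of "\<lambda>p. f (?g p) * indicator (S \<times> ?T) p"]
    by (subst nn_integral_count_space_indicator) auto
  also have "\<dots> = (\<integral>\<^sup>+a. (\<integral>\<^sup>+x. f (x(n := a)) * indicator ?T x \<partial>count_space UNIV) * indicator S a \<partial>count_space UNIV)"
    by (intro nn_integral_cong) (auto simp: indicator_times split: split_indicator)
  also have "\<dots> = (\<integral>\<^sup>+a. \<integral>\<^sup>+x. f (x(n := a)) \<partial>count_space ?T \<partial>count_space S)"
    by (simp add: nn_integral_count_space_indicator)
  finally show ?thesis .
qed

text \<open>\<open>point_process\<close> makes only the counts in single bounded Borel sets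
  measurable. On a rectangle the number of tuples is a product of such counts, and Dynkin's argument
  carries this to all product measurable sets. The disc of radius \<open>r\<close> keeps the counts
  finite, so that the complement step may subtract.\<close>

lemma measurable_emeasure_tuples:
  fixes E :: "(nat \<Rightarrow> complex) set"
  assumes pp: "point_process M X"
    and E: "E \<in> sets (\<Pi>\<^sub>M i\<in>{..<n}. borel)"
  shows "(\<lambda>\<omega>. emeasure (count_space UNIV) (E \<inter> ({..<n} \<rightarrow>\<^sub>E X \<omega> \<inter> ball 0 r))) \<in> borel_measurable M"
proof -
  let ?P = "\<lambda>\<omega>. {..<n} \<rightarrow>\<^sub>E X \<omega> \<inter> ball 0 r"
  let ?\<Omega> = "{..<n} \<rightarrow>\<^sub>E (UNIV :: complex set)"
  have fin: "finite (X \<omega> \<inter> ball 0 r)" if "\<omega> \<in> space M" for \<omega>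
  proof (rule finite_subset)
    show "finite (X \<omega> \<inter> cball 0 r)"
      using pp that unfolding point_process_def locally_finite_set_def by auto
  qed auto
  have finP: "finite (?P \<omega>)" if "\<omega> \<in> space M" for \<omega>
    using fin[OF that] by (intro finite_PiE) auto
  have basic_count: "(\<lambda>\<omega>. emeasure (count_space UNIV) (Pi\<^sub>E {..<n} A \<inter> ?P \<omega>)) \<in> borel_measurable M"
    if A: "\<And>i. i < n \<Longrightarrow> A i \<in> sets borel" for A :: "nat \<Rightarrow> complex set"
  proof -
    have [measurable]: "(\<lambda>\<omega>. card (X \<omega> \<inter> (A i \<inter> ball 0 r))) \<in> measurable M (count_space UNIV)" if "i < n" for i
      using pp A[OF that] unfolding point_process_def
      by (meson bounded_Int bounded_ball borel_open open_ball sets.Int)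
    have "(\<lambda>\<omega>. ennreal (\<Prod>i<n. real (card (X \<omega> \<inter> (A i \<inter> ball 0 r))))) \<in> borel_measurable M"
      by (intro measurable_compose[OF _ measurable_ennreal] borel_measurable_prod)
         (auto intro!: measurable_compose[of _ M "count_space UNIV"])
    moreover have "emeasure (count_space UNIV) (Pi\<^sub>E {..<n} A \<inter> ?P \<omega>) =
        ennreal (\<Prod>i<n. real (card (X \<omega> \<inter> (A i \<inter> ball 0 r))))" if "\<omega> \<in> space M" for \<omega>
    proof -
      have eq: "Pi\<^sub>E {..<n} A \<inter> ?P \<omega> = (\<Pi>\<^sub>E i\<in>{..<n}. X \<omega> \<inter> (A i \<inter> ball 0 r))"
        by (auto simp: PiE_Int)
      have "finite (Pi\<^sub>E {..<n} A \<inter> ?P \<omega>)" using finP[OF that] by auto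
      then show ?thesis
        unfolding eq by (simp add: card_PiE ennreal_of_nat_eq_real_of_nat)
    qed
    ultimately show ?thesis
      by (subst measurable_cong) auto
  qed
  have P: "(\<lambda>\<omega>. emeasure (count_space UNIV) (?P \<omega>)) \<in> borel_measurable M"
    using basic_count[of "\<lambda>_. UNIV"] by (simp add: PiE_Int[symmetric] del: PiE_Int) (simp add: PiE_Int)
  have sub: "prod_algebra {..<n} (\<lambda>_. borel :: complex measure) \<subseteq> Pow ?\<Omega>"
    using prod_algebra_sets_into_space[of "{..<n}" "\<lambda>_. borel :: complex measure"] by simp
  have "E \<in> sigma_sets ?\<Omega> (prod_algebra {..<n} (\<lambda>_. borel))"
    using E unfolding sets_PiM by simp
  with Int_stable_prod_algebra sub show ?thesis
  proof (induction rule: sigma_sets_induct_disjoint)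
    case (basic A)
    then show ?case
      using basic_count by (auto simp: prod_algebra_eq_finite Pi_iff)
  next
    case empty
    show ?case by simp
  next
    case (compl A)
    have eq: "emeasure (count_space UNIV) ((?\<Omega> - A) \<inter> ?P \<omega>) =
      emeasure (count_space UNIV) (?P \<omega>) - emeasure (count_space UNIV) (A \<inter> ?P \<omega>)" if "\<omega> \<in> space M" for \<omega>
    proof -
      have "(?\<Omega> - A) \<inter> ?P \<omega> = ?P \<omega> - A \<inter> ?P \<omega>" by (auto simp: PiE_def)
      then show ?thesis
        using finP[OF that] by (simp add: emeasure_Diff)
    qed
    show ?case
      by (rule measurable_cong[THEN iffD2, OF eq borel_measurable_minus_ennreal[OF P compl(2)]])
  next
    case (union A)
    have "emeasure (count_space UNIV) ((\<Union>i. A i) \<inter> ?P \<omega>) = (\<Sum>i. emeasure (count_space UNIV) (A i \<inter> ?P \<omega>))" for \<omega>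
      using union(1) by (subst suminf_emeasure) (auto simp: disjoint_family_on_def intro!: arg_cong2[where f=emeasure])
    then show ?case
      using union(3) by simp
  qed
qed

text \<open>Inside a fixed disc the previous lemma settles indicators; monotone convergence extends
  this to all nonnegative functions and finally removes the disc.\<close>

lemma measurable_nn_integral_tuples:
  fixes f :: "(nat \<Rightarrow> complex) \<Rightarrow> ennreal"
  assumes pp: "point_process M X"
    and f: "f \<in> borel_measurable (\<Pi>\<^sub>M i\<in>{..<n}. borel)"
  shows "(\<lambda>\<omega>. \<integral>\<^sup>+x. f x \<partial>count_space ({..<n} \<rightarrow>\<^sub>E X \<omega>)) \<in> borel_measurable M"
proof -
  let ?P = "\<lambda>r \<omega>. {..<n} \<rightarrow>\<^sub>E X \<omega> \<inter> ball 0 r"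
  let ?I = "\<lambda>r \<omega> f. \<integral>\<^sup>+x. f x * indicator (?P r \<omega>) x \<partial>count_space UNIV"
  have *: "(\<lambda>\<omega>. ?I r \<omega> f) \<in> borel_measurable M" for r
    using f
  proof (induction rule: borel_measurable_induct)
    case (cong f g)
    have "?I r \<omega> f = ?I r \<omega> g" for \<omega>
      using cong(3) by (intro nn_integral_cong) (auto simp: space_PiM PiE_def split: split_indicator)
    then show ?case using cong by simp
  next
    case (set A)
    have "?I r \<omega> (indicator A) = emeasure (count_space UNIV) (A \<inter> ?P r \<omega>)" for \<omega>
      using nn_integral_indicator[of "A \<inter> ?P r \<omega>" "count_space UNIV"] by (simp add: indicator_inter_arith)
    then show ?case using measurable_emeasure_tuples[OF pp set] by simp
  next
    case (mult u c)
    then show ?case by (simp add: mult.assoc nn_integral_cmult)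
  next
    case (add u v)
    then show ?case by (simp add: distrib_right nn_integral_add)
  next
    case (seq U)
    have eq: "?I r \<omega> (Sup (range U)) = (SUP i. ?I r \<omega> (U i))" for \<omega>
    proof -
      have "(SUP i. U i) x * indicator (?P r \<omega>) x = (SUP i. U i x * indicator (?P r \<omega>) x)" for x
        by (simp only: Sup_apply image_comp o_def SUP_mult_right_ennreal)
      then have "?I r \<omega> (Sup (range U)) = (\<integral>\<^sup>+x. (SUP i. U i x * indicator (?P r \<omega>) x) \<partial>count_space UNIV)"
        by (simp only:)
      also have "\<dots> = (SUP i. ?I r \<omega> (U i))"
        using \<open>incseq U\<close>
        by (intro nn_integral_monotone_convergence_SUP) (auto simp: incseq_def le_fun_def intro!: mult_right_mono)
      finally show ?thesis .
    qed
    have "(\<lambda>\<omega>. ?I r \<omega> (U i)) \<in> borel_measurable M" for i by (rule seq.IH)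
    then show ?case unfolding eq by measurable
  qed
  have eq: "(\<integral>\<^sup>+x. f x \<partial>count_space ({..<n} \<rightarrow>\<^sub>E X \<omega>)) = (SUP k. ?I (real k) \<omega> f)" for \<omega>
  proof -
    have ind: "indicator ({..<n} \<rightarrow>\<^sub>E X \<omega>) x = (SUP k. indicator (?P (real k) \<omega>) x :: ennreal)" for x
    proof (rule antisym)
      show "indicator ({..<n} \<rightarrow>\<^sub>E X \<omega>) x \<le> (SUP k. indicator (?P (real k) \<omega>) x :: ennreal)"
      proof (cases "x \<in> {..<n} \<rightarrow>\<^sub>E X \<omega>")
        case True
        \<comment> \<open>The sum of the moduli bounds every coordinate at once, so a single disc
          contains the whole tuple.\<close>
        obtain k :: nat where k: "(\<Sum>i<n. cmod (x i)) < real k" using reals_Archimedean2 by blast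
        have "cmod (x i) < real k" if "i < n" for i
          using member_le_sum[of i "{..<n}" "\<lambda>i. cmod (x i)"] that k by simp
        then have "x \<in> ?P (real k) \<omega>" using True by (auto simp: PiE_def Pi_def)
        then show ?thesis by (intro SUP_upper2[of k]) (auto split: split_indicator)
      qed simp
    next
      have "?P (real k) \<omega> \<subseteq> {..<n} \<rightarrow>\<^sub>E X \<omega>" for k by (intro PiE_mono) auto
      then show "(SUP k. indicator (?P (real k) \<omega>) x :: ennreal) \<le> indicator ({..<n} \<rightarrow>\<^sub>E X \<omega>) x"
        by (intro SUP_least) (auto simp: indicator_def)
    qed
    have "(\<integral>\<^sup>+x. f x \<partial>count_space ({..<n} \<rightarrow>\<^sub>E X \<omega>)) = (\<integral>\<^sup>+x. (SUP k. f x * indicator (?P (real k) \<omega>) x) \<partial>count_space UNIV)"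
      by (simp add: nn_integral_count_space_indicator ind SUP_mult_left_ennreal)
    also have "\<dots> = (SUP k. ?I (real k) \<omega> f)"
      by (rule nn_integral_monotone_convergence_SUP)
         (auto simp: incseq_def le_fun_def PiE_def Pi_def intro!: mult_left_mono split: split_indicator)
    finally show ?thesis .
  qed
  show ?thesis
    unfolding eq by (intro borel_measurable_SUP *) simp
qed

section \<open>Correlation functions\<close>

text \<open>Completing the square: the real part of \<open>z * cnj w\<close> merges the two separate
  Gaussians into one in \<open>z - w\<close>. This decay makes distant pairs of points nearly
  independent.\<close>

lemma cmod_ginibre_kernel: "cmod (ginibre_kernel z w) = exp (- pi * (cmod (z - w))\<^sup>2 / 2)"
proof -
  have "(cmod (z - w))\<^sup>2 = (cmod z)\<^sup>2 + (cmod w)\<^sup>2 - 2 * Re (z * cnj w)"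
    unfolding cmod_power2 by (simp add: power2_eq_square algebra_simps)
  then have *: "pi * Re (z * cnj w) + - (pi * ((cmod z)\<^sup>2 + (cmod w)\<^sup>2) / 2) = - pi * (cmod (z - w))\<^sup>2 / 2"
    by (simp only:) (simp add: algebra_simps)
  have "cmod (ginibre_kernel z w) =
      exp (Re (of_real pi * (z * cnj w))) * exp (Re (- of_real (pi * ((cmod z)\<^sup>2 + (cmod w)\<^sup>2) / 2)))"
    unfolding ginibre_kernel_def norm_mult norm_exp_eq_Re mult.assoc ..
  also have "\<dots> = exp (pi * Re (z * cnj w) + - (pi * ((cmod z)\<^sup>2 + (cmod w)\<^sup>2) / 2))"
    unfolding exp_add by (simp only: Re_complex_of_real uminus_complex.sel times_complex.sel Im_complex_of_real mult_zero_left diff_zero)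
  finally show ?thesis unfolding * .
qed

lemma cmod_ginibre_kernel_le_1: "cmod (ginibre_kernel z w) \<le> 1"
  by (simp add: cmod_ginibre_kernel)

lemma ginibre_kernel_cnj: "ginibre_kernel w z = cnj (ginibre_kernel z w)"
proof -
  have "of_real pi * w * cnj z = cnj (of_real pi * z * cnj w)"
    by (simp add: mult.commute mult.left_commute)
  moreover have "- of_real (pi * ((cmod w)\<^sup>2 + (cmod z)\<^sup>2) / 2) = cnj (- of_real (pi * ((cmod z)\<^sup>2 + (cmod w)\<^sup>2) / 2))"
    by (simp only: complex_cnj_minus complex_cnj_complex_of_real add.commute)
  ultimately show ?thesis
    unfolding ginibre_kernel_def by (simp only: exp_cnj complex_cnj_mult)
qed

lemma ginibre_kernel_diag: "ginibre_kernel z z = 1"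
proof -
  have "of_real pi * z * cnj z = complex_of_real (pi * (cmod z)\<^sup>2)"
    unfolding mult.assoc complex_norm_square[symmetric] by simp
  moreover have "pi * ((cmod z)\<^sup>2 + (cmod z)\<^sup>2) / 2 = pi * (cmod z)\<^sup>2" by simp
  ultimately show ?thesis
    unfolding ginibre_kernel_def exp_add[symmetric] by (simp only: add.right_inverse exp_zero)
qed

text \<open>The contribution of a 2-cycle to the determinant. The kernel is Hermitian, so this is a
  squared modulus, and squaring removes the \<open>1 / 2\<close> from the exponent.\<close>

lemma ginibre_kernel_swap: "ginibre_kernel z w * ginibre_kernel w z = of_real (exp (- pi * (cmod (z - w))\<^sup>2))"
proof -
  have "ginibre_kernel z w * ginibre_kernel w z = of_real ((cmod (ginibre_kernel z w))\<^sup>2)"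
    by (simp add: ginibre_kernel_cnj[of w z] complex_norm_square[symmetric])
  then show ?thesis
    by (simp add: cmod_ginibre_kernel power2_eq_square[of "exp _"] mult_exp_exp)
qed

lemma ginibre_corr_1: "ginibre_corr 1 x = 1"
  by (simp add: ginibre_corr_def lessThan_Suc ginibre_kernel_diag sign_id)

lemma ginibre_corr_2: "ginibre_corr 2 x = of_real (1 - exp (- pi * (cmod (x 0 - x 1))\<^sup>2))"
proof -
  have [simp]: "{..<2::nat} = insert 0 {1}" by auto
  show ?thesis
    unfolding ginibre_corr_def
    using ginibre_kernel_swap[of "x 0" "x 1"]
    by (simp add: sum_over_permutations_insert sign_swap_id sign_id transpose_def sign_compose permutation_swap_id ginibre_kernel_diag)
qed

text \<open>Leibniz's formula has \<open>fact n\<close> terms, each of modulus at most 1. So crude a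
  bound suffices for triples, which enter the second moment only through pairs that share a
  point.\<close>

lemma norm_ginibre_corr_le: "cmod (ginibre_corr n x) \<le> fact n"
proof -
  have "cmod (ginibre_corr n x) \<le> (\<Sum>p | p permutes {..<n}. cmod (of_int (sign p) * (\<Prod>i<n. ginibre_kernel (x i) (x (p i)))))"
    unfolding ginibre_corr_def by (rule norm_sum)
  also have "\<dots> \<le> (\<Sum>p | p permutes {..<n}. 1)"
    by (intro sum_mono) (auto simp: norm_mult sign_def intro!: prod_le_1 cmod_ginibre_kernel_le_1 simp flip: prod_norm)
  also have "\<dots> = fact n" by (simp add: card_permutations[OF _ finite_lessThan])
  finally show ?thesis .
qed

text \<open>The permutations that preserve \<open>{0, 1}\<close> contribute the product of two 2-point functions;
  every other one has a factor \<open>K(x\<^sub>i, x\<^sub>j)\<close> with \<open>i < 2 \<le> j\<close>, and all factors have modulus at most 1.\<close>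

lemma ginibre_corr_4_le:
  fixes x :: "nat \<Rightarrow> complex"
  defines "k \<equiv> \<lambda>i j. exp (- pi * (cmod (x i - x j))\<^sup>2 / 2)"
  shows "Re (ginibre_corr 4 x) \<le>
     (1 - exp (- pi * (cmod (x 0 - x 1))\<^sup>2)) * (1 - exp (- pi * (cmod (x 2 - x 3))\<^sup>2))
     + 24 * (k 0 2 + k 0 3 + k 1 2 + k 1 3)"
proof -
  let ?f = "\<lambda>p. of_int (sign p) * (\<Prod>i<4. ginibre_kernel (x i) (x (p i)))"
  let ?P = "\<lambda>p :: nat \<Rightarrow> nat. p 0 < 2 \<and> p 1 < 2"
  let ?S = "k 0 2 + k 0 3 + k 1 2 + k 1 3"
  have four: "{..<4::nat} = insert 0 (insert 1 (insert 2 {3}))" by auto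
  have main: "(\<Sum>p | p permutes {..<4}. if ?P p then ?f p else 0) =
     of_real ((1 - exp (- pi * (cmod (x 0 - x 1))\<^sup>2)) * (1 - exp (- pi * (cmod (x 2 - x 3))\<^sup>2)))"
  proof -
    \<comment> \<open>The 24 permutations are listed as products of transpositions. Those with
      \<open>?P\<close> are the identity, the swap of 0 and 1, the swap of 2 and 3, and the
      composition of both swaps; they give the four terms of the expanded product.\<close>
    have perms: "(\<Sum>p | p permutes {..<4::nat}. F p) = 
      (\<Sum>b\<in>{0,1,2,3}. \<Sum>c\<in>{1,2,3}. \<Sum>d\<in>{2,3}. F (Transposition.transpose 0 b \<circ> (Transposition.transpose 1 c \<circ> (Transposition.transpose 2 d))))" for F :: "(nat \<Rightarrow> nat) \<Rightarrow> complex"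
      unfolding four by (simp add: sum_over_permutations_insert)
    show ?thesis
      unfolding perms unfolding four
      using ginibre_kernel_swap[of "x 0" "x 1"] ginibre_kernel_swap[of "x 2" "x 3"]
      by (simp add: sign_swap_id sign_id Transposition.transpose_def sign_compose
            permutation_swap_id permutation_compose ginibre_kernel_diag,
          simp only: mult.assoc[symmetric], simp add: algebra_simps)
  qed
  have rest: "cmod (if ?P p then 0 else ?f p) \<le> ?S" if p: "p permutes {..<4}" for p
  proof (cases "?P p")
    case True
    then show ?thesis by (simp add: k_def)
  next
    case False
    \<comment> \<open>The permutation must also return to {0, 1}, so a second linking factor is
      present. It is bounded by 1 together with the others: one Gaussian is already integrable over
      the plane.\<close>
    then obtain i where i: "i < 2" "\<not> p i < 2" by (metis one_less_numeral_iff pos2 semiring_norm(76))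
    have "p i < 4" using permutes_in_image[OF p, of i] i by auto
    with i have ij: "i = 0 \<or> i = 1" "p i = 2 \<or> p i = 3" by auto
    have "cmod (?f p) = (\<Prod>j<4. cmod (ginibre_kernel (x j) (x (p j))))"
      by (auto simp: norm_mult sign_def prod_norm)
    also have "\<dots> = cmod (ginibre_kernel (x i) (x (p i))) * (\<Prod>j\<in>{..<4} - {i}. cmod (ginibre_kernel (x j) (x (p j))))"
      using i by (intro prod.remove) auto
    also have "\<dots> \<le> cmod (ginibre_kernel (x i) (x (p i))) * 1"
      by (intro mult_left_mono prod_le_1) (auto intro: cmod_ginibre_kernel_le_1)
    also have "\<dots> \<le> ?S"
      using ij by (auto simp: cmod_ginibre_kernel k_def)
    finally show ?thesis using False by (simp only: if_False)
  qed
  let ?R = "\<Sum>p | p permutes {..<4}. if ?P p then 0 else ?f p"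
  have "ginibre_corr 4 x = (\<Sum>p | p permutes {..<4}. if ?P p then ?f p else 0) + ?R"
    unfolding ginibre_corr_def sum.distrib[symmetric] by (intro sum.cong) auto
  then have "Re (ginibre_corr 4 x) = (1 - exp (- pi * (cmod (x 0 - x 1))\<^sup>2)) * (1 - exp (- pi * (cmod (x 2 - x 3))\<^sup>2)) + Re ?R"
    unfolding main by (simp only: plus_complex.sel Re_complex_of_real)
  moreover have "Re ?R \<le> cmod ?R"
    by (rule complex_Re_le_cmod)
  moreover have "cmod ?R \<le> (\<Sum>p | p permutes {..<4::nat}. ?S)"
    by (rule order_trans[OF norm_sum sum_mono]) (use rest in blast)
  \<comment> \<open>The constant 24 counts all permutations, including the four that contribute 0 to
    \<open>?R\<close>.\<close>
  moreover have "(\<Sum>p | p permutes {..<4::nat}. ?S) = 24 * ?S"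
    by (simp add: card_permutations[OF _ finite_lessThan] fact_numeral)
  ultimately show ?thesis by linarith
qed

section \<open>Moments of the process\<close>

lemma nn_integral_count_space_PiE_0:
  "(\<integral>\<^sup>+x. f x \<partial>count_space ({..<0::nat} \<rightarrow>\<^sub>E S)) = f (\<lambda>_. undefined)"
  by (simp add: nn_integral_count_space_finite)

lemma measurable_fun_upd_PiM:
  fixes f :: "(nat \<Rightarrow> 'a) \<Rightarrow> ennreal"
  assumes f: "f \<in> borel_measurable (\<Pi>\<^sub>M i\<in>{..<Suc n}. N)" and a: "a \<in> space N"
  shows "(\<lambda>x. f (x(n := a))) \<in> borel_measurable (\<Pi>\<^sub>M i\<in>{..<n}. N)"
proof (rule measurable_compose[OF _ f])
  show "(\<lambda>x. x(n := a)) \<in> (\<Pi>\<^sub>M i\<in>{..<n}. N) \<rightarrow>\<^sub>M (\<Pi>\<^sub>M i\<in>{..<Suc n}. N)"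
    by (rule measurable_fun_upd[where J="{..<n}"]) (use a in auto)
qed

lemma nn_integral_PiM_Suc:
  fixes f :: "(nat \<Rightarrow> 'a) \<Rightarrow> ennreal"
  assumes N: "sigma_finite_measure N" and f: "f \<in> borel_measurable (\<Pi>\<^sub>M i\<in>{..<Suc n}. N)"
  shows "(\<integral>\<^sup>+x. f x \<partial>(\<Pi>\<^sub>M i\<in>{..<Suc n}. N)) = (\<integral>\<^sup>+a. \<integral>\<^sup>+x. f (x(n := a)) \<partial>(\<Pi>\<^sub>M i\<in>{..<n}. N) \<partial>N)"
proof -
  interpret product_sigma_finite "\<lambda>_. N"
    by (simp add: N product_sigma_finite_def)
  show ?thesis
    using f unfolding lessThan_Suc by (intro product_nn_integral_insert_rev) auto
qed

lemma nn_integral_PiM_0: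
  "(\<integral>\<^sup>+x. f x \<partial>(\<Pi>\<^sub>M i\<in>{..<0::nat}. N)) = f (\<lambda>_. undefined)"
  by (simp add: PiM_empty nn_integral_count_space_finite)


lemma nn_integral_count_space_PiE_1:
  "(\<integral>\<^sup>+x. f x \<partial>count_space ({..<1::nat} \<rightarrow>\<^sub>E S)) =
    (\<integral>\<^sup>+a. f ((\<lambda>_. undefined)(0 := a)) \<partial>count_space S)"
  unfolding One_nat_def nn_integral_count_space_PiE_Suc nn_integral_count_space_PiE_0 ..

lemma nn_integral_count_space_PiE_2:
  "(\<integral>\<^sup>+x. f x \<partial>count_space ({..<2::nat} \<rightarrow>\<^sub>E S)) =
    (\<integral>\<^sup>+a. \<integral>\<^sup>+b. f ((\<lambda>_. undefined)(0 := b, 1 := a)) \<partial>count_space S \<partial>count_space S)"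
  unfolding numeral_2_eq_2 One_nat_def nn_integral_count_space_PiE_Suc nn_integral_count_space_PiE_0 ..

lemma nn_integral_count_space_PiE_3:
  "(\<integral>\<^sup>+x. f x \<partial>count_space ({..<3::nat} \<rightarrow>\<^sub>E S)) =
    (\<integral>\<^sup>+a. \<integral>\<^sup>+b. \<integral>\<^sup>+c. f ((\<lambda>_. undefined)(0 := c, 1 := b, 2 := a))
      \<partial>count_space S \<partial>count_space S \<partial>count_space S)"
  unfolding numeral_3_eq_3 numeral_2_eq_2 One_nat_def
    nn_integral_count_space_PiE_Suc nn_integral_count_space_PiE_0 ..

lemma nn_integral_count_space_PiE_4:
  "(\<integral>\<^sup>+x. f x \<partial>count_space ({..<4::nat} \<rightarrow>\<^sub>E S)) =
    (\<integral>\<^sup>+a. \<integral>\<^sup>+b. \<integral>\<^sup>+c. \<integral>\<^sup>+d. f ((\<lambda>_. undefined)(0 := d, 1 := c, 2 := b, 3 := a))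
      \<partial>count_space S \<partial>count_space S \<partial>count_space S \<partial>count_space S)"
proof -
  have four: "4 = Suc (Suc (Suc (Suc 0)))" by simp
  show ?thesis
    unfolding four numeral_3_eq_3 numeral_2_eq_2 One_nat_def
      nn_integral_count_space_PiE_Suc nn_integral_count_space_PiE_0 ..
qed

context
  fixes N :: "'a measure"
  assumes N: "sigma_finite_measure N" and space_N: "space N = UNIV"
begin

lemma nn_integral_PiM_1:
  assumes "f \<in> borel_measurable (\<Pi>\<^sub>M i\<in>{..<1::nat}. N)"
  shows "(\<integral>\<^sup>+x. f x \<partial>(\<Pi>\<^sub>M i\<in>{..<1::nat}. N)) = (\<integral>\<^sup>+a. f ((\<lambda>_. undefined)(0 := a)) \<partial>N)"
  using assms unfolding One_nat_def
  by (simp only: nn_integral_PiM_Suc[OF N] nn_integral_PiM_0)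

lemma nn_integral_PiM_2:
  assumes "f \<in> borel_measurable (\<Pi>\<^sub>M i\<in>{..<2::nat}. N)"
  shows "(\<integral>\<^sup>+x. f x \<partial>(\<Pi>\<^sub>M i\<in>{..<2::nat}. N)) =
    (\<integral>\<^sup>+a. \<integral>\<^sup>+b. f ((\<lambda>_. undefined)(0 := b, 1 := a)) \<partial>N \<partial>N)"
proof -
  have "f \<in> borel_measurable (\<Pi>\<^sub>M i\<in>{..<Suc 1}. N)"
    using assms by (simp add: numeral_2_eq_2)
  note * = nn_integral_PiM_Suc[OF N this] measurable_fun_upd_PiM[OF this]
  show ?thesis
    using *(1) by (simp only: *(2) space_N UNIV_I nn_integral_PiM_1 Suc_1)
qed

lemma nn_integral_PiM_3:
  assumes "f \<in> borel_measurable (\<Pi>\<^sub>M i\<in>{..<3::nat}. N)"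
  shows "(\<integral>\<^sup>+x. f x \<partial>(\<Pi>\<^sub>M i\<in>{..<3::nat}. N)) =
    (\<integral>\<^sup>+a. \<integral>\<^sup>+b. \<integral>\<^sup>+c. f ((\<lambda>_. undefined)(0 := c, 1 := b, 2 := a)) \<partial>N \<partial>N \<partial>N)"
proof -
  have "f \<in> borel_measurable (\<Pi>\<^sub>M i\<in>{..<Suc 2}. N)"
    using assms by (simp add: eval_nat_numeral)
  note * = nn_integral_PiM_Suc[OF N this] measurable_fun_upd_PiM[OF this]
  have "Suc 2 = 3" by simp
  with *(1) show ?thesis
    by (simp only: *(2) space_N UNIV_I nn_integral_PiM_2)
qed

lemma nn_integral_PiM_4:
  assumes "f \<in> borel_measurable (\<Pi>\<^sub>M i\<in>{..<4::nat}. N)"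
  shows "(\<integral>\<^sup>+x. f x \<partial>(\<Pi>\<^sub>M i\<in>{..<4::nat}. N)) =
    (\<integral>\<^sup>+a. \<integral>\<^sup>+b. \<integral>\<^sup>+c. \<integral>\<^sup>+d. f ((\<lambda>_. undefined)(0 := d, 1 := c, 2 := b, 3 := a)) \<partial>N \<partial>N \<partial>N \<partial>N)"
proof -
  have "f \<in> borel_measurable (\<Pi>\<^sub>M i\<in>{..<Suc 3}. N)"
    using assms by (simp add: eval_nat_numeral)
  note * = nn_integral_PiM_Suc[OF N this] measurable_fun_upd_PiM[OF this]
  have "Suc 3 = 4" by simp
  with *(1) show ?thesis
    by (simp only: *(2) space_N UNIV_I nn_integral_PiM_3)
qed

end

lemma space_lborel_UNIV: "space lborel = UNIV"
  by simp

lemma measurable_PiM_lborel: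
  "f \<in> borel_measurable (\<Pi>\<^sub>M i\<in>I. borel) \<Longrightarrow> f \<in> borel_measurable (\<Pi>\<^sub>M i\<in>I. lborel)"
proof -
  have "sets (\<Pi>\<^sub>M i\<in>I. lborel) = sets (\<Pi>\<^sub>M i\<in>I. borel)"
    by (rule sets_PiM_cong) simp_all
  then show "f \<in> borel_measurable (\<Pi>\<^sub>M i\<in>I. borel) \<Longrightarrow> f \<in> borel_measurable (\<Pi>\<^sub>M i\<in>I. lborel)"
    by (subst measurable_cong_sets[OF _ refl])
qed

locale ginibre =
  fixes M :: "'w measure" and X :: "'w \<Rightarrow> complex set"
  assumes ginibre: "ginibre_process M X"
begin

lemma point_process: "point_process M X"
  using ginibre by (simp add: ginibre_process_def)

lemma prob_space: "prob_space M"
  using point_process by (simp add: point_process_def)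

lemma locally_finite: "\<omega> \<in> space M \<Longrightarrow> locally_finite_set (X \<omega>)"
  using point_process by (simp add: point_process_def)

text \<open>In the definition of the process, distinctness restricts the index set, which prevents
  iterated sums. Here it moves into the integrand, so that the index set becomes a full product.
  Keeping \<open>g\<close> apart from \<open>f\<close> lets each instance spell out injectivity as
  explicit inequations.\<close>

lemma moment_inj:
  fixes f g :: "(nat \<Rightarrow> complex) \<Rightarrow> ennreal"
  assumes n: "n \<ge> 1"
    and [measurable]: "f \<in> borel_measurable (\<Pi>\<^sub>M i\<in>{..<n}. borel)"
    and g: "\<And>x. g x = f x * of_bool (inj_on x {..<n})"
  shows "(\<lambda>\<omega>. \<integral>\<^sup>+x. g x \<partial>count_space ({..<n} \<rightarrow>\<^sub>E X \<omega>)) \<in> borel_measurable M" (is ?meas)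
    and "(\<integral>\<^sup>+\<omega>. \<integral>\<^sup>+x. g x \<partial>count_space ({..<n} \<rightarrow>\<^sub>E X \<omega>) \<partial>M) =
      (\<integral>\<^sup>+x. f x * ennreal (Re (ginibre_corr n x)) \<partial>(\<Pi>\<^sub>M i\<in>{..<n}. lborel))" (is ?int)
proof -
  have "Measurable.pred (\<Pi>\<^sub>M i\<in>{..<n}. borel) (\<lambda>x. i \<noteq> j \<longrightarrow> (x i :: complex) \<noteq> x j)"
    if "i \<in> {..<n}" "j \<in> {..<n}" for i j
  proof -
    have "Measurable.pred (\<Pi>\<^sub>M i\<in>{..<n}. borel) (\<lambda>x. (x i :: complex) = x j)"
      unfolding Measurable.pred_def
      by (intro measurable_equality_set measurable_component_singleton that)
    then have "Measurable.pred (\<Pi>\<^sub>M i\<in>{..<n}. borel) (\<lambda>x. (x i :: complex) \<noteq> x j)"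
      by (rule pred_intros_logic)
    then show ?thesis
      by (cases "i = j") simp_all
  qed
  then have "Measurable.pred (\<Pi>\<^sub>M i\<in>{..<n}. borel) (\<lambda>x. \<forall>i\<in>{..<n}. \<forall>j\<in>{..<n}. i \<noteq> j \<longrightarrow> (x i :: complex) \<noteq> x j)"
    by (intro pred_intros_finite finite_lessThan)
  also have "(\<lambda>x. \<forall>i\<in>{..<n}. \<forall>j\<in>{..<n}. i \<noteq> j \<longrightarrow> (x i :: complex) \<noteq> x j) = (\<lambda>x. inj_on x {..<n})"
    by (auto simp: inj_on_def fun_eq_iff)
  finally have [measurable]: "Measurable.pred (\<Pi>\<^sub>M i\<in>{..<n}. borel) (\<lambda>x :: nat \<Rightarrow> complex. inj_on x {..<n})" .
  have "g \<in> borel_measurable (\<Pi>\<^sub>M i\<in>{..<n}. borel)"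
    unfolding g by measurable
  then show ?meas
    by (rule measurable_nn_integral_tuples[OF point_process])
  have "(\<integral>\<^sup>+x. g x \<partial>count_space ({..<n} \<rightarrow>\<^sub>E X \<omega>)) =
      (\<integral>\<^sup>+x. f x \<partial>count_space {x \<in> {..<n} \<rightarrow>\<^sub>E X \<omega>. inj_on x {..<n}})" for \<omega>
    unfolding g by (subst (1 2) nn_integral_count_space_indicator) (auto intro!: nn_integral_cong simp: indicator_def)
  then show ?int
    using ginibre n by (simp add: ginibre_process_def)
qed

text \<open>Iterated integrals peel off the last coordinate first, so the outermost variable is the
  coordinate with the highest index.\<close>

lemma moment_1:
  fixes \<phi> :: "complex \<Rightarrow> ennreal"
  assumes [measurable]: "\<phi> \<in> borel_measurable borel"
  shows "(\<lambda>\<omega>. \<integral>\<^sup>+x. \<phi> x \<partial>count_space (X \<omega>)) \<in> borel_measurable M"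
    and "(\<integral>\<^sup>+\<omega>. \<integral>\<^sup>+x. \<phi> x \<partial>count_space (X \<omega>) \<partial>M) = (\<integral>\<^sup>+x. \<phi> x \<partial>lborel)"
proof -
  have "(\<lambda>x. \<phi> (x 0)) \<in> borel_measurable (\<Pi>\<^sub>M i\<in>{..<1::nat}. borel)"
    by measurable
  note * = moment_inj[OF _ this, of "\<lambda>x. \<phi> (x 0)"]
  have "(\<integral>\<^sup>+x. \<phi> (x 0) \<partial>(\<Pi>\<^sub>M i\<in>{..<1::nat}. lborel)) = (\<integral>\<^sup>+x. \<phi> x \<partial>lborel)"
    by (subst nn_integral_PiM_1[OF sigma_finite_lborel space_lborel_UNIV measurable_PiM_lborel]) simp_all
  then show "(\<lambda>\<omega>. \<integral>\<^sup>+x. \<phi> x \<partial>count_space (X \<omega>)) \<in> borel_measurable M"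
    and "(\<integral>\<^sup>+\<omega>. \<integral>\<^sup>+x. \<phi> x \<partial>count_space (X \<omega>) \<partial>M) = (\<integral>\<^sup>+x. \<phi> x \<partial>lborel)"
    using * unfolding ginibre_corr_1 nn_integral_count_space_PiE_1 by (simp_all add: lessThan_Suc)
qed

lemma moment_2:
  fixes \<phi> :: "complex \<Rightarrow> complex \<Rightarrow> ennreal"
  assumes [measurable]: "(\<lambda>x. \<phi> (x 1) (x 0)) \<in> borel_measurable (\<Pi>\<^sub>M i\<in>{..<2::nat}. borel)"
  shows "(\<lambda>\<omega>. \<integral>\<^sup>+x. \<integral>\<^sup>+y. \<phi> x y * of_bool (x \<noteq> y) \<partial>count_space (X \<omega>) \<partial>count_space (X \<omega>)) \<in> borel_measurable M"
    and "(\<integral>\<^sup>+\<omega>. \<integral>\<^sup>+x. \<integral>\<^sup>+y. \<phi> x y * of_bool (x \<noteq> y) \<partial>count_space (X \<omega>) \<partial>count_space (X \<omega>) \<partial>M) =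
      (\<integral>\<^sup>+x. \<integral>\<^sup>+y. \<phi> x y * ennreal (1 - exp (- pi * (cmod (x - y))\<^sup>2)) \<partial>lborel \<partial>lborel)"
proof -
  let ?g = "\<lambda>x :: nat \<Rightarrow> complex. \<phi> (x 1) (x 0) * of_bool (x 1 \<noteq> x 0)"
  let ?h = "\<lambda>x :: nat \<Rightarrow> complex. \<phi> (x 1) (x 0) * ennreal (1 - exp (- pi * (cmod (x 1 - x 0))\<^sup>2))"
  have two: "{..<2::nat} = {0, 1}" by auto
  have g: "?g x = \<phi> (x 1) (x 0) * of_bool (inj_on x {..<2})" for x :: "nat \<Rightarrow> complex"
    unfolding two by auto
  have n: "(1::nat) \<le> 2" by simp
  note * = moment_inj[OF n assms g]
  have corr: "Re (ginibre_corr 2 x) = 1 - exp (- pi * (cmod (x 1 - x 0))\<^sup>2)" for x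
    by (simp only: ginibre_corr_2 Re_complex_of_real norm_minus_commute)
  have h: "?h \<in> borel_measurable (\<Pi>\<^sub>M i\<in>{..<2::nat}. lborel)"
    by (intro measurable_PiM_lborel borel_measurable_times assms) measurable
  have eq: "(\<integral>\<^sup>+x. ?h x \<partial>(\<Pi>\<^sub>M i\<in>{..<2::nat}. lborel)) =
      (\<integral>\<^sup>+x. \<integral>\<^sup>+y. \<phi> x y * ennreal (1 - exp (- pi * (cmod (x - y))\<^sup>2)) \<partial>lborel \<partial>lborel)"
    unfolding nn_integral_PiM_2[OF sigma_finite_lborel space_lborel_UNIV h] by simp
  have count: "(\<integral>\<^sup>+x. ?g x \<partial>count_space ({..<2::nat} \<rightarrow>\<^sub>E S)) = (\<integral>\<^sup>+x. \<integral>\<^sup>+y. \<phi> x y * of_bool (x \<noteq> y) \<partial>count_space S \<partial>count_space S)" for S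
    unfolding nn_integral_count_space_PiE_2 by simp
  show "(\<lambda>\<omega>. \<integral>\<^sup>+x. \<integral>\<^sup>+y. \<phi> x y * of_bool (x \<noteq> y) \<partial>count_space (X \<omega>) \<partial>count_space (X \<omega>)) \<in> borel_measurable M"
    and "(\<integral>\<^sup>+\<omega>. \<integral>\<^sup>+x. \<integral>\<^sup>+y. \<phi> x y * of_bool (x \<noteq> y) \<partial>count_space (X \<omega>) \<partial>count_space (X \<omega>) \<partial>M) =
      (\<integral>\<^sup>+x. \<integral>\<^sup>+y. \<phi> x y * ennreal (1 - exp (- pi * (cmod (x - y))\<^sup>2)) \<partial>lborel \<partial>lborel)"
    using * unfolding count corr eq .
qed

text \<open>An upper bound is enough, because triples belong to the error term of the second moment.
  The 6 is \<open>fact 3\<close>, the bound on the 3-point function.\<close>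

lemma moment_3:
  fixes \<phi> :: "complex \<Rightarrow> complex \<Rightarrow> complex \<Rightarrow> ennreal"
  assumes [measurable]: "(\<lambda>x. \<phi> (x 2) (x 1) (x 0)) \<in> borel_measurable (\<Pi>\<^sub>M i\<in>{..<3::nat}. borel)"
  shows "(\<lambda>\<omega>. \<integral>\<^sup>+x. \<integral>\<^sup>+y. \<integral>\<^sup>+z. \<phi> x y z * of_bool (x \<noteq> y \<and> x \<noteq> z \<and> y \<noteq> z)
        \<partial>count_space (X \<omega>) \<partial>count_space (X \<omega>) \<partial>count_space (X \<omega>)) \<in> borel_measurable M"
    and "(\<integral>\<^sup>+\<omega>. \<integral>\<^sup>+x. \<integral>\<^sup>+y. \<integral>\<^sup>+z. \<phi> x y z * of_bool (x \<noteq> y \<and> x \<noteq> z \<and> y \<noteq> z)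
        \<partial>count_space (X \<omega>) \<partial>count_space (X \<omega>) \<partial>count_space (X \<omega>) \<partial>M) \<le>
      (\<integral>\<^sup>+x. \<integral>\<^sup>+y. \<integral>\<^sup>+z. \<phi> x y z * 6 \<partial>lborel \<partial>lborel \<partial>lborel)"
proof -
  let ?g = "\<lambda>x :: nat \<Rightarrow> complex. \<phi> (x 2) (x 1) (x 0) * of_bool (x 2 \<noteq> x 1 \<and> x 2 \<noteq> x 0 \<and> x 1 \<noteq> x 0)"
  let ?h = "\<lambda>x :: nat \<Rightarrow> complex. \<phi> (x 2) (x 1) (x 0) * 6"
  have three: "{..<3::nat} = {0, 1, 2}" by auto
  have g: "?g x = \<phi> (x 2) (x 1) (x 0) * of_bool (inj_on x {..<3})" for x :: "nat \<Rightarrow> complex"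
    unfolding three by auto
  have n: "(1::nat) \<le> 3" by simp
  note * = moment_inj[OF n assms g]
  have h: "?h \<in> borel_measurable (\<Pi>\<^sub>M i\<in>{..<3::nat}. lborel)"
    by (intro measurable_PiM_lborel borel_measurable_times assms) measurable
  have count: "(\<integral>\<^sup>+x. ?g x \<partial>count_space ({..<3::nat} \<rightarrow>\<^sub>E S)) = (\<integral>\<^sup>+x. \<integral>\<^sup>+y. \<integral>\<^sup>+z. \<phi> x y z * of_bool (x \<noteq> y \<and> x \<noteq> z \<and> y \<noteq> z) \<partial>count_space S \<partial>count_space S \<partial>count_space S)" for S
    unfolding nn_integral_count_space_PiE_3 by simp
  have "(\<integral>\<^sup>+x. \<phi> (x 2) (x 1) (x 0) * ennreal (Re (ginibre_corr 3 x)) \<partial>(\<Pi>\<^sub>M i\<in>{..<3::nat}. lborel)) \<le>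
      (\<integral>\<^sup>+x. ?h x \<partial>(\<Pi>\<^sub>M i\<in>{..<3::nat}. lborel))"
  proof (intro nn_integral_mono mult_left_mono)
    fix x :: "nat \<Rightarrow> complex"
    have "Re (ginibre_corr 3 x) \<le> 6"
      using complex_Re_le_cmod[of "ginibre_corr 3 x"] norm_ginibre_corr_le[of 3 x] by (simp add: fact_numeral)
    then show "ennreal (Re (ginibre_corr 3 x)) \<le> 6"
      using ennreal_leI by fastforce
  qed simp
  also have "\<dots> =
      (\<integral>\<^sup>+x. \<integral>\<^sup>+y. \<integral>\<^sup>+z. \<phi> x y z * 6 \<partial>lborel \<partial>lborel \<partial>lborel)"
    unfolding nn_integral_PiM_3[OF sigma_finite_lborel space_lborel_UNIV h] by simp
  finally show "(\<integral>\<^sup>+\<omega>. \<integral>\<^sup>+x. \<integral>\<^sup>+y. \<integral>\<^sup>+z. \<phi> x y z * of_bool (x \<noteq> y \<and> x \<noteq> z \<and> y \<noteq> z)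
        \<partial>count_space (X \<omega>) \<partial>count_space (X \<omega>) \<partial>count_space (X \<omega>) \<partial>M) \<le>
      (\<integral>\<^sup>+x. \<integral>\<^sup>+y. \<integral>\<^sup>+z. \<phi> x y z * 6 \<partial>lborel \<partial>lborel \<partial>lborel)"
    unfolding *(2)[unfolded count] .
  show "(\<lambda>\<omega>. \<integral>\<^sup>+x. \<integral>\<^sup>+y. \<integral>\<^sup>+z. \<phi> x y z * of_bool (x \<noteq> y \<and> x \<noteq> z \<and> y \<noteq> z)
        \<partial>count_space (X \<omega>) \<partial>count_space (X \<omega>) \<partial>count_space (X \<omega>)) \<in> borel_measurable M"
    by (rule *(1)[unfolded count])
qed

lemma moment_4:
  fixes \<phi> :: "complex \<Rightarrow> complex \<Rightarrow> complex \<Rightarrow> complex \<Rightarrow> ennreal"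
  defines "k \<equiv> \<lambda>z w. exp (- pi * (cmod (z - w))\<^sup>2 / 2)"
  assumes [measurable]: "(\<lambda>x. \<phi> (x 3) (x 2) (x 1) (x 0)) \<in> borel_measurable (\<Pi>\<^sub>M i\<in>{..<4::nat}. borel)"
  shows "(\<lambda>\<omega>. \<integral>\<^sup>+x. \<integral>\<^sup>+y. \<integral>\<^sup>+z. \<integral>\<^sup>+w. \<phi> x y z w * of_bool (x \<noteq> y \<and> x \<noteq> z \<and> x \<noteq> w \<and> y \<noteq> z \<and> y \<noteq> w \<and> z \<noteq> w)
        \<partial>count_space (X \<omega>) \<partial>count_space (X \<omega>) \<partial>count_space (X \<omega>) \<partial>count_space (X \<omega>)) \<in> borel_measurable M"
    and "(\<integral>\<^sup>+\<omega>. \<integral>\<^sup>+x. \<integral>\<^sup>+y. \<integral>\<^sup>+z. \<integral>\<^sup>+w. \<phi> x y z w * of_bool (x \<noteq> y \<and> x \<noteq> z \<and> x \<noteq> w \<and> y \<noteq> z \<and> y \<noteq> w \<and> z \<noteq> w)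
        \<partial>count_space (X \<omega>) \<partial>count_space (X \<omega>) \<partial>count_space (X \<omega>) \<partial>count_space (X \<omega>) \<partial>M) \<le>
      (\<integral>\<^sup>+x. \<integral>\<^sup>+y. \<integral>\<^sup>+z. \<integral>\<^sup>+w. \<phi> x y z w *
        ennreal ((1 - exp (- pi * (cmod (x - y))\<^sup>2)) * (1 - exp (- pi * (cmod (z - w))\<^sup>2)) +
          24 * (k x z + k x w + k y z + k y w)) \<partial>lborel \<partial>lborel \<partial>lborel \<partial>lborel)"
proof -
  let ?g = "\<lambda>x :: nat \<Rightarrow> complex. \<phi> (x 3) (x 2) (x 1) (x 0) * of_bool (x 3 \<noteq> x 2 \<and> x 3 \<noteq> x 1 \<and> x 3 \<noteq> x 0 \<and> x 2 \<noteq> x 1 \<and> x 2 \<noteq> x 0 \<and> x 1 \<noteq> x 0)"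
  let ?h = "\<lambda>x :: nat \<Rightarrow> complex. \<phi> (x 3) (x 2) (x 1) (x 0) * ennreal ((1 - exp (- pi * (cmod (x 3 - x 2))\<^sup>2)) * (1 - exp (- pi * (cmod (x 1 - x 0))\<^sup>2)) +
          24 * (k (x 3) (x 1) + k (x 3) (x 0) + k (x 2) (x 1) + k (x 2) (x 0)))"
  have four: "{..<4::nat} = {0, 1, 2, 3}" by auto
  have g: "?g x = \<phi> (x 3) (x 2) (x 1) (x 0) * of_bool (inj_on x {..<4})" for x :: "nat \<Rightarrow> complex"
    unfolding four by auto
  have n: "(1::nat) \<le> 4" by simp
  note * = moment_inj[OF n assms(2) g]
  have "(\<lambda>x. ennreal ((1 - exp (- pi * (cmod (x 3 - x 2))\<^sup>2)) * (1 - exp (- pi * (cmod (x 1 - x 0))\<^sup>2)) +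
          24 * (k (x 3) (x 1) + k (x 3) (x 0) + k (x 2) (x 1) + k (x 2) (x 0)))) \<in> borel_measurable (\<Pi>\<^sub>M i\<in>{..<4::nat}. borel)"
  proof -
    have [measurable]: "(\<lambda>x. x i - x j) \<in> borel_measurable (\<Pi>\<^sub>M i\<in>{..<4::nat}. borel :: complex measure)" if "i < 4" "j < 4" for i j
      by (intro borel_measurable_diff measurable_component_singleton) (use that in auto)
    show ?thesis unfolding k_def by measurable
  qed
  note borel_measurable_times_ennreal[OF assms(2) this]
  then have h: "?h \<in> borel_measurable (\<Pi>\<^sub>M i\<in>{..<4::nat}. lborel)"
    by (rule measurable_PiM_lborel)
  have count: "(\<integral>\<^sup>+x. ?g x \<partial>count_space ({..<4::nat} \<rightarrow>\<^sub>E S)) = (\<integral>\<^sup>+x. \<integral>\<^sup>+y. \<integral>\<^sup>+z. \<integral>\<^sup>+w. \<phi> x y z w * of_bool (x \<noteq> y \<and> x \<noteq> z \<and> x \<noteq> w \<and> y \<noteq> z \<and> y \<noteq> w \<and> z \<noteq> w) \<partial>count_space S \<partial>count_space S \<partial>count_space S \<partial>count_space S)" for S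
    unfolding nn_integral_count_space_PiE_4 by simp
  have "(\<integral>\<^sup>+x. \<phi> (x 3) (x 2) (x 1) (x 0) * ennreal (Re (ginibre_corr 4 x)) \<partial>(\<Pi>\<^sub>M i\<in>{..<4::nat}. lborel)) \<le>
      (\<integral>\<^sup>+x. ?h x \<partial>(\<Pi>\<^sub>M i\<in>{..<4::nat}. lborel))"
  proof (intro nn_integral_mono mult_left_mono ennreal_leI)
    fix x :: "nat \<Rightarrow> complex"
    show "Re (ginibre_corr 4 x) \<le> (1 - exp (- pi * (cmod (x 3 - x 2))\<^sup>2)) * (1 - exp (- pi * (cmod (x 1 - x 0))\<^sup>2)) +
          24 * (k (x 3) (x 1) + k (x 3) (x 0) + k (x 2) (x 1) + k (x 2) (x 0))"
      \<comment> \<open>The first pair is now formed by coordinates 3 and 2, the second by 1 and 0.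
        The bound of \<open>ginibre_corr_4_le\<close> is symmetric under exchanging the pairs and
        reversing each of them.\<close>
      using ginibre_corr_4_le[of x] unfolding k_def
        norm_minus_commute[of "x 3"] norm_minus_commute[of "x 2" "x 0"] norm_minus_commute[of "x 2" "x 1"]
        norm_minus_commute[of "x 1" "x 0"] mult.commute[of "1 - exp (- pi * (cmod (x 2 - x 3))\<^sup>2)"]
      by (simp only: add_ac)
  qed simp
  also have "\<dots> =
      (\<integral>\<^sup>+x. \<integral>\<^sup>+y. \<integral>\<^sup>+z. \<integral>\<^sup>+w. \<phi> x y z w *
        ennreal ((1 - exp (- pi * (cmod (x - y))\<^sup>2)) * (1 - exp (- pi * (cmod (z - w))\<^sup>2)) +
          24 * (k x z + k x w + k y z + k y w)) \<partial>lborel \<partial>lborel \<partial>lborel \<partial>lborel)"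
    unfolding nn_integral_PiM_4[OF sigma_finite_lborel space_lborel_UNIV h] by simp
  finally show "(\<integral>\<^sup>+\<omega>. \<integral>\<^sup>+x. \<integral>\<^sup>+y. \<integral>\<^sup>+z. \<integral>\<^sup>+w. \<phi> x y z w * of_bool (x \<noteq> y \<and> x \<noteq> z \<and> x \<noteq> w \<and> y \<noteq> z \<and> y \<noteq> w \<and> z \<noteq> w)
        \<partial>count_space (X \<omega>) \<partial>count_space (X \<omega>) \<partial>count_space (X \<omega>) \<partial>count_space (X \<omega>) \<partial>M) \<le>
      (\<integral>\<^sup>+x. \<integral>\<^sup>+y. \<integral>\<^sup>+z. \<integral>\<^sup>+w. \<phi> x y z w *
        ennreal ((1 - exp (- pi * (cmod (x - y))\<^sup>2)) * (1 - exp (- pi * (cmod (z - w))\<^sup>2)) +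
          24 * (k x z + k x w + k y z + k y w)) \<partial>lborel \<partial>lborel \<partial>lborel \<partial>lborel)"
    unfolding *(2)[unfolded count] .
  show "(\<lambda>\<omega>. \<integral>\<^sup>+x. \<integral>\<^sup>+y. \<integral>\<^sup>+z. \<integral>\<^sup>+w. \<phi> x y z w * of_bool (x \<noteq> y \<and> x \<noteq> z \<and> x \<noteq> w \<and> y \<noteq> z \<and> y \<noteq> w \<and> z \<noteq> w)
        \<partial>count_space (X \<omega>) \<partial>count_space (X \<omega>) \<partial>count_space (X \<omega>) \<partial>count_space (X \<omega>)) \<in> borel_measurable M"
    by (rule *(1)[unfolded count])
qed

end

section \<open>Gaussian integrals\<close>

lemma borel_measurable_cis [measurable]: "cis \<in> borel_measurable borel"
  by (intro borel_measurable_continuous_onI continuous_on_cis continuous_intros)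

lemma nn_integral_gaussian_real:
  assumes a: "a > 0"
  shows "(\<integral>\<^sup>+t. ennreal (exp (- a * t\<^sup>2)) \<partial>(lborel :: real measure)) = ennreal (sqrt (pi / a))"
proof -
  \<comment> \<open>Chosen so that \<open>t^2 / (2 * \<sigma>^2)\<close> is \<open>a * t^2\<close>;
    the total mass 1 of the normal density then gives the integral.\<close>
  define \<sigma> where "\<sigma> = 1 / sqrt (2 * a)"
  have \<sigma>: "\<sigma> > 0" "2 * \<sigma>\<^sup>2 = 1 / a"
    using a by (simp_all add: \<sigma>_def power_divide)
  have nd: "exp (- a * t\<^sup>2) = sqrt (pi / a) * normal_density 0 \<sigma> t" for t
    using a \<sigma>(1) by (simp add: normal_density_def \<sigma>(2)[symmetric] mult.assoc mult.left_commute[of _ pi]) (simp add: \<sigma>_def field_simps real_sqrt_divide)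
  have "(\<integral>\<^sup>+t. ennreal (normal_density 0 \<sigma> t) \<partial>lborel) = 1"
    using prob_space.emeasure_space_1[OF prob_space_normal_density[OF \<sigma>(1), of 0]]
    by (simp add: emeasure_density)
  then show ?thesis
    using a unfolding nd by (simp add: ennreal_mult nn_integral_cmult)
qed

lemma exp_norm_sq_eq_prod:
  "exp (- a * (cmod x)\<^sup>2) = (\<Prod>b\<in>Basis. exp (- a * (x \<bullet> b)\<^sup>2))"
  unfolding exp_sum[OF finite_Basis, symmetric] sum_distrib_left[symmetric] norm_eq_sqrt_inner
  by (subst euclidean_inner) (simp add: power2_eq_square[symmetric] sum_nonneg)

lemma nn_integral_gaussian:
  assumes a: "a > 0"
  shows "(\<integral>\<^sup>+x. ennreal (exp (- a * (cmod x)\<^sup>2)) \<partial>lborel) = ennreal (pi / a)"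
proof -
  have "(\<integral>\<^sup>+x. ennreal (exp (- a * (cmod x)\<^sup>2)) \<partial>lborel) =
      (\<integral>\<^sup>+x. (\<Prod>b\<in>Basis. ennreal (exp (- a * (x \<bullet> b)\<^sup>2))) \<partial>(lborel :: complex measure))"
    by (simp only: exp_norm_sq_eq_prod prod_ennreal[OF exp_ge_zero])
  also have "\<dots> = (\<Prod>b\<in>(Basis :: complex set). ennreal (sqrt (pi / a)))"
    by (subst nn_integral_lborel_prod) (simp_all add: nn_integral_gaussian_real[OF a, simplified])
  also have "\<dots> = ennreal (pi / a)"
    using a by (simp add: ennreal_power)
  finally show ?thesis .
qed

lemma integrable_gaussian:
  "a > 0 \<Longrightarrow> integrable lborel (\<lambda>x. exp (- a * (cmod x)\<^sup>2))"
  by (intro integrableI_nonneg) (simp_all add: nn_integral_gaussian[simplified])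

lemma fourier_gaussian_real:
  assumes a: "a > 0"
  shows "integrable lborel (\<lambda>t. of_real (exp (- a * t\<^sup>2)) * cis (s * t))"
    and "(\<integral>t. of_real (exp (- a * t\<^sup>2)) * cis (s * t) \<partial>lborel) = complex_of_real (sqrt (pi / a) * exp (- s\<^sup>2 / (4 * a)))"
proof -
  have "integrable lborel (\<lambda>t. exp (- a * t\<^sup>2))"
    by (intro integrableI_nonneg) (simp_all add: nn_integral_gaussian_real[OF a, simplified])
  then show "integrable lborel (\<lambda>t. of_real (exp (- a * t\<^sup>2)) * cis (s * t))"
    by (rule Bochner_Integration.integrable_bound) (auto simp: norm_mult)
  \<comment> \<open>Scaling \<open>x = c * t\<close> turns the standard normal exponent
    \<open>x^2 / 2\<close> into \<open>a * t^2\<close>, so the characteristic function at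
    \<open>s / c\<close> is the wanted transform at \<open>s\<close> up to a factor.\<close>
  define c where "c = sqrt (2 * a)"
  have c: "c > 0" "c\<^sup>2 = 2 * a" using a by (simp_all add: c_def)
  have "complex_of_real (exp (- ((s / c)\<^sup>2) / 2)) = (CLINT x|std_normal_distribution. iexp ((s / c) * x))"
    using fun_cong[OF char_std_normal_distribution, of "s / c"] by (simp add: char_def)
  also have "\<dots> = (\<integral>x. std_normal_density x *\<^sub>R cis (s / c * x) \<partial>lborel)"
    by (subst integral_density) (auto simp: cis_conv_exp)
  also have "\<dots> = c *\<^sub>R (\<integral>t. std_normal_density (0 + c * t) *\<^sub>R cis (s / c * (0 + c * t)) \<partial>lborel)"
    using c(1) by (subst lborel_integral_real_affine[where c=c and t=0]) auto
  also have "\<dots> = c *\<^sub>R (\<integral>t. (1 / sqrt (2 * pi)) *\<^sub>R (of_real (exp (- a * t\<^sup>2)) * cis (s * t)) \<partial>lborel)"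
    using c by (simp add: std_normal_density_def power_mult_distrib scaleR_conv_of_real mult.assoc)
  also have "\<dots> = (c / sqrt (2 * pi)) *\<^sub>R (\<integral>t. of_real (exp (- a * t\<^sup>2)) * cis (s * t) \<partial>lborel)"
    by (subst integral_scaleR_right) simp_all
  finally have *: "complex_of_real (exp (- ((s / c)\<^sup>2) / 2)) = (c / sqrt (2 * pi)) *\<^sub>R (\<integral>t. of_real (exp (- a * t\<^sup>2)) * cis (s * t) \<partial>lborel)" .
  have k: "sqrt (2 * pi) / c = sqrt (pi / a)"
    using a by (simp add: c_def real_sqrt_divide[symmetric])
  have "(\<integral>t. of_real (exp (- a * t\<^sup>2)) * cis (s * t) \<partial>lborel) =
      (sqrt (2 * pi) / c) *\<^sub>R complex_of_real (exp (- ((s / c)\<^sup>2) / 2))"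
    unfolding * using c by simp
  also have "\<dots> = complex_of_real (sqrt (pi / a) * exp (- s\<^sup>2 / (4 * a)))"
    unfolding k using c by (simp add: scaleR_conv_of_real power_divide)
  finally show "(\<integral>t. of_real (exp (- a * t\<^sup>2)) * cis (s * t) \<partial>lborel) = complex_of_real (sqrt (pi / a) * exp (- s\<^sup>2 / (4 * a)))" .
qed

text \<open>Gaussian and character both factor over the coordinates. For \<open>a = pi * s^2\<close>
  and \<open>k = 2 * pi * d\<close> the value is \<open>exp (- pi * |d|^2 / s^2) / s^2\<close>, so
  the Gaussian with \<open>s = 1\<close> is its own transform.\<close>

lemma fourier_gaussian:
  assumes a: "a > 0"
  shows "(\<integral>x. of_real (exp (- a * (cmod x)\<^sup>2)) * cis (k \<bullet> x) \<partial>lborel) =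
    complex_of_real (pi / a * exp (- (cmod k)\<^sup>2 / (4 * a)))"
proof -
  interpret product_sigma_finite "\<lambda>_. lborel :: real measure" by standard
  let ?f = "\<lambda>b t. complex_of_real (exp (- a * t\<^sup>2)) * cis ((k \<bullet> b) * t)"
  have cis_sum: "cis (\<Sum>b\<in>B. g b) = (\<Prod>b\<in>B. cis (g b))" if "finite B" for B :: "complex set" and g
    using that by (induction rule: finite_induct) (auto simp: cis_mult[symmetric])
  have prod: "of_real (exp (- a * (cmod x)\<^sup>2)) * cis (k \<bullet> x) = (\<Prod>b\<in>Basis. ?f b (x \<bullet> b))" for x
    unfolding exp_norm_sq_eq_prod of_real_prod prod.distrib
    by (subst (2) euclidean_inner) (simp add: cis_sum[OF finite_Basis])
  have "(\<integral>x. of_real (exp (- a * (cmod x)\<^sup>2)) * cis (k \<bullet> x) \<partial>lborel) =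
     (\<integral>x. (\<Prod>b\<in>Basis. ?f b ((\<Sum>c\<in>(Basis :: complex set). x c *\<^sub>R c) \<bullet> b)) \<partial>(\<Pi>\<^sub>M b\<in>Basis. lborel))"
    unfolding prod by (subst lborel_eq, subst integral_distr) simp_all
  also have "\<dots> = (\<integral>x. (\<Prod>b\<in>(Basis :: complex set). ?f b (x b)) \<partial>(\<Pi>\<^sub>M b\<in>Basis. lborel))"
    by (intro Bochner_Integration.integral_cong prod.cong refl) (simp add: inner_sum_left_Basis)
  also have "\<dots> = (\<Prod>b\<in>(Basis :: complex set). \<integral>t. ?f b t \<partial>lborel)"
    by (intro product_integral_prod fourier_gaussian_real a) simp
  also have "\<dots> = (\<Prod>b\<in>(Basis :: complex set). complex_of_real (sqrt (pi / a))) * (\<Prod>b\<in>Basis. complex_of_real (exp (- (1 / (4 * a)) * (k \<bullet> b)\<^sup>2)))"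
    unfolding fourier_gaussian_real[OF a] prod.distrib[symmetric] by simp
  also have "\<dots> = complex_of_real (pi / a) * complex_of_real (exp (- (1 / (4 * a)) * (cmod k)\<^sup>2))"
    unfolding exp_norm_sq_eq_prod of_real_prod using a
    by (simp flip: of_real_power)
  finally show ?thesis by simp
qed

section \<open>Variance of pair counts\<close>

lemma nn_integral_lborel_diff:
  fixes x :: "'a :: euclidean_space"
  assumes [measurable]: "g \<in> borel_measurable borel"
  shows "(\<integral>\<^sup>+y. g (x - y) \<partial>lborel) = (\<integral>\<^sup>+y. g y \<partial>lborel)"
proof -
  have "(\<integral>\<^sup>+y. g y \<partial>lborel) = (\<integral>\<^sup>+y. g y \<partial>density (distr lborel borel (\<lambda>y. x + (-1) *\<^sub>R y)) (\<lambda>_. \<bar>-1 :: real\<bar> ^ DIM('a)))"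
    by (subst lborel_affine[of "-1" x]) simp_all
  also have "\<dots> = (\<integral>\<^sup>+y. g (x - y) \<partial>lborel)"
    by (simp add: nn_integral_density nn_integral_distr)
  finally show ?thesis ..
qed

text \<open>Holds for index sets of any cardinality, because nonnegative sums can be reordered
  freely; \<open>pair_count_square_le\<close> applies it to an arbitrary set of points.\<close>

lemma nn_integral_count_space_Fubini:
  "(\<integral>\<^sup>+x. \<integral>\<^sup>+y. f x y \<partial>count_space B \<partial>count_space A) =
    (\<integral>\<^sup>+y. \<integral>\<^sup>+x. f x y \<partial>count_space A \<partial>count_space B)"
proof -
  let ?f = "\<lambda>x y. f x y * indicator B y * indicator A x"
  have "(\<integral>\<^sup>+x. \<integral>\<^sup>+y. f x y \<partial>count_space B \<partial>count_space A) = (\<integral>\<^sup>+x. \<integral>\<^sup>+y. ?f x y \<partial>count_space UNIV \<partial>count_space UNIV)"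
    by (subst (1 2) nn_integral_count_space_indicator) (simp_all add: nn_integral_multc)
  also have "\<dots> = (\<integral>\<^sup>+y. \<integral>\<^sup>+x. ?f x y \<partial>count_space UNIV \<partial>count_space UNIV)"
    using nn_integral_fst_count_space[of "\<lambda>(x, y). ?f x y"] nn_integral_snd_count_space[of "\<lambda>(x, y). ?f x y"] by simp
  also have "\<dots> = (\<integral>\<^sup>+y. (\<integral>\<^sup>+x. f x y * indicator A x \<partial>count_space UNIV) * indicator B y \<partial>count_space UNIV)"
    by (intro nn_integral_cong) (auto split: split_indicator)
  also have "\<dots> = (\<integral>\<^sup>+y. \<integral>\<^sup>+x. f x y \<partial>count_space A \<partial>count_space B)"
    by (subst (1 2) nn_integral_count_space_indicator[symmetric]) simp_all
  finally show ?thesis .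
qed

lemma nn_integral_count_space_eq_point:
  assumes "x \<in> S"
  shows "(\<integral>\<^sup>+y. g y * of_bool (x = y) \<partial>count_space S) = g x"
proof -
  have "(\<integral>\<^sup>+y. g y * of_bool (x = y) \<partial>count_space S) = (\<integral>\<^sup>+y. g x * indicator {x} y \<partial>count_space S)"
    by (intro nn_integral_cong) (auto split: split_indicator)
  also have "\<dots> = g x" using assms by (subst nn_integral_cmult_indicator) (auto simp: emeasure_count_space)
  finally show ?thesis .
qed

text \<open>Two pairs are disjoint, or they share one of four combinations of endpoints.\<close>

lemma pair_count_square_le:
  fixes S :: "'a set"
  assumes H: "\<And>x y. H x y \<longleftrightarrow> H y x" "\<And>x. \<not> H x x" and F: "\<And>x y. F x y \<Longrightarrow> H x y"
  shows "(\<integral>\<^sup>+x. \<integral>\<^sup>+y. of_bool (F x y) \<partial>count_space S \<partial>count_space S)\<^sup>2 \<le>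
    (\<integral>\<^sup>+x. \<integral>\<^sup>+y. \<integral>\<^sup>+z. \<integral>\<^sup>+w. of_bool (F x y) * of_bool (F z w) *
       of_bool (x \<noteq> y \<and> x \<noteq> z \<and> x \<noteq> w \<and> y \<noteq> z \<and> y \<noteq> w \<and> z \<noteq> w)
       \<partial>count_space S \<partial>count_space S \<partial>count_space S \<partial>count_space S) +
    4 * ((\<integral>\<^sup>+x. \<integral>\<^sup>+y. \<integral>\<^sup>+z. of_bool (H x y) * of_bool (H x z) * of_bool (x \<noteq> y \<and> x \<noteq> z \<and> y \<noteq> z)
       \<partial>count_space S \<partial>count_space S \<partial>count_space S) +
      (\<integral>\<^sup>+x. \<integral>\<^sup>+y. of_bool (H x y) * of_bool (x \<noteq> y) \<partial>count_space S \<partial>count_space S))"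
proof -
  let ?S = "count_space S"
  let ?d = "\<lambda>x y z w. of_bool (F x y) * of_bool (F z w) * (of_bool (x \<noteq> y \<and> x \<noteq> z \<and> x \<noteq> w \<and> y \<noteq> z \<and> y \<noteq> w \<and> z \<noteq> w) :: ennreal)"
  let ?h = "\<lambda>x y. of_bool (H x y) :: ennreal"
  let ?n = "\<lambda>x. \<integral>\<^sup>+y. ?h x y \<partial>?S"
  let ?D4 = "\<integral>\<^sup>+x. \<integral>\<^sup>+y. \<integral>\<^sup>+z. \<integral>\<^sup>+w. ?d x y z w \<partial>?S \<partial>?S \<partial>?S \<partial>?S"
  let ?D3 = "\<integral>\<^sup>+x. \<integral>\<^sup>+y. \<integral>\<^sup>+z. of_bool (H x y) * of_bool (H x z) * of_bool (x \<noteq> y \<and> x \<noteq> z \<and> y \<noteq> z) \<partial>?S \<partial>?S \<partial>?S"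
  let ?D2 = "\<integral>\<^sup>+x. \<integral>\<^sup>+y. of_bool (H x y) * of_bool (x \<noteq> y) \<partial>?S \<partial>?S"
  let ?Q = "\<integral>\<^sup>+x. ?n x * ?n x \<partial>?S"
  \<comment> \<open>\<open>F\<close> may fail to be symmetric. Passing to the symmetric relation
    \<open>H\<close> makes incoming and outgoing neighbours equally many, so that all four
    coincidence sums equal \<open>?Q\<close>.\<close>
  have n': "(\<integral>\<^sup>+y. ?h y x \<partial>?S) = ?n x" for x
    using H(1) by (intro nn_integral_cong) auto
  have "(\<integral>\<^sup>+x. \<integral>\<^sup>+y. of_bool (F x y) \<partial>?S \<partial>?S)\<^sup>2 =
      (\<integral>\<^sup>+x. \<integral>\<^sup>+y. \<integral>\<^sup>+z. \<integral>\<^sup>+w. of_bool (F x y) * of_bool (F z w) \<partial>?S \<partial>?S \<partial>?S \<partial>?S)"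
    by (simp add: power2_eq_square nn_integral_cmult nn_integral_multc)
  \<comment> \<open>Pairs with several coincidences are counted more than once on the right, which
    is harmless for an upper bound.\<close>
  also have "\<dots> \<le> (\<integral>\<^sup>+x. \<integral>\<^sup>+y. \<integral>\<^sup>+z. \<integral>\<^sup>+w. ?d x y z w +
      (?h x y * (?h z w * of_bool (x = z)) + ?h x y * (?h z w * of_bool (x = w)) + ?h x y * (?h z w * of_bool (y = z)) + ?h x y * (?h z w * of_bool (y = w))) \<partial>?S \<partial>?S \<partial>?S \<partial>?S)"
  proof (intro nn_integral_mono)
    fix x y z w
    show "of_bool (F x y) * of_bool (F z w) \<le> ?d x y z w +
      (?h x y * (?h z w * of_bool (x = z)) + ?h x y * (?h z w * of_bool (x = w)) + ?h x y * (?h z w * of_bool (y = z)) + ?h x y * (?h z w * of_bool (y = w)))"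
    proof (cases "F x y \<and> F z w")
      case True
      then have "x \<noteq> y" "z \<noteq> w" "H x y" "H z w" using H(2) F by auto
      then show ?thesis using True
        by (cases "x = z"; cases "x = w"; cases "y = z"; cases "y = w") simp_all
    qed auto
  qed
  also have "\<dots> = ?D4 +
     ((\<integral>\<^sup>+x. \<integral>\<^sup>+y. \<integral>\<^sup>+z. \<integral>\<^sup>+w. ?h x y * (?h z w * of_bool (x = z)) \<partial>?S \<partial>?S \<partial>?S \<partial>?S) +
      (\<integral>\<^sup>+x. \<integral>\<^sup>+y. \<integral>\<^sup>+z. \<integral>\<^sup>+w. ?h x y * (?h z w * of_bool (x = w)) \<partial>?S \<partial>?S \<partial>?S \<partial>?S) +
      (\<integral>\<^sup>+x. \<integral>\<^sup>+y. \<integral>\<^sup>+z. \<integral>\<^sup>+w. ?h x y * (?h z w * of_bool (y = z)) \<partial>?S \<partial>?S \<partial>?S \<partial>?S) +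
      (\<integral>\<^sup>+x. \<integral>\<^sup>+y. \<integral>\<^sup>+z. \<integral>\<^sup>+w. ?h x y * (?h z w * of_bool (y = w)) \<partial>?S \<partial>?S \<partial>?S \<partial>?S))"
    by (simp only: nn_integral_add[OF borel_measurable_count_space borel_measurable_count_space])
  also have "(\<integral>\<^sup>+x. \<integral>\<^sup>+y. \<integral>\<^sup>+z. \<integral>\<^sup>+w. ?h x y * (?h z w * of_bool (x = z)) \<partial>?S \<partial>?S \<partial>?S \<partial>?S) = ?Q"
    by (intro nn_integral_cong)
       (simp add: nn_integral_cmult nn_integral_multc nn_integral_count_space_eq_point)
  also have "(\<integral>\<^sup>+x. \<integral>\<^sup>+y. \<integral>\<^sup>+z. \<integral>\<^sup>+w. ?h x y * (?h z w * of_bool (x = w)) \<partial>?S \<partial>?S \<partial>?S \<partial>?S) = ?Q"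
    by (intro nn_integral_cong)
       (simp add: nn_integral_cmult nn_integral_multc nn_integral_count_space_eq_point n')
  also have "(\<integral>\<^sup>+x. \<integral>\<^sup>+y. \<integral>\<^sup>+z. \<integral>\<^sup>+w. ?h x y * (?h z w * of_bool (y = z)) \<partial>?S \<partial>?S \<partial>?S \<partial>?S) = ?Q"
    by (subst nn_integral_count_space_Fubini, intro nn_integral_cong)
       (simp add: nn_integral_cmult nn_integral_multc nn_integral_count_space_eq_point n')
  also have "(\<integral>\<^sup>+x. \<integral>\<^sup>+y. \<integral>\<^sup>+z. \<integral>\<^sup>+w. ?h x y * (?h z w * of_bool (y = w)) \<partial>?S \<partial>?S \<partial>?S \<partial>?S) = ?Q"
    by (subst nn_integral_count_space_Fubini, intro nn_integral_cong)
       (simp add: nn_integral_cmult nn_integral_multc nn_integral_count_space_eq_point n')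
  also have "?Q + ?Q + ?Q + ?Q = 4 * ?Q"
  proof -
    have "(4 :: ennreal) = 1 + 1 + 1 + 1" by simp
    then show ?thesis by (simp only: distrib_right mult_1)
  qed
  also have "?Q = (\<integral>\<^sup>+x. \<integral>\<^sup>+y. \<integral>\<^sup>+z. ?h x y * ?h x z \<partial>?S \<partial>?S \<partial>?S)"
    by (simp add: nn_integral_cmult nn_integral_multc)
  \<comment> \<open>The two partners of \<open>x\<close> in \<open>?Q\<close> are either distinct,
    which gives triples, or equal, which gives pairs.\<close>
  also have "\<dots> \<le> (\<integral>\<^sup>+x. \<integral>\<^sup>+y. \<integral>\<^sup>+z. of_bool (H x y) * of_bool (H x z) * of_bool (x \<noteq> y \<and> x \<noteq> z \<and> y \<noteq> z) +
      (of_bool (H x y) * of_bool (x \<noteq> y)) * of_bool (y = z) \<partial>?S \<partial>?S \<partial>?S)"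
    using H(2) by (intro nn_integral_mono) auto
  also have "\<dots> = ?D3 + (\<integral>\<^sup>+x. \<integral>\<^sup>+y. \<integral>\<^sup>+z. (of_bool (H x y) * of_bool (x \<noteq> y)) * of_bool (y = z) \<partial>?S \<partial>?S \<partial>?S)"
    by (simp only: nn_integral_add[OF borel_measurable_count_space borel_measurable_count_space])
  also have "(\<integral>\<^sup>+x. \<integral>\<^sup>+y. \<integral>\<^sup>+z. (of_bool (H x y) * of_bool (x \<noteq> y)) * of_bool (y = z) \<partial>?S \<partial>?S \<partial>?S) = ?D2"
    by (intro nn_integral_cong) (simp add: nn_integral_count_space_eq_point)
  finally show ?thesis by (simp add: mult_left_mono)
qed

text \<open>Since \<open>|u|^2\<close> is at most \<open>2 * |u + v|^2 + 2 * |v|^2\<close>, a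
  bounded shift costs half of the decay rate and a constant factor. This replaces the four Gaussians
  linking two short pairs by a single one.\<close>

lemma gaussian_shift_le:
  fixes u v :: complex
  assumes "cmod v \<le> 2 * r"
  shows "exp (- pi * (cmod (u + v))\<^sup>2 / 2) \<le> exp (2 * pi * r\<^sup>2) * exp (- (pi / 4) * (cmod u)\<^sup>2)"
proof -
  have "cmod u \<le> cmod (u + v) + cmod v"
    using norm_triangle_ineq4[of "u + v" v] by simp
  then have "(cmod u)\<^sup>2 \<le> (cmod (u + v) + cmod v)\<^sup>2"
    by (rule power_mono) simp
  also have "\<dots> \<le> 2 * (cmod (u + v))\<^sup>2 + 2 * (cmod v)\<^sup>2"
    using sum_squares_bound[of "cmod (u + v)" "cmod v"] by (simp add: power2_sum)
  also have "(cmod v)\<^sup>2 \<le> (2 * r)\<^sup>2"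
    using assms by (intro power_mono) auto
  finally have "(cmod u)\<^sup>2 \<le> 2 * (cmod (u + v))\<^sup>2 + 8 * r\<^sup>2"
    by (simp add: power_mult_distrib)
  then have "pi * (cmod u)\<^sup>2 \<le> pi * (2 * (cmod (u + v))\<^sup>2 + 8 * r\<^sup>2)"
    by (intro mult_left_mono) auto
  then show ?thesis
    unfolding mult_exp_exp by (simp add: algebra_simps)
qed

text \<open>Written with iterated counting integrals to match the moment formulas. The diagonal is
  excluded here and returns at the end as the mass at the origin.\<close>

definition pair_count :: "complex set \<Rightarrow> real \<Rightarrow> complex set \<Rightarrow> ennreal" where
  "pair_count A R S = (\<integral>\<^sup>+x. \<integral>\<^sup>+y. of_bool (x \<in> ball 0 R \<and> y \<in> ball 0 R \<and> x - y \<in> A) * of_bool (x \<noteq> y)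
      \<partial>count_space S \<partial>count_space S)"

definition ginibre_pair_mean :: "complex set \<Rightarrow> real \<Rightarrow> ennreal" where
  "ginibre_pair_mean A R = (\<integral>\<^sup>+x. \<integral>\<^sup>+y. of_bool (x \<in> ball 0 R \<and> y \<in> ball 0 R \<and> x - y \<in> A) *
      ennreal (1 - exp (- pi * (cmod (x - y))\<^sup>2)) \<partial>lborel \<partial>lborel)"

text \<open>The absolutely continuous part of the limit measure, kept apart from the atom because
  pairs of distinct points see only this part.\<close>

definition truncated_density :: "complex measure" where
  "truncated_density = density lborel (\<lambda>x. ennreal (1 - exp (- pi * (cmod x)\<^sup>2)))"

lemma sets_truncated_density [simp, measurable_cong]: "sets truncated_density = sets borel"
  by (simp add: truncated_density_def)

text \<open>Without the constraint on \<open>y\<close>, the double integral is an area times a mass,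
  by translation invariance. The constraint is automatic for \<open>x\<close> in the disc of radius
  \<open>R - r\<close>, since \<open>y\<close> is closer to \<open>x\<close> than \<open>r\<close>.
  The two bounds thus differ only by a boundary layer.\<close>

lemma ginibre_pair_mean_bounds:
  assumes A: "A \<in> sets borel" "A \<subseteq> ball 0 r"
  shows "ginibre_pair_mean A R \<le> emeasure lborel (ball (0 :: complex) R) * emeasure truncated_density A"
    and "emeasure lborel (ball (0 :: complex) (R - r)) * emeasure truncated_density A \<le> ginibre_pair_mean A R"
proof -
  note [measurable] = A(1)
  let ?g = "\<lambda>u. indicator A u * ennreal (1 - exp (- pi * (cmod u)\<^sup>2))"
  have c: "emeasure truncated_density A = (\<integral>\<^sup>+u. ?g u \<partial>lborel)"
    unfolding truncated_density_def using A(1) by (simp add: emeasure_density mult.commute)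
  have conv: "(\<integral>\<^sup>+x. \<integral>\<^sup>+y. indicator (ball 0 s) x * ?g (x - y) \<partial>lborel \<partial>lborel) =
      emeasure lborel (ball (0 :: complex) s) * emeasure truncated_density A" for s
  proof -
    have "(\<integral>\<^sup>+y. indicator (ball 0 s) x * ?g (x - y) \<partial>lborel) = indicator (ball 0 s) x * emeasure truncated_density A" for x
    proof -
      have "(\<integral>\<^sup>+y. indicator (ball 0 s) x * ?g (x - y) \<partial>lborel) = indicator (ball 0 s) x * (\<integral>\<^sup>+y. ?g (x - y) \<partial>lborel)"
        by (rule nn_integral_cmult) measurable
      also have "(\<integral>\<^sup>+y. ?g (x - y) \<partial>lborel) = (\<integral>\<^sup>+u. ?g u \<partial>lborel)"
        by (rule nn_integral_lborel_diff) measurable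
      finally show ?thesis unfolding c .
    qed
    moreover have "(indicator (ball 0 s) :: complex \<Rightarrow> ennreal) \<in> borel_measurable lborel"
      by (simp add: borel_measurable_indicator)
    ultimately show ?thesis by (simp only: nn_integral_multc nn_integral_indicator sets_lborel borel_open open_ball)
  qed
  show "ginibre_pair_mean A R \<le> emeasure lborel (ball (0 :: complex) R) * emeasure truncated_density A"
    unfolding conv[symmetric] ginibre_pair_mean_def
    by (intro nn_integral_mono) (auto simp: indicator_def)
  show "emeasure lborel (ball (0 :: complex) (R - r)) * emeasure truncated_density A \<le> ginibre_pair_mean A R"
    unfolding conv[symmetric] ginibre_pair_mean_def
  proof (intro nn_integral_mono)
    fix x y :: complex
    show "indicator (ball 0 (R - r)) x * ?g (x - y) \<le>
       of_bool (x \<in> ball 0 R \<and> y \<in> ball 0 R \<and> x - y \<in> A) * ennreal (1 - exp (- pi * (cmod (x - y))\<^sup>2))"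
    proof (cases "x \<in> ball 0 (R - r) \<and> x - y \<in> A")
      case True
      then have "cmod (x - y) < r" "cmod x < R - r" using A(2) by auto
      moreover have "cmod y \<le> cmod x + cmod (x - y)"
        using norm_triangle_ineq4[of x "x - y"] by simp
      moreover have "0 \<le> cmod (x - y)" by simp
      ultimately have "x \<in> ball 0 R" "y \<in> ball 0 R" unfolding mem_ball dist_0_norm by linarith+
      then show ?thesis using True by simp
    qed auto
  qed
qed

text \<open>The factoring part integrates to the squared mean. In the linking part only
  \<open>x\<close> ranges over the large disc: \<open>y\<close> is tied to \<open>x\<close> and
  \<open>w\<close> to \<open>z\<close> by discs of radius \<open>r\<close>, and \<open>z\<close> to
  \<open>x\<close> by a Gaussian, so a single factor of the area remains.\<close>

lemma four_fold_integral_le: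
  fixes r R :: real
  assumes A: "A \<in> sets borel" "A \<subseteq> ball 0 r"
  defines "k \<equiv> \<lambda>z w. exp (- pi * (cmod (z - w))\<^sup>2 / 2)"
    and "G \<equiv> \<lambda>x y. x \<in> ball 0 R \<and> y \<in> ball 0 R \<and> x - y \<in> A"
  shows "(\<integral>\<^sup>+x. \<integral>\<^sup>+y. \<integral>\<^sup>+z. \<integral>\<^sup>+w. (of_bool (G x y) * of_bool (G z w)) *
        ennreal ((1 - exp (- pi * (cmod (x - y))\<^sup>2)) * (1 - exp (- pi * (cmod (z - w))\<^sup>2)) +
          24 * (k x z + k x w + k y z + k y w)) \<partial>lborel \<partial>lborel \<partial>lborel \<partial>lborel) \<le>
     (ginibre_pair_mean A R)\<^sup>2 + ennreal (384 * exp (2 * pi * r\<^sup>2)) * (emeasure lborel (ball (0 :: complex) r))\<^sup>2 *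
        emeasure lborel (ball (0 :: complex) R)"
proof -
  note [measurable] = A(1)
  define B where "B = ball (0 :: complex) R"
  define D where "D = ball (0 :: complex) r"
  have [measurable]: "B \<in> sets borel" "D \<in> sets borel"
    by (simp_all add: B_def D_def)
  define a where "a = (\<lambda>x y. of_bool (G x y) * ennreal (1 - exp (- pi * (cmod (x - y))\<^sup>2)))"
  define \<kappa> where "\<kappa> = (\<lambda>u :: complex. ennreal (exp (- (pi / 4) * (cmod u)\<^sup>2)))"
  have [measurable]: "\<kappa> \<in> borel_measurable borel"
    unfolding \<kappa>_def by measurable
  let ?V = "emeasure lborel D"
  let ?p = "indicator B :: complex \<Rightarrow> ennreal"
  let ?q = "indicator D :: complex \<Rightarrow> ennreal"
  \<comment> \<open>96 = 4 * 24: each of the four linking Gaussians is bounded by the same Gaussian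
    in \<open>x - z\<close>; the exponential is the cost of the shift in
    \<open>gaussian_shift_le\<close>.\<close>
  let ?c = "96 * exp (2 * pi * r\<^sup>2)"
  have mean: "ginibre_pair_mean A R = (\<integral>\<^sup>+x. \<integral>\<^sup>+y. a x y \<partial>lborel \<partial>lborel)"
    by (simp add: ginibre_pair_mean_def G_def a_def)
  have "a x y = indicator B x * indicator B y * indicator A (x - y) * ennreal (1 - exp (- pi * (cmod (x - y))\<^sup>2))" for x y
    by (auto simp: a_def G_def B_def)
  then have [measurable]: "(\<lambda>(x, y). a x y) \<in> borel_measurable (borel \<Otimes>\<^sub>M borel)"
    by simp
  have "(\<integral>\<^sup>+x. \<integral>\<^sup>+y. \<integral>\<^sup>+z. \<integral>\<^sup>+w. (of_bool (G x y) * of_bool (G z w)) *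
        ennreal ((1 - exp (- pi * (cmod (x - y))\<^sup>2)) * (1 - exp (- pi * (cmod (z - w))\<^sup>2)) +
          24 * (k x z + k x w + k y z + k y w)) \<partial>lborel \<partial>lborel \<partial>lborel \<partial>lborel) \<le>
     (\<integral>\<^sup>+x. \<integral>\<^sup>+y. \<integral>\<^sup>+z. \<integral>\<^sup>+w. a x y * a z w + ennreal ?c * (?p x * (?q (x - y) * (\<kappa> (x - z) * ?q (z - w)))) \<partial>lborel \<partial>lborel \<partial>lborel \<partial>lborel)"
  proof (intro nn_integral_mono)
    fix x y z w :: complex
    show "(of_bool (G x y) * of_bool (G z w)) *
        ennreal ((1 - exp (- pi * (cmod (x - y))\<^sup>2)) * (1 - exp (- pi * (cmod (z - w))\<^sup>2)) +
          24 * (k x z + k x w + k y z + k y w)) \<le>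
        a x y * a z w + ennreal ?c * (?p x * (?q (x - y) * (\<kappa> (x - z) * ?q (z - w))))"
    proof (cases "G x y \<and> G z w")
      case True
      then have xy: "cmod (x - y) < r" and zw: "cmod (z - w) < r" and x: "x \<in> ball 0 R"
        using A(2) by (auto simp: G_def)
      define E where "E = exp (2 * pi * r\<^sup>2) * exp (- (pi / 4) * (cmod (x - z))\<^sup>2)"
      have "0 < r" using xy norm_ge_zero[of "x - y"] by linarith
      \<comment> \<open>Each linking Gaussian joins a point within \<open>r\<close> of
        \<open>x\<close> to a point within \<open>r\<close> of \<open>z\<close>, so its argument
        differs from \<open>x - z\<close> by at most \<open>2 * r\<close>.\<close>
      have bound: "k s t \<le> E" if "cmod ((s - t) - (x - z)) \<le> 2 * r" for s t
        using gaussian_shift_le[OF that, of "x - z"] by (simp add: k_def E_def)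
      have "k x z \<le> E"
        by (rule bound) (use \<open>0 < r\<close> in simp)
      moreover have "k x w \<le> E"
        by (rule bound) (use zw \<open>0 < r\<close> in simp)
      moreover have "k y z \<le> E"
        by (rule bound) (use xy \<open>0 < r\<close> in \<open>simp add: norm_minus_commute\<close>)
      moreover have "k y w \<le> E"
      proof (rule bound)
        have eq: "(y - w) - (x - z) = (z - w) - (x - y)" by simp
        show "cmod ((y - w) - (x - z)) \<le> 2 * r"
          unfolding eq using norm_triangle_ineq4[of "z - w" "x - y"] xy zw by simp
      qed
      ultimately have "k x z + k x w + (k y z + k y w) \<le> (E + E) + (E + E)"
        by (intro add_mono)
      then have "24 * (k x z + k x w + k y z + k y w) \<le> 96 * E"
        by simp
      then have "ennreal ((1 - exp (- pi * (cmod (x - y))\<^sup>2)) * (1 - exp (- pi * (cmod (z - w))\<^sup>2)) +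
          24 * (k x z + k x w + k y z + k y w)) \<le>
         ennreal ((1 - exp (- pi * (cmod (x - y))\<^sup>2)) * (1 - exp (- pi * (cmod (z - w))\<^sup>2)) + 96 * E)"
        by (intro ennreal_leI add_left_mono)
      also have "\<dots> = a x y * a z w + ennreal ?c * (?p x * (?q (x - y) * (\<kappa> (x - z) * ?q (z - w))))"
        using True xy zw x by (simp add: ennreal_mult' mult.assoc a_def \<kappa>_def B_def D_def E_def)
      finally show ?thesis using True by simp
    next
      case False
      then show ?thesis by (auto simp: a_def)
    qed
  qed
  also have "\<dots> = (\<integral>\<^sup>+x. \<integral>\<^sup>+y. \<integral>\<^sup>+z. \<integral>\<^sup>+w. a x y * a z w \<partial>lborel \<partial>lborel \<partial>lborel \<partial>lborel) +
      (\<integral>\<^sup>+x. \<integral>\<^sup>+y. \<integral>\<^sup>+z. \<integral>\<^sup>+w. ennreal ?c * (?p x * (?q (x - y) * (\<kappa> (x - z) * ?q (z - w)))) \<partial>lborel \<partial>lborel \<partial>lborel \<partial>lborel)"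
    by (simp add: nn_integral_add)
  also have "(\<integral>\<^sup>+x. \<integral>\<^sup>+y. \<integral>\<^sup>+z. \<integral>\<^sup>+w. a x y * a z w \<partial>lborel \<partial>lborel \<partial>lborel \<partial>lborel) = (ginibre_pair_mean A R)\<^sup>2"
    by (simp add: mean nn_integral_cmult nn_integral_multc power2_eq_square)
  also have "(\<integral>\<^sup>+x. \<integral>\<^sup>+y. \<integral>\<^sup>+z. \<integral>\<^sup>+w. ennreal ?c * (?p x * (?q (x - y) * (\<kappa> (x - z) * ?q (z - w)))) \<partial>lborel \<partial>lborel \<partial>lborel \<partial>lborel) =
      ennreal ?c * (emeasure lborel B * (?V * (ennreal 4 * ?V)))"
  proof -
    have q: "(\<integral>\<^sup>+w. ?q (z - w) \<partial>lborel) = ?V" for z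
      by (simp add: nn_integral_lborel_diff)
    have \<kappa>: "(\<integral>\<^sup>+w. \<kappa> (z - w) \<partial>lborel) = ennreal 4" for z
    proof -
      have "(\<integral>\<^sup>+w. \<kappa> (z - w) \<partial>lborel) = (\<integral>\<^sup>+w. \<kappa> w \<partial>lborel)"
        by (rule nn_integral_lborel_diff) measurable
      then show ?thesis
        using nn_integral_gaussian[of "pi / 4"] by (simp add: \<kappa>_def)
    qed
    show ?thesis
      by (simp add: nn_integral_cmult nn_integral_multc q \<kappa>[simplified])
  qed
  also have "ennreal ?c * (emeasure lborel B * (?V * (ennreal 4 * ?V))) =
      ennreal (384 * exp (2 * pi * r\<^sup>2)) * ?V\<^sup>2 * emeasure lborel B"
  proof -
    \<comment> \<open>384 = 96 * 4, where 4 is the integral of \<open>\<kappa>\<close>, namely pi /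
      (pi / 4).\<close>
    have "ennreal (384 * exp (2 * pi * r\<^sup>2)) = ennreal ?c * ennreal 4"
      by (subst ennreal_mult[symmetric]) auto
    then show ?thesis by (simp only: power2_eq_square mult_ac)
  qed
  finally show ?thesis unfolding B_def D_def .
qed


context ginibre
begin

lemma
  assumes A: "A \<in> sets borel"
  shows measurable_pair_count: "(\<lambda>\<omega>. pair_count A R (X \<omega>)) \<in> borel_measurable M"
    and expectation_pair_count: "(\<integral>\<^sup>+\<omega>. pair_count A R (X \<omega>) \<partial>M) = ginibre_pair_mean A R"
proof -
  note [measurable] = A
  define B where "B = ball (0 :: complex) R"
  have [measurable]: "B \<in> sets borel" by (simp add: B_def)
  have "(\<lambda>x. indicator B (x 1) * indicator B (x 0) * indicator A (x 1 - x 0) :: ennreal) \<in> borel_measurable (\<Pi>\<^sub>M i\<in>{..<2::nat}. borel)"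
    by measurable
  also have "(\<lambda>x :: nat \<Rightarrow> complex. indicator B (x 1) * indicator B (x 0) * indicator A (x 1 - x 0) :: ennreal) =
      (\<lambda>x. of_bool (x 1 \<in> ball 0 R \<and> x 0 \<in> ball 0 R \<and> x 1 - x 0 \<in> A))"
    by (auto simp: fun_eq_iff B_def)
  finally have "(\<lambda>x :: nat \<Rightarrow> complex. of_bool (x 1 \<in> ball 0 R \<and> x 0 \<in> ball 0 R \<and> x 1 - x 0 \<in> A) :: ennreal) \<in> borel_measurable (\<Pi>\<^sub>M i\<in>{..<2::nat}. borel)" .
  from moment_2[of "\<lambda>x y. of_bool (x \<in> ball 0 R \<and> y \<in> ball 0 R \<and> x - y \<in> A)", OF this]
  show "(\<lambda>\<omega>. pair_count A R (X \<omega>)) \<in> borel_measurable M"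
    and "(\<integral>\<^sup>+\<omega>. pair_count A R (X \<omega>) \<partial>M) = ginibre_pair_mean A R"
    unfolding pair_count_def ginibre_pair_mean_def .
qed

text \<open>The squared mean appears with coefficient one, so the rest bounds the variance by a
  constant times the area. In that constant the leading 4 counts the ways in which two pairs can
  share an endpoint, \<open>6 * V^2\<close> comes from triples and \<open>V\<close> from coinciding
  pairs.\<close>

lemma second_moment_pair_count:
  fixes r :: real
  assumes A: "A \<in> sets borel" "A \<subseteq> ball 0 r"
  defines "V \<equiv> emeasure lborel (ball (0 :: complex) r)"
  shows "(\<integral>\<^sup>+\<omega>. (pair_count A R (X \<omega>))\<^sup>2 \<partial>M) \<le> (ginibre_pair_mean A R)\<^sup>2 +
    (ennreal (384 * exp (2 * pi * r\<^sup>2)) * V\<^sup>2 + 4 * (6 * V\<^sup>2 + V)) * emeasure lborel (ball (0 :: complex) R)"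
proof -
  note [measurable] = A(1)
  define B where "B = ball (0 :: complex) R"
  define D where "D = ball (0 :: complex) r"
  have [measurable]: "B \<in> sets borel" "D \<in> sets borel"
    by (simp_all add: B_def D_def)
  have V: "V = emeasure lborel D" by (simp add: V_def D_def)
  let ?vol = "emeasure lborel B"
  let ?G = "\<lambda>x y. x \<in> ball 0 R \<and> y \<in> ball 0 R \<and> x - y \<in> A"
  \<comment> \<open>The error terms use the disc \<open>D\<close> in place of \<open>A\<close>: it
    is symmetric, so \<open>?H\<close> is a symmetric relation that contains
    \<open>?F\<close>.\<close>
  let ?K = "\<lambda>x y. x \<in> B \<and> y \<in> B \<and> x - y \<in> D"
  let ?F = "\<lambda>x y. ?G x y \<and> x \<noteq> y"
  let ?H = "\<lambda>x y. ?K x y \<and> x \<noteq> y"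
  let ?D4 = "\<lambda>\<omega>. \<integral>\<^sup>+x. \<integral>\<^sup>+y. \<integral>\<^sup>+z. \<integral>\<^sup>+w. of_bool (?G x y) * of_bool (?G z w) *
       of_bool (x \<noteq> y \<and> x \<noteq> z \<and> x \<noteq> w \<and> y \<noteq> z \<and> y \<noteq> w \<and> z \<noteq> w)
       \<partial>count_space (X \<omega>) \<partial>count_space (X \<omega>) \<partial>count_space (X \<omega>) \<partial>count_space (X \<omega>) :: ennreal"
  let ?D3 = "\<lambda>\<omega>. \<integral>\<^sup>+x. \<integral>\<^sup>+y. \<integral>\<^sup>+z. of_bool (?K x y) * of_bool (?K x z) * of_bool (x \<noteq> y \<and> x \<noteq> z \<and> y \<noteq> z)
       \<partial>count_space (X \<omega>) \<partial>count_space (X \<omega>) \<partial>count_space (X \<omega>) :: ennreal"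
  let ?D2 = "\<lambda>\<omega>. \<integral>\<^sup>+x. \<integral>\<^sup>+y. of_bool (?K x y) * of_bool (x \<noteq> y) \<partial>count_space (X \<omega>) \<partial>count_space (X \<omega>) :: ennreal"
  have H_sym: "?H x y \<longleftrightarrow> ?H y x" for x y
    by (auto simp: D_def norm_minus_commute)
  have F_H: "?F x y \<Longrightarrow> ?H x y" for x y
    using A(2) by (auto simp: B_def D_def)
  have pointwise: "(pair_count A R (X \<omega>))\<^sup>2 \<le> ?D4 \<omega> + 4 * (?D3 \<omega> + ?D2 \<omega>)" for \<omega>
  proof -
    have "(pair_count A R (X \<omega>))\<^sup>2 = (\<integral>\<^sup>+x. \<integral>\<^sup>+y. of_bool (?F x y) \<partial>count_space (X \<omega>) \<partial>count_space (X \<omega>))\<^sup>2"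
      unfolding pair_count_def by (intro arg_cong[where f="\<lambda>t. t\<^sup>2"] nn_integral_cong) auto
    also note pair_count_square_le[of ?H ?F, OF H_sym _ F_H]
    also have "(\<integral>\<^sup>+x. \<integral>\<^sup>+y. \<integral>\<^sup>+z. \<integral>\<^sup>+w. of_bool (?F x y) * of_bool (?F z w) *
       of_bool (x \<noteq> y \<and> x \<noteq> z \<and> x \<noteq> w \<and> y \<noteq> z \<and> y \<noteq> w \<and> z \<noteq> w)
       \<partial>count_space (X \<omega>) \<partial>count_space (X \<omega>) \<partial>count_space (X \<omega>) \<partial>count_space (X \<omega>)) = ?D4 \<omega>"
      by (intro nn_integral_cong) auto
    also have "(\<integral>\<^sup>+x. \<integral>\<^sup>+y. \<integral>\<^sup>+z. of_bool (?H x y) * of_bool (?H x z) * of_bool (x \<noteq> y \<and> x \<noteq> z \<and> y \<noteq> z)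
       \<partial>count_space (X \<omega>) \<partial>count_space (X \<omega>) \<partial>count_space (X \<omega>)) = ?D3 \<omega>"
      by (intro nn_integral_cong) auto
    also have "(\<integral>\<^sup>+x. \<integral>\<^sup>+y. of_bool (?H x y) * of_bool (x \<noteq> y) \<partial>count_space (X \<omega>) \<partial>count_space (X \<omega>)) = ?D2 \<omega>"
      by (intro nn_integral_cong) auto
    finally show ?thesis by blast
  qed
  have G_meas: "(\<lambda>x. of_bool (?G (x i) (x j)) :: ennreal) \<in> borel_measurable (\<Pi>\<^sub>M i\<in>{..<n::nat}. borel)"
    if "i < n" "j < n" for i j n
  proof -
    have [measurable]: "(\<lambda>x. x i) \<in> (\<Pi>\<^sub>M i\<in>{..<n::nat}. borel) \<rightarrow>\<^sub>M (borel :: complex measure)"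
        "(\<lambda>x. x j) \<in> (\<Pi>\<^sub>M i\<in>{..<n::nat}. borel) \<rightarrow>\<^sub>M (borel :: complex measure)"
      using that by (auto intro: measurable_component_singleton)
    have "(\<lambda>x. of_bool (?G (x i) (x j)) :: ennreal) = (\<lambda>x. indicator B (x i) * indicator B (x j) * indicator A (x i - x j))"
      by (auto simp: fun_eq_iff B_def)
    then show ?thesis by simp
  qed
  have K_meas: "(\<lambda>x. of_bool (?K (x i) (x j)) :: ennreal) \<in> borel_measurable (\<Pi>\<^sub>M i\<in>{..<n::nat}. borel)"
    if "i < n" "j < n" for i j n
  proof -
    have [measurable]: "(\<lambda>x. x i) \<in> (\<Pi>\<^sub>M i\<in>{..<n::nat}. borel) \<rightarrow>\<^sub>M (borel :: complex measure)"
        "(\<lambda>x. x j) \<in> (\<Pi>\<^sub>M i\<in>{..<n::nat}. borel) \<rightarrow>\<^sub>M (borel :: complex measure)"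
      using that by (auto intro: measurable_component_singleton)
    have "(\<lambda>x. of_bool (?K (x i) (x j)) :: ennreal) = (\<lambda>x. indicator B (x i) * indicator B (x j) * indicator D (x i - x j))"
      by (auto simp: fun_eq_iff)
    then show ?thesis by simp
  qed
  note m4 = moment_4[of "\<lambda>x y z w. of_bool (?G x y) * of_bool (?G z w)", OF borel_measurable_times_ennreal[OF G_meas G_meas]]
  note m3 = moment_3[of "\<lambda>x y z. of_bool (?K x y) * of_bool (?K x z)", OF borel_measurable_times_ennreal[OF K_meas K_meas]]
  note m2 = moment_2[of "\<lambda>x y. of_bool (?K x y)", OF K_meas]
  have [measurable]: "?D4 \<in> borel_measurable M" "?D3 \<in> borel_measurable M" "?D2 \<in> borel_measurable M"
    using m4(1) m3(1) m2(1) by simp_all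
  have q: "(\<integral>\<^sup>+y. indicator D (x - y) \<partial>lborel) = V" for x
  proof -
    have "(\<integral>\<^sup>+y. indicator D (x - y) \<partial>lborel) = (\<integral>\<^sup>+y. indicator D y \<partial>lborel)"
      by (intro nn_integral_lborel_diff borel_measurable_indicator) measurable
    then show ?thesis by (simp add: V)
  qed
  have D4: "(\<integral>\<^sup>+\<omega>. ?D4 \<omega> \<partial>M) \<le> (ginibre_pair_mean A R)\<^sup>2 + ennreal (384 * exp (2 * pi * r\<^sup>2)) * V\<^sup>2 * ?vol"
    unfolding V_def B_def by (rule order.trans[OF m4(2) four_fold_integral_le[OF A]]) simp_all
  have "(\<integral>\<^sup>+\<omega>. ?D3 \<omega> \<partial>M) \<le> (\<integral>\<^sup>+x. \<integral>\<^sup>+y. \<integral>\<^sup>+z. of_bool (?K x y) * of_bool (?K x z) * 6 \<partial>lborel \<partial>lborel \<partial>lborel)"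
    using m3(2) by simp
  also have "\<dots> \<le> (\<integral>\<^sup>+x. \<integral>\<^sup>+y. \<integral>\<^sup>+z. indicator B x * (indicator D (x - y) * (indicator D (x - z) * 6)) \<partial>lborel \<partial>lborel \<partial>lborel)"
    by (intro nn_integral_mono) auto
  also have "\<dots> = ?vol * (V * (V * 6))"
    by (simp add: nn_integral_cmult nn_integral_multc q)
  finally have D3: "(\<integral>\<^sup>+\<omega>. ?D3 \<omega> \<partial>M) \<le> 6 * V\<^sup>2 * ?vol"
    by (simp add: power2_eq_square mult_ac)
  have "(\<integral>\<^sup>+\<omega>. ?D2 \<omega> \<partial>M) \<le> (\<integral>\<^sup>+x. \<integral>\<^sup>+y. of_bool (?K x y) * ennreal (1 - exp (- pi * (cmod (x - y))\<^sup>2)) \<partial>lborel \<partial>lborel)"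
    using m2(2) by simp
  also have "\<dots> \<le> (\<integral>\<^sup>+x. \<integral>\<^sup>+y. indicator B x * indicator D (x - y) \<partial>lborel \<partial>lborel)"
    by (intro nn_integral_mono) (auto simp: ennreal_le_1)
  also have "\<dots> = ?vol * V"
    by (simp add: nn_integral_cmult nn_integral_multc q)
  finally have D2: "(\<integral>\<^sup>+\<omega>. ?D2 \<omega> \<partial>M) \<le> V * ?vol"
    by (simp add: mult_ac)
  have "(\<integral>\<^sup>+\<omega>. (pair_count A R (X \<omega>))\<^sup>2 \<partial>M) \<le> (\<integral>\<^sup>+\<omega>. ?D4 \<omega> + 4 * (?D3 \<omega> + ?D2 \<omega>) \<partial>M)"
    by (intro nn_integral_mono pointwise)
  also have "\<dots> = (\<integral>\<^sup>+\<omega>. ?D4 \<omega> \<partial>M) + 4 * ((\<integral>\<^sup>+\<omega>. ?D3 \<omega> \<partial>M) + (\<integral>\<^sup>+\<omega>. ?D2 \<omega> \<partial>M))"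
  proof -
    have "(\<integral>\<^sup>+\<omega>. f \<omega> + 4 * (g \<omega> + h \<omega>) \<partial>M) = (\<integral>\<^sup>+\<omega>. f \<omega> \<partial>M) + 4 * ((\<integral>\<^sup>+\<omega>. g \<omega> \<partial>M) + (\<integral>\<^sup>+\<omega>. h \<omega> \<partial>M))"
      if [measurable]: "f \<in> borel_measurable M" "g \<in> borel_measurable M" "h \<in> borel_measurable M"
      for f g h :: "'w \<Rightarrow> ennreal"
      by (simp add: nn_integral_add nn_integral_cmult)
    then show ?thesis by this fact+
  qed
  also have "\<dots> \<le> ((ginibre_pair_mean A R)\<^sup>2 + ennreal (384 * exp (2 * pi * r\<^sup>2)) * V\<^sup>2 * ?vol) + 4 * (6 * V\<^sup>2 * ?vol + V * ?vol)"
    by (intro add_mono mult_left_mono D4 D3 D2) auto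
  also have "\<dots> = (ginibre_pair_mean A R)\<^sup>2 + (ennreal (384 * exp (2 * pi * r\<^sup>2)) * V\<^sup>2 + 4 * (6 * V\<^sup>2 + V)) * ?vol"
    by (simp only: distrib_left distrib_right mult.assoc add.assoc)
  finally show ?thesis unfolding B_def .
qed

end

section \<open>Almost sure limits\<close>

text \<open>A variance of order \<open>n\<^sup>2\<close> makes the expected squares of the normalised errors summable.\<close>

lemma AE_tendsto_of_variance_bound:
  fixes T :: "nat \<Rightarrow> 'w \<Rightarrow> ennreal" and m :: "nat \<Rightarrow> real"
  assumes "prob_space M" and [measurable]: "\<And>n. T n \<in> borel_measurable M"
    and mean: "\<And>n. (\<integral>\<^sup>+\<omega>. T n \<omega> \<partial>M) = ennreal (m n)" and m: "\<And>n. 0 \<le> m n"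
    and second: "\<And>n. (\<integral>\<^sup>+\<omega>. (T n \<omega>)\<^sup>2 \<partial>M) \<le> ennreal ((m n)\<^sup>2 + C * (real n)\<^sup>2)" and C: "0 \<le> C"
  shows "AE \<omega> in M. (\<lambda>n. (enn2real (T n \<omega>) - m n) / (real n)\<^sup>2) \<longlonglongrightarrow> 0"
proof -
  interpret prob_space M by fact
  define t where "t n \<omega> = enn2real (T n \<omega>)" for n \<omega>
  have [measurable]: "t n \<in> borel_measurable M" for n
    unfolding t_def by measurable
  have t_nonneg: "0 \<le> t n \<omega>" for n \<omega>
    by (simp add: t_def)
  have fin: "AE \<omega> in M. T n \<omega> = ennreal (t n \<omega>)" for n
  proof -
    have "AE \<omega> in M. T n \<omega> \<noteq> \<infinity>"
      by (rule nn_integral_PInf_AE) (simp_all add: mean)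
    then show ?thesis by eventually_elim (simp add: t_def ennreal_enn2real less_top)
  qed
  have int1: "has_bochner_integral M (t n) (m n)" for n
  proof (rule has_bochner_integral_nn_integral)
    show "(\<integral>\<^sup>+\<omega>. ennreal (t n \<omega>) \<partial>M) = ennreal (m n)"
      unfolding mean[symmetric] using fin[of n] by (intro nn_integral_cong_AE) auto
  qed (auto simp: t_def m)
  have nn2: "(\<integral>\<^sup>+\<omega>. ennreal ((t n \<omega>)\<^sup>2) \<partial>M) \<le> ennreal ((m n)\<^sup>2 + C * (real n)\<^sup>2)" for n
  proof -
    have "(\<integral>\<^sup>+\<omega>. ennreal ((t n \<omega>)\<^sup>2) \<partial>M) = (\<integral>\<^sup>+\<omega>. (T n \<omega>)\<^sup>2 \<partial>M)"
      by (intro nn_integral_cong_AE) (use fin[of n] in \<open>eventually_elim, simp add: ennreal_power t_nonneg\<close>)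
    then show ?thesis using second by simp
  qed
  have int2: "integrable M (\<lambda>\<omega>. (t n \<omega>)\<^sup>2)" for n
    using nn2[of n] by (intro integrableI_nonneg) (auto simp: less_top[symmetric] top_unique)
  have E2: "expectation (\<lambda>\<omega>. (t n \<omega>)\<^sup>2) \<le> (m n)\<^sup>2 + C * (real n)\<^sup>2" for n
    using nn2[of n] C by (subst (asm) nn_integral_eq_integral[OF int2]) (auto simp del: ennreal_plus)
  \<comment> \<open>A variance of at most \<open>C * n^2\<close> is divided by \<open>n^4\<close>.
    At \<open>n = 0\<close> division by zero makes the left-hand side 0.\<close>
  have var: "(\<integral>\<^sup>+\<omega>. ennreal (((t n \<omega> - m n) / (real n)\<^sup>2)\<^sup>2) \<partial>M) \<le> ennreal (C * (1 / (real n)\<^sup>2))" for n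
  proof (cases "n = 0")
    case False
    have [simp]: "integrable M (t n)" "expectation (t n) = m n"
      using int1[of n] by (simp_all add: has_bochner_integral_iff)
    have eq: "((t n \<omega> - m n) / (real n)\<^sup>2)\<^sup>2 = ((t n \<omega>)\<^sup>2 - 2 * m n * t n \<omega> + (m n)\<^sup>2) / (real n)^4" for \<omega>
      by (simp add: power2_diff power_divide mult_ac flip: power_mult)
    have int: "integrable M (\<lambda>\<omega>. ((t n \<omega> - m n) / (real n)\<^sup>2)\<^sup>2)"
      unfolding eq using int2[of n] by simp
    have "expectation (\<lambda>\<omega>. ((t n \<omega> - m n) / (real n)\<^sup>2)\<^sup>2) =
        (expectation (\<lambda>\<omega>. (t n \<omega>)\<^sup>2) - (m n)\<^sup>2) / (real n)^4"
      unfolding eq using int2[of n] by (simp add: prob_space power2_eq_square)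
    also have "\<dots> \<le> (C * (real n)\<^sup>2) / (real n)^4"
      using E2[of n] by (intro divide_right_mono) auto
    also have "\<dots> = C * (1 / (real n)\<^sup>2)"
      using False by (simp add: field_simps power2_eq_square power4_eq_xxxx)
    finally show ?thesis
      by (subst nn_integral_eq_integral[OF int]) (auto intro: ennreal_leI)
  qed simp
  \<comment> \<open>The expected sum of the squared errors is finite, so almost surely the sum
    itself is finite and its terms tend to 0.\<close>
  have "(\<integral>\<^sup>+\<omega>. (\<Sum>n. ennreal (((t n \<omega> - m n) / (real n)\<^sup>2)\<^sup>2)) \<partial>M) =
      (\<Sum>n. \<integral>\<^sup>+\<omega>. ennreal (((t n \<omega> - m n) / (real n)\<^sup>2)\<^sup>2) \<partial>M)"
    by (intro nn_integral_suminf) measurable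
  also have "\<dots> \<le> (\<Sum>n. ennreal (C * (1 / (real n)\<^sup>2)))"
    by (intro suminf_le var) auto
  also have "\<dots> < \<infinity>"
  proof -
    have "summable (\<lambda>n. C * (1 / (real n)\<^sup>2))"
      using inverse_power_summable[of 2, where ?'a=real] by (intro summable_mult) (simp add: inverse_eq_divide)
    then show ?thesis using C by (subst suminf_ennreal2) auto
  qed
  finally have "AE \<omega> in M. (\<Sum>n. ennreal (((t n \<omega> - m n) / (real n)\<^sup>2)\<^sup>2)) \<noteq> \<infinity>"
    by (intro nn_integral_PInf_AE) auto
  then show ?thesis
  proof eventually_elim
    case (elim \<omega>)
    then have "summable (\<lambda>n. ((t n \<omega> - m n) / (real n)\<^sup>2)\<^sup>2)"
      by (intro summable_suminf_not_top) auto
    then have "(\<lambda>n. sqrt (((t n \<omega> - m n) / (real n)\<^sup>2)\<^sup>2)) \<longlonglongrightarrow> sqrt 0"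
      by (intro tendsto_real_sqrt summable_LIMSEQ_zero)
    then show ?case
      unfolding t_def real_sqrt_abs real_sqrt_zero tendsto_rabs_zero_iff .
  qed
qed

text \<open>For R between n and n + 1, monotonicity squeezes the quotient between its values at n
  and n + 1, up to the factor n^2 / (n + 1)^2 or its inverse, and these tend to 1.\<close>

lemma tendsto_at_top_from_sequence:
  fixes f :: "real \<Rightarrow> real"
  assumes mono: "\<And>x y. 0 \<le> x \<Longrightarrow> x \<le> y \<Longrightarrow> f x \<le> f y" and nonneg: "\<And>x. 0 \<le> f x"
    and lim: "(\<lambda>n. f (real n) / (pi * (real n)\<^sup>2)) \<longlonglongrightarrow> c"
  shows "((\<lambda>R. f R / (pi * R\<^sup>2)) \<longlongrightarrow> c) at_top"
proof -
  let ?n = "\<lambda>R :: real. nat \<lfloor>R\<rfloor>"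
  let ?l = "\<lambda>n. f (real n) / (pi * (real n)\<^sup>2) * ((real n)\<^sup>2 / (real (Suc n))\<^sup>2)"
  let ?u = "\<lambda>n. f (real (Suc n)) / (pi * (real (Suc n))\<^sup>2) * ((real (Suc n))\<^sup>2 / (real n)\<^sup>2)"
  have n: "filterlim ?n sequentially at_top"
    using filterlim_compose[OF filterlim_nat_sequentially filterlim_floor_sequentially] .
  have "(\<lambda>n. (real n)\<^sup>2 / (real (Suc n))\<^sup>2) \<longlonglongrightarrow> 1\<^sup>2"
    unfolding power_divide[symmetric] by (intro tendsto_power LIMSEQ_n_over_Suc_n)
  from tendsto_mult[OF lim this] have l: "?l \<longlonglongrightarrow> c"
    by (simp only: power_one mult_1_right)
  have "(\<lambda>n. (real (Suc n))\<^sup>2 / (real n)\<^sup>2) \<longlonglongrightarrow> 1\<^sup>2"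
    unfolding power_divide[symmetric] by (intro tendsto_power LIMSEQ_Suc_n_over_n)
  from tendsto_mult[OF LIMSEQ_Suc[OF lim] this] have u: "?u \<longlonglongrightarrow> c"
    by (simp only: power_one mult_1_right)
  \<comment> \<open>From R = 1 on the floor of R is positive, so no denominator vanishes.\<close>
  have bounds: "\<forall>\<^sub>F R in at_top. ?l (?n R) \<le> f R / (pi * R\<^sup>2) \<and> f R / (pi * R\<^sup>2) \<le> ?u (?n R)"
    using eventually_ge_at_top[of "1 :: real"]
  proof eventually_elim
    case (elim R)
    define k where "k = ?n R"
    have k: "real k \<le> R" "R \<le> real (Suc k)" "1 \<le> k"
      using elim unfolding k_def by (linarith+)
    have "?l k = f (real k) / (pi * (real (Suc k))\<^sup>2)"
      using k by (simp add: field_simps)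
    also have "\<dots> \<le> f R / (pi * R\<^sup>2)"
      using k elim by (intro frac_le nonneg mono mult_left_mono power_mono) auto
    finally have 1: "?l k \<le> f R / (pi * R\<^sup>2)" .
    have "f R / (pi * R\<^sup>2) \<le> f (real (Suc k)) / (pi * (real k)\<^sup>2)"
      using k elim by (intro frac_le nonneg mono mult_left_mono power_mono) auto
    also have "\<dots> = ?u k"
      using k by (simp add: field_simps)
    finally show ?case using 1 unfolding k_def by blast
  qed
  show ?thesis
  proof (rule tendsto_sandwich)
    show "((\<lambda>R. ?l (?n R)) \<longlongrightarrow> c) at_top" by (rule filterlim_compose[OF l n])
    show "((\<lambda>R. ?u (?n R)) \<longlongrightarrow> c) at_top" by (rule filterlim_compose[OF u n])
  qed (use bounds in \<open>auto elim: eventually_mono\<close>)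
qed

lemma emeasure_lborel_disc: "0 \<le> R \<Longrightarrow> emeasure lborel (ball (0 :: complex) R) = ennreal (pi * R\<^sup>2)"
  by (simp add: emeasure_ball unit_ball_vol_2)

lemma measure_lborel_disc: "0 \<le> R \<Longrightarrow> measure lborel (ball (0 :: complex) R) = pi * R\<^sup>2"
  by (simp add: measure_def emeasure_lborel_disc)

text \<open>The real-valued form of \<open>pair_count\<close> for locally finite sets; the limits in
  the radius are taken in the reals.\<close>

definition pairs :: "complex set \<Rightarrow> real \<Rightarrow> complex set \<Rightarrow> real" where
  "pairs A R S = (\<Sum>x\<in>S \<inter> ball 0 R. \<Sum>y\<in>S \<inter> ball 0 R. of_bool (x \<noteq> y \<and> x - y \<in> A))"

lemma finite_Int_ball: "locally_finite_set S \<Longrightarrow> finite (S \<inter> ball 0 R)"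
proof (rule finite_subset)
  assume "locally_finite_set S"
  then show "finite (S \<inter> cball 0 R)" by (simp add: locally_finite_set_def)
qed auto

lemma pair_count_eq_pairs:
  assumes "locally_finite_set S"
  shows "pair_count A R S = ennreal (pairs A R S)"
proof -
  let ?T = "S \<inter> ball 0 R"
  have fin: "finite ?T" by (rule finite_Int_ball) fact
  have "(\<integral>\<^sup>+y. of_bool (x \<in> ball 0 R \<and> y \<in> ball 0 R \<and> x - y \<in> A) * of_bool (x \<noteq> y) \<partial>count_space S) =
      (\<Sum>y\<in>?T. of_bool (x \<in> ball 0 R \<and> y \<in> ball 0 R \<and> x - y \<in> A) * of_bool (x \<noteq> y))" for x
    by (rule nn_integral_count_space'[OF fin]) auto
  then have "pair_count A R S = (\<integral>\<^sup>+x. (\<Sum>y\<in>?T. of_bool (x \<in> ball 0 R \<and> y \<in> ball 0 R \<and> x - y \<in> A) * of_bool (x \<noteq> y)) \<partial>count_space S)"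
    unfolding pair_count_def by (simp only:)
  also have "\<dots> = (\<Sum>x\<in>?T. \<Sum>y\<in>?T. of_bool (x \<in> ball 0 R \<and> y \<in> ball 0 R \<and> x - y \<in> A) * of_bool (x \<noteq> y))"
    by (rule nn_integral_count_space'[OF fin]) auto
  also have "\<dots> = (\<Sum>x\<in>?T. \<Sum>y\<in>?T. ennreal (of_bool (x \<noteq> y \<and> x - y \<in> A)))"
    by (intro sum.cong refl) auto
  also have "\<dots> = ennreal (pairs A R S)"
    by (simp add: pairs_def sum_ennreal sum_nonneg)
  finally show ?thesis .
qed

lemma pairs_nonneg: "0 \<le> pairs A R S"
  by (simp add: pairs_def sum_nonneg)

lemma pairs_mono:
  assumes "locally_finite_set S" "R \<le> R'"
  shows "pairs A R S \<le> pairs A R' S"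
proof -
  have sub: "S \<inter> ball 0 R \<subseteq> S \<inter> ball 0 R'" using assms(2) by auto
  note fin = finite_Int_ball[OF assms(1)]
  have "pairs A R S \<le> (\<Sum>x\<in>S \<inter> ball 0 R. \<Sum>y\<in>S \<inter> ball 0 R'. of_bool (x \<noteq> y \<and> x - y \<in> A))"
    unfolding pairs_def by (intro sum_mono sum_mono2 fin sub) auto
  also have "\<dots> \<le> pairs A R' S"
    unfolding pairs_def by (intro sum_mono2 fin sub) (auto intro: sum_nonneg)
  finally show ?thesis .
qed

lemma emeasure_truncated_density_le: "emeasure truncated_density A \<le> emeasure lborel A"
proof (cases "A \<in> sets lborel")
  case True
  then have "emeasure truncated_density A = (\<integral>\<^sup>+x. ennreal (1 - exp (- pi * (cmod x)\<^sup>2)) * indicator A x \<partial>lborel)"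
    unfolding truncated_density_def by (intro emeasure_density) auto
  also have "\<dots> \<le> (\<integral>\<^sup>+x. indicator A x \<partial>lborel)"
    by (intro nn_integral_mono) (auto simp: ennreal_le_1 split: split_indicator)
  finally show ?thesis using True by simp
next
  case False
  then show ?thesis by (simp add: emeasure_notin_sets)
qed

context ginibre
begin

text \<open>The 2-point function is at most 1, since the points repel each other. Hence the variance
  of the number of points in a disc is at most its mean, as for a Poisson process, and the constant
  in the variance bound is pi.\<close>

lemma AE_density: "AE \<omega> in M. has_density (X \<omega>) 1"
proof -
  define N where "N n \<omega> = (\<integral>\<^sup>+x. indicator (ball 0 (real n)) x \<partial>count_space (X \<omega>))" for n :: nat and \<omega>
  let ?v = "\<lambda>n :: nat. pi * (real n)\<^sup>2"
  have Bmeas: "(indicator (ball 0 (real n)) :: complex \<Rightarrow> ennreal) \<in> borel_measurable borel" for n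
    by (rule borel_measurable_indicator) simp
  have N_meas [measurable]: "N n \<in> borel_measurable M" for n
    using moment_1(1)[OF Bmeas] unfolding N_def[abs_def] .
  have mean: "(\<integral>\<^sup>+\<omega>. N n \<omega> \<partial>M) = ennreal (?v n)" for n
    unfolding N_def moment_1(2)[OF Bmeas] by (simp add: emeasure_lborel_disc)
  have second: "(\<integral>\<^sup>+\<omega>. (N n \<omega>)\<^sup>2 \<partial>M) \<le> ennreal ((?v n)\<^sup>2 + pi * (real n)\<^sup>2)" for n
  proof -
    let ?P = "\<lambda>\<omega>. pair_count UNIV (real n) (X \<omega>)"
    have [measurable]: "?P \<in> borel_measurable M"
      by (rule measurable_pair_count) simp
    \<comment> \<open>The square of a count is the number of ordered pairs of distinct points plus
      the diagonal, which is the count itself.\<close>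
    have sq: "(N n \<omega>)\<^sup>2 = ?P \<omega> + N n \<omega>" for \<omega>
    proof -
      have "(N n \<omega>)\<^sup>2 = (\<integral>\<^sup>+x. \<integral>\<^sup>+y. indicator (ball 0 (real n)) x * indicator (ball 0 (real n)) y \<partial>count_space (X \<omega>) \<partial>count_space (X \<omega>))"
        unfolding N_def power2_eq_square by (simp only: nn_integral_cmult nn_integral_multc borel_measurable_count_space)
      also have "\<dots> = (\<integral>\<^sup>+x. \<integral>\<^sup>+y. of_bool (x \<in> ball 0 (real n) \<and> y \<in> ball 0 (real n) \<and> x - y \<in> UNIV) * of_bool (x \<noteq> y) +
          indicator (ball 0 (real n)) x * of_bool (x = y) \<partial>count_space (X \<omega>) \<partial>count_space (X \<omega>))"
        by (intro nn_integral_cong) (auto simp: indicator_def)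
      also have "\<dots> = ?P \<omega> + (\<integral>\<^sup>+x. \<integral>\<^sup>+y. indicator (ball 0 (real n)) x * of_bool (x = y) \<partial>count_space (X \<omega>) \<partial>count_space (X \<omega>))"
        unfolding pair_count_def
        by (simp only: nn_integral_add[OF borel_measurable_count_space borel_measurable_count_space])
      also have "(\<integral>\<^sup>+x. \<integral>\<^sup>+y. indicator (ball 0 (real n)) x * of_bool (x = y) \<partial>count_space (X \<omega>) \<partial>count_space (X \<omega>)) = N n \<omega>"
        unfolding N_def
        by (intro nn_integral_cong) (simp add: nn_integral_count_space_eq_point[where g="\<lambda>_. indicator _ _"])
      finally show ?thesis .
    qed
    have B: "ball 0 (real n) \<in> sets (borel :: complex measure)" by simp
    have "(\<integral>\<^sup>+\<omega>. ?P \<omega> \<partial>M) = ginibre_pair_mean UNIV (real n)"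
      by (rule expectation_pair_count) simp
    also have "\<dots> \<le> (\<integral>\<^sup>+x. \<integral>\<^sup>+y. indicator (ball (0 :: complex) (real n)) x * indicator (ball (0 :: complex) (real n)) y \<partial>lborel \<partial>lborel)"
      unfolding ginibre_pair_mean_def by (intro nn_integral_mono) (auto simp: ennreal_le_1 split: split_indicator)
    also have "\<dots> = ennreal (?v n) * ennreal (?v n)"
    proof -
      have "(indicator (ball 0 (real n)) :: complex \<Rightarrow> ennreal) \<in> borel_measurable lborel"
        using Bmeas[of n] by simp
      then show ?thesis
        using B by (simp only: nn_integral_cmult nn_integral_multc nn_integral_indicator sets_lborel emeasure_lborel_disc of_nat_0_le_iff)
    qed
    also have "\<dots> = ennreal ((?v n)\<^sup>2)"
      by (simp add: power2_eq_square ennreal_mult)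
    finally have "(\<integral>\<^sup>+\<omega>. ?P \<omega> \<partial>M) \<le> ennreal ((?v n)\<^sup>2)" .
    then show ?thesis
      unfolding sq by (subst nn_integral_add) (simp_all add: mean)
  qed
  have "AE \<omega> in M. (\<lambda>n. (enn2real (N n \<omega>) - ?v n) / (real n)\<^sup>2) \<longlonglongrightarrow> 0"
    by (rule AE_tendsto_of_variance_bound[OF prob_space N_meas mean _ second]) simp_all
  moreover have "AE \<omega> in M. locally_finite_set (X \<omega>)"
    using locally_finite by (intro AE_I2)
  ultimately show ?thesis
  proof eventually_elim
    case (elim \<omega>)
    let ?f = "\<lambda>R. real (card (X \<omega> \<inter> ball 0 R))"
    note fin = finite_Int_ball[OF elim(2)]
    have N: "N n \<omega> = ennreal (?f (real n))" for n
    proof -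
      have "N n \<omega> = (\<Sum>x\<in>X \<omega> \<inter> ball 0 (real n). indicator (ball 0 (real n)) x)"
        unfolding N_def by (rule nn_integral_count_space'[OF fin]) auto
      also have "\<dots> = (\<Sum>x\<in>X \<omega> \<inter> ball 0 (real n). 1)"
        by (intro sum.cong) auto
      finally show ?thesis by (simp add: ennreal_of_nat_eq_real_of_nat)
    qed
    have "(\<lambda>n. (?f (real n) - ?v n) / (real n)\<^sup>2 / pi + 1) \<longlonglongrightarrow> 0 / pi + 1"
      using elim(1) unfolding N by (intro tendsto_intros) auto
    moreover have "\<forall>\<^sub>F n in sequentially. (?f (real n) - ?v n) / (real n)\<^sup>2 / pi + 1 = ?f (real n) / (pi * (real n)\<^sup>2)"
      using eventually_gt_at_top[of 0] by eventually_elim (simp add: field_simps)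
    ultimately have "(\<lambda>n. ?f (real n) / (pi * (real n)\<^sup>2)) \<longlonglongrightarrow> 1"
      by (simp add: tendsto_cong)
    then have "((\<lambda>R. ?f R / (pi * R\<^sup>2)) \<longlongrightarrow> 1) at_top"
      by (rule tendsto_at_top_from_sequence[rotated 2]) (auto intro!: card_mono fin)
    moreover have "\<forall>\<^sub>F R in at_top. ?f R / (pi * R\<^sup>2) = ?f R / measure lborel (ball (0 :: complex) R)"
      using eventually_ge_at_top[of "0 :: real"] by eventually_elim (simp add: measure_lborel_disc)
    ultimately show ?case
      unfolding has_density_def by (simp cong: tendsto_cong)
  qed
qed

text \<open>The normalised mean converges to the mass of \<open>A\<close>, and the variance bound
  makes the realisation follow its mean along the integers. Monotonicity of \<open>pairs\<close> in
  the radius covers all other radii.\<close>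

lemma AE_pairs:
  assumes A: "A \<in> sets borel" "A \<subseteq> ball 0 r" and r: "0 \<le> r"
  shows "AE \<omega> in M. ((\<lambda>R. pairs A R (X \<omega>) / (pi * R\<^sup>2)) \<longlongrightarrow> measure truncated_density A) at_top"
proof -
  let ?c = "measure truncated_density A"
  let ?V = "emeasure lborel (ball (0 :: complex) r)"
  define K where "K = ennreal (384 * exp (2 * pi * r\<^sup>2)) * ?V\<^sup>2 + 4 * (6 * ?V\<^sup>2 + ?V)"
  have V: "?V = ennreal (pi * r\<^sup>2)" using r by (rule emeasure_lborel_disc)
  \<comment> \<open>\<open>K\<close> is finite because the enclosing disc has finite area; its real
    value times pi is the constant of the variance bound.\<close>
  have K: "K = ennreal (enn2real K)"
    unfolding K_def V by (simp add: ennreal_enn2real_if ennreal_mult_eq_top_iff power_eq_top_ennreal)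
  have "emeasure truncated_density A \<le> ?V"
    using emeasure_truncated_density_le[of A] emeasure_mono[OF A(2), of lborel] by simp
  then have c: "emeasure truncated_density A = ennreal ?c"
    unfolding V by (intro emeasure_eq_ennreal_measure) (auto simp: top_unique)
  define m where "m n = enn2real (ginibre_pair_mean A (real n))" for n :: nat
  have upper: "ginibre_pair_mean A (real n) \<le> ennreal (pi * (real n)\<^sup>2 * ?c)" for n
    using ginibre_pair_mean_bounds(1)[OF A, of "real n"] by (simp add: c emeasure_lborel_disc ennreal_mult)
  then have fin: "ginibre_pair_mean A (real n) = ennreal (m n)" for n
    unfolding m_def by (metis ennreal_enn2real_if ennreal_neq_top top_unique)
  have m_nonneg: "0 \<le> m n" for n by (simp add: m_def)
  have m_upper: "m n / (pi * (real n)\<^sup>2) \<le> ?c" for n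
    using upper[of n] unfolding fin by (cases "n = 0") (simp_all add: field_simps)
  have m_lower: "pi * (real n - r)\<^sup>2 * ?c \<le> m n" if "r \<le> real n" for n
    using ginibre_pair_mean_bounds(2)[OF A, of "real n"] that m_nonneg[of n]
    by (simp add: c fin emeasure_lborel_disc flip: ennreal_mult)
  \<comment> \<open>The pairs lost at the boundary have their first point in an annulus of width
    \<open>r\<close>, a vanishing share of the disc.\<close>
  have m_lim: "(\<lambda>n. m n / (pi * (real n)\<^sup>2)) \<longlonglongrightarrow> ?c"
  proof (rule tendsto_sandwich)
    have "(\<lambda>n. (1 - r / real n)\<^sup>2 * ?c) \<longlonglongrightarrow> (1 - 0)\<^sup>2 * ?c"
      by (intro tendsto_intros lim_const_over_n)
    then show "(\<lambda>n. (1 - r / real n)\<^sup>2 * ?c) \<longlonglongrightarrow> ?c" by simp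
    show "\<forall>\<^sub>F n in sequentially. (1 - r / real n)\<^sup>2 * ?c \<le> m n / (pi * (real n)\<^sup>2)"
      using eventually_gt_at_top[of 0] eventually_ge_at_top[of "nat \<lceil>r\<rceil>"]
    proof eventually_elim
      case (elim n)
      then have "r \<le> real n" by linarith
      have "1 - r / real n = (real n - r) / real n"
        using elim by (simp add: diff_divide_distrib)
      then have "(1 - r / real n)\<^sup>2 * ?c = pi * (real n - r)\<^sup>2 * ?c / (pi * (real n)\<^sup>2)"
        by (simp add: power_divide)
      also have "\<dots> \<le> m n / (pi * (real n)\<^sup>2)"
        by (intro divide_right_mono m_lower \<open>r \<le> real n\<close>) simp
      finally show ?case .
    qed
    show "\<forall>\<^sub>F n in sequentially. m n / (pi * (real n)\<^sup>2) \<le> ?c"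
      by (simp add: m_upper)
  qed simp
  have second: "(\<integral>\<^sup>+\<omega>. (pair_count A (real n) (X \<omega>))\<^sup>2 \<partial>M) \<le> ennreal ((m n)\<^sup>2 + (enn2real K * pi) * (real n)\<^sup>2)" for n
  proof -
    have "(\<integral>\<^sup>+\<omega>. (pair_count A (real n) (X \<omega>))\<^sup>2 \<partial>M) \<le> (ennreal (m n))\<^sup>2 + ennreal (enn2real K) * ennreal (pi * (real n)\<^sup>2)"
      using second_moment_pair_count[OF A, of "real n"] K unfolding K_def[symmetric]
      by (simp add: fin emeasure_lborel_disc)
    also have "\<dots> = ennreal ((m n)\<^sup>2 + (enn2real K * pi) * (real n)\<^sup>2)"
      using m_nonneg[of n] by (simp add: ennreal_power ennreal_mult' mult.assoc)
    finally show ?thesis .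
  qed
  have "AE \<omega> in M. (\<lambda>n. (enn2real (pair_count A (real n) (X \<omega>)) - m n) / (real n)\<^sup>2) \<longlonglongrightarrow> 0"
    by (rule AE_tendsto_of_variance_bound[OF prob_space measurable_pair_count _ m_nonneg second])
       (simp_all add: A expectation_pair_count fin)
  moreover have "AE \<omega> in M. locally_finite_set (X \<omega>)"
    using locally_finite by (intro AE_I2)
  ultimately show ?thesis
  proof eventually_elim
    case (elim \<omega>)
    let ?f = "\<lambda>R. pairs A R (X \<omega>)"
    have "(\<lambda>n. (?f (real n) - m n) / (real n)\<^sup>2 / pi + m n / (pi * (real n)\<^sup>2)) \<longlonglongrightarrow> 0 / pi + ?c"
      using elim(1) m_lim unfolding pair_count_eq_pairs[OF elim(2)] enn2real_ennreal[OF pairs_nonneg]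
      by (intro tendsto_intros) auto
    moreover have "(?f (real n) - m n) / (real n)\<^sup>2 / pi + m n / (pi * (real n)\<^sup>2) = ?f (real n) / (pi * (real n)\<^sup>2)" for n
      by (simp add: diff_divide_distrib mult.commute)
    ultimately have "(\<lambda>n. ?f (real n) / (pi * (real n)\<^sup>2)) \<longlonglongrightarrow> ?c"
      by simp
    then show ?case
      by (rule tendsto_at_top_from_sequence[rotated 2]) (auto intro: pairs_mono elim pairs_nonneg)
  qed
qed

end

section \<open>The limit measure\<close>

abbreviation (input) "\<Gamma> \<equiv> dirac_plus_ginibre_density"

lemma sets_dirac_plus [simp, measurable_cong]: "sets \<Gamma> = sets borel"
  and space_dirac_plus [simp]: "space \<Gamma> = UNIV"
  unfolding dirac_plus_ginibre_density_def
  using sets.sigma_sets_eq[of "borel :: complex measure"] by (simp_all add: sets_measure_of_conv space_measure_of_conv)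

text \<open>\<open>measure_of\<close> returns the given set function only once it is known to be
  countably additive. It is, being the sum of a point mass and of
  \<open>truncated_density\<close>.\<close>

lemma emeasure_dirac_plus:
  assumes "A \<in> sets borel"
  shows "emeasure \<Gamma> A = indicator A 0 + emeasure truncated_density A"
proof -
  let ?\<mu> = "\<lambda>A. indicator A 0 + (\<integral>\<^sup>+x. indicator A x * ennreal (1 - exp (- pi * (cmod x)\<^sup>2)) \<partial>lborel)"
  have \<mu>: "?\<mu> A = emeasure (return borel (0 :: complex)) A + emeasure truncated_density A" if "A \<in> sets borel" for A
    using that unfolding truncated_density_def by (simp add: emeasure_density mult.commute)
  have "emeasure \<Gamma> A = ?\<mu> A"
  proof (rule emeasure_measure_of[OF dirac_plus_ginibre_density_def])
    show "positive (sets \<Gamma>) ?\<mu>"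
      by (simp add: positive_def)
    show "countably_additive (sets \<Gamma>) ?\<mu>"
    proof (rule countably_additiveI)
      fix F :: "nat \<Rightarrow> complex set"
      assume F: "range F \<subseteq> sets \<Gamma>" "disjoint_family F" "(\<Union>i. F i) \<in> sets \<Gamma>"
      have Fi: "F i \<in> sets borel" for i using F(1) by auto
      have "(\<Sum>i. ?\<mu> (F i)) = (\<Sum>i. emeasure (return borel 0) (F i) + emeasure truncated_density (F i))"
        using Fi by (intro suminf_cong \<mu>) auto
      also have "\<dots> = (\<Sum>i. emeasure (return borel 0) (F i)) + (\<Sum>i. emeasure truncated_density (F i))"
        by (intro suminf_add[symmetric]) auto
      also have "\<dots> = ?\<mu> (\<Union>i. F i)"
        using F Fi by (subst (1 2) suminf_emeasure) (auto simp only: sets_return sets_truncated_density sets_dirac_plus \<mu>)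
      finally show "(\<Sum>i. ?\<mu> (F i)) = ?\<mu> (\<Union>i. F i)" .
    qed
  qed (use assms in auto)
  then show ?thesis
    using \<mu>[OF assms] assms by simp
qed

text \<open>Off the origin both measures agree, and the origin is a null set of
  \<open>truncated_density\<close> while it has mass 1 for \<Gamma>. Splitting the integral at the
  origin therefore produces the extra term \<open>f 0\<close>.\<close>

lemma dirac_plus_integral:
  fixes f :: "complex \<Rightarrow> 'b :: {banach, second_countable_topology}"
  assumes f: "integrable truncated_density f"
  shows "integrable \<Gamma> f" and "integral\<^sup>L \<Gamma> f = f 0 + integral\<^sup>L truncated_density f"
proof -
  have null: "emeasure truncated_density {0} = 0"
    using emeasure_truncated_density_le[of "{0}"] by simp
  have [measurable]: "f \<in> borel_measurable borel"
    using f by (auto dest!: borel_measurable_integrable)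
  have restr: "restrict_space \<Gamma> (- {0}) = restrict_space truncated_density (- {0})"
  proof (rule measure_eqI)
    show "sets (restrict_space \<Gamma> (- {0})) = sets (restrict_space truncated_density (- {0}))"
      by (simp add: sets_restrict_space)
    fix A assume "A \<in> sets (restrict_space \<Gamma> (- {0}))"
    then have "A \<in> sets borel" "A \<subseteq> - {0}"
      by (auto simp: sets_restrict_space)
    then show "emeasure (restrict_space \<Gamma> (- {0})) A = emeasure (restrict_space truncated_density (- {0})) A"
      by (auto simp: emeasure_restrict_space emeasure_dirac_plus)
  qed
  have int_off: "integrable \<Gamma> (\<lambda>x. indicator (- {0}) x *\<^sub>R f x)"
  proof -
    have "integrable truncated_density (\<lambda>x. indicator (- {0}) x *\<^sub>R f x)"
      by (rule integrable_mult_indicator[OF _ f]) simp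
    then show ?thesis
      using integrable_restrict_space[of "- {0}" truncated_density f] integrable_restrict_space[of "- {0}" \<Gamma> f] by (simp add: restr)
  qed
  have one: "emeasure \<Gamma> {0} = 1"
    by (subst emeasure_dirac_plus) (simp_all add: null)
  have int_0: "integrable \<Gamma> (\<lambda>x. indicator {0} x *\<^sub>R f 0)"
    by (intro integrable_scaleR_left integrable_real_indicator) (simp_all add: one)
  have split: "f = (\<lambda>x. indicator {0} x *\<^sub>R f 0 + indicator (- {0}) x *\<^sub>R f x)"
    by (auto simp: fun_eq_iff split: split_indicator)
  show "integrable \<Gamma> f"
    by (subst split) (intro Bochner_Integration.integrable_add int_0 int_off)
  have "integral\<^sup>L \<Gamma> f = (\<integral>x. indicator {0} x *\<^sub>R f 0 \<partial>\<Gamma>) + (\<integral>x. indicator (- {0}) x *\<^sub>R f x \<partial>\<Gamma>)"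
    by (subst split) (intro Bochner_Integration.integral_add int_0 int_off)
  also have "(\<integral>x. indicator {0} x *\<^sub>R f 0 \<partial>\<Gamma>) = f 0"
    by (simp add: measure_def one)
  also have "(\<integral>x. indicator (- {0}) x *\<^sub>R f x \<partial>\<Gamma>) = (\<integral>x. indicator (- {0}) x *\<^sub>R f x \<partial>truncated_density)"
    using integral_restrict_space[of "- {0}" truncated_density f] integral_restrict_space[of "- {0}" \<Gamma> f] by (simp add: restr)
  also have "\<dots> = integral\<^sup>L truncated_density f"
  proof (rule integral_cong_AE)
    have "AE x in truncated_density. x \<noteq> 0"
      by (rule AE_I[OF _ null]) auto
    then show "AE x in truncated_density. indicator (- {0}) x *\<^sub>R f x = f x"
      by eventually_elim simp
  qed measurable
  finally show "integral\<^sup>L \<Gamma> f = f 0 + integral\<^sup>L truncated_density f" .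
qed

lemma emeasure_dirac_plus_bounded:
  assumes "bounded A" "A \<in> sets borel"
  shows "emeasure \<Gamma> A < \<infinity>"
proof -
  have "emeasure truncated_density A \<le> emeasure lborel A"
    by (rule emeasure_truncated_density_le)
  also have "\<dots> < \<infinity>"
    by (rule emeasure_bounded_finite[OF assms(1)])
  finally show ?thesis
    using assms(2) by (simp add: emeasure_dirac_plus split: split_indicator)
qed

section \<open>Partition of the plane into small squares\<close>

text \<open>Half-open squares of side \<open>1 / m\<close>, encoded by floors: for fixed positive
  \<open>m\<close> every point lies in exactly one of them, and the whole family is
  countable.\<close>

definition cell :: "nat \<Rightarrow> int \<Rightarrow> int \<Rightarrow> complex set" where
  "cell m a b = {z. \<lfloor>real m * Re z\<rfloor> = a \<and> \<lfloor>real m * Im z\<rfloor> = b}"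

lemma cell_borel [measurable]: "cell m a b \<in> sets borel"
proof -
  have "Measurable.pred borel (\<lambda>z. \<lfloor>real m * Re z\<rfloor> = a \<and> \<lfloor>real m * Im z\<rfloor> = b)"
    by measurable
  then show ?thesis
    by (simp add: Measurable.pred_def cell_def)
qed

lemma cell_norm_le:
  assumes "m > 0" "z \<in> cell m a b"
  shows "cmod (z - Complex (a / m) (b / m)) \<le> 2 / m"
proof -
  have "\<bar>Re z - a / m\<bar> \<le> 1 / m" "\<bar>Im z - b / m\<bar> \<le> 1 / m"
    using assms by (auto simp: cell_def field_simps abs_le_iff) linarith+
  then show ?thesis
    using cmod_le[of "z - Complex (a / m) (b / m)"] by simp
qed

lemma cell_bounded:
  assumes "m > 0"
  shows "\<exists>r\<ge>0. cell m a b \<subseteq> ball 0 r"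
proof (intro exI conjI subsetI)
  let ?c = "Complex (a / m) (b / m)"
  fix z assume "z \<in> cell m a b"
  from cell_norm_le[OF assms this] show "z \<in> ball 0 (cmod ?c + 2 / m + 1)"
    using norm_triangle_ineq2[of z ?c] by simp
qed (use assms in simp)

text \<open>Half-open with integer half-width, so that for every positive \<open>m\<close> it is an
  exact union of cells, with indices from \<open>- L * m\<close> to
  \<open>L * m - 1\<close>.\<close>

definition box_set :: "nat \<Rightarrow> complex set" where
  "box_set L = {z. - real L \<le> Re z \<and> Re z < real L \<and> - real L \<le> Im z \<and> Im z < real L}"

text \<open>At most one summand is nonzero, the one whose indices are the floors of the scaled
  coordinates; these lie in the index range exactly for points of the box.\<close>

lemma sum_cells:
  fixes f :: "int \<Rightarrow> int \<Rightarrow> 'a :: real_normed_vector"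
  assumes "m > 0"
  shows "(\<Sum>a\<in>{- int (L * m)..<int (L * m)}. \<Sum>b\<in>{- int (L * m)..<int (L * m)}. indicator (cell m a b) z *\<^sub>R f a b) =
    indicator (box_set L) z *\<^sub>R f \<lfloor>real m * Re z\<rfloor> \<lfloor>real m * Im z\<rfloor>"
proof -
  let ?I = "{- int (L * m)..<int (L * m)}"
  have mem: "\<lfloor>real m * t\<rfloor> \<in> ?I \<longleftrightarrow> - real L \<le> t \<and> t < real L" for t
  proof -
    have "\<lfloor>real m * t\<rfloor> \<in> ?I \<longleftrightarrow> - real L * real m \<le> t * real m \<and> t * real m < real L * real m"
      by (simp add: le_floor_iff floor_less_iff mult.commute)
    moreover have "- real L * real m \<le> t * real m \<longleftrightarrow> - real L \<le> t" "t * real m < real L * real m \<longleftrightarrow> t < real L"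
      using assms by (intro mult_le_cancel_right_pos mult_less_cancel_right_pos, simp)+
    ultimately show ?thesis by blast
  qed
  have "(\<Sum>a\<in>?I. \<Sum>b\<in>?I. indicator (cell m a b) z *\<^sub>R f a b) =
      (\<Sum>a\<in>?I. if a = \<lfloor>real m * Re z\<rfloor> then (\<Sum>b\<in>?I. if b = \<lfloor>real m * Im z\<rfloor> then f a b else 0) else 0)"
  proof (intro sum.cong refl)
    fix a
    have "indicator (cell m a b) z *\<^sub>R f a b =
        (if a = \<lfloor>real m * Re z\<rfloor> then if b = \<lfloor>real m * Im z\<rfloor> then f a b else 0 else 0)" for b
      by (auto simp: cell_def indicator_def)
    then show "(\<Sum>b\<in>?I. indicator (cell m a b) z *\<^sub>R f a b) =
        (if a = \<lfloor>real m * Re z\<rfloor> then (\<Sum>b\<in>?I. if b = \<lfloor>real m * Im z\<rfloor> then f a b else 0) else 0)"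
      by simp
  qed
  also have "\<dots> = (if \<lfloor>real m * Re z\<rfloor> \<in> ?I \<and> \<lfloor>real m * Im z\<rfloor> \<in> ?I then f \<lfloor>real m * Re z\<rfloor> \<lfloor>real m * Im z\<rfloor> else 0)"
    by (simp add: sum.delta)
  also have "\<dots> = indicator (box_set L) z *\<^sub>R f \<lfloor>real m * Re z\<rfloor> \<lfloor>real m * Im z\<rfloor>"
    unfolding mem by (auto simp: box_set_def indicator_def)
  finally show ?thesis .
qed

section \<open>From averages over cells to continuous test functions\<close>

text \<open>A three-epsilon argument with weighted errors. A uniformly small change of the test
  function changes the pair average only by a multiple of the average over a box, and the convergent
  \<open>B\<close> stands for that average.\<close>

lemma tendsto_by_approximation:
  fixes S :: "'a \<Rightarrow> 'b :: real_normed_vector"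
  assumes B: "(B \<longlongrightarrow> b) F" and "0 \<le> b"
    and approx: "\<And>\<epsilon>. \<epsilon> > 0 \<Longrightarrow> \<exists>T u. (T \<longlongrightarrow> u) F \<and> (\<forall>x. norm (S x - T x) \<le> \<epsilon> * B x) \<and> norm (s - u) \<le> \<epsilon> * (b :: real)"
  shows "(S \<longlongrightarrow> s) F"
proof (rule tendstoI)
  fix e :: real assume e: "e > 0"
  \<comment> \<open>Eventually \<open>B\<close> stays below \<open>b + 1\<close>, which is positive
    even for \<open>b = 0\<close>; the 3 shares the error among the three differences.\<close>
  define \<epsilon> where "\<epsilon> = e / (3 * (b + 1))"
  have \<epsilon>: "\<epsilon> > 0" "\<epsilon> * (b + 1) = e / 3"
    using e \<open>0 \<le> b\<close> by (auto simp: \<epsilon>_def field_simps)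
  obtain T u where T: "(T \<longlongrightarrow> u) F" "\<And>x. norm (S x - T x) \<le> \<epsilon> * B x" "norm (s - u) \<le> \<epsilon> * b"
    using approx[OF \<epsilon>(1)] by blast
  have "\<forall>\<^sub>F x in F. dist (T x) u < e / 3"
    using e by (intro tendstoD T(1)) simp
  moreover have "\<forall>\<^sub>F x in F. B x < b + 1"
    using order_tendstoD(2)[OF B, of "b + 1"] by simp
  ultimately show "\<forall>\<^sub>F x in F. dist (S x) s < e"
  proof eventually_elim
    case (elim x)
    have "\<epsilon> * B x \<le> \<epsilon> * (b + 1)" "\<epsilon> * b \<le> \<epsilon> * (b + 1)"
      using elim(2) \<epsilon>(1) by auto
    then have "norm (S x - T x) \<le> e / 3" "norm (u - s) \<le> e / 3"
      using T(2)[of x] T(3) \<epsilon>(2) by (auto simp: norm_minus_commute)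
    moreover have "norm (S x - s) \<le> norm (S x - T x) + norm (T x - u) + norm (u - s)"
      using norm_triangle_ineq[of "S x - T x + (T x - u)" "u - s"] norm_triangle_ineq[of "S x - T x" "T x - u"] by simp
    ultimately show ?case
      using elim(1) by (simp add: dist_norm)
  qed
qed

text \<open>Includes the diagonal, unlike \<open>pairs\<close>. The value type is general so that
  complex test functions can be compared with real indicators.\<close>

definition pair_avg :: "complex set \<Rightarrow> (complex \<Rightarrow> 'a :: real_normed_vector) \<Rightarrow> real \<Rightarrow> 'a" where
  "pair_avg S h R = (1 / (pi * R\<^sup>2)) *\<^sub>R (\<Sum>x\<in>S \<inter> ball 0 R. \<Sum>y\<in>S \<inter> ball 0 R. h (x - y))"

lemma pair_avg_sum: "pair_avg S (\<lambda>z. \<Sum>i\<in>I. h i z) R = (\<Sum>i\<in>I. pair_avg S (h i) R)"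
proof -
  have "(\<Sum>x\<in>T. \<Sum>y\<in>T. \<Sum>i\<in>I. h i (x - y)) = (\<Sum>i\<in>I. \<Sum>x\<in>T. \<Sum>y\<in>T. h i (x - y))" for T
  proof -
    have "(\<Sum>x\<in>T. \<Sum>y\<in>T. \<Sum>i\<in>I. h i (x - y)) = (\<Sum>x\<in>T. \<Sum>i\<in>I. \<Sum>y\<in>T. h i (x - y))"
      by (intro sum.cong refl sum.swap)
    also have "\<dots> = (\<Sum>i\<in>I. \<Sum>x\<in>T. \<Sum>y\<in>T. h i (x - y))"
      by (rule sum.swap)
    finally show ?thesis .
  qed
  then show ?thesis
    by (simp add: pair_avg_def scaleR_sum_right)
qed

lemma pair_avg_diff: "pair_avg S (\<lambda>z. f z - g z) R = pair_avg S f R - pair_avg S g R"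
  by (simp add: pair_avg_def sum_subtractf scaleR_diff_right)

lemma pair_avg_scaleR_const: "pair_avg S (\<lambda>z. f z *\<^sub>R w) R = pair_avg S f R *\<^sub>R w"
  by (simp add: pair_avg_def flip: scaleR_sum_left)

lemma norm_pair_avg_le:
  assumes "\<And>z. norm (f z) \<le> \<epsilon> * g z"
  shows "norm (pair_avg S f R) \<le> \<epsilon> * pair_avg S g R"
proof -
  let ?T = "S \<inter> ball 0 R"
  have "norm (\<Sum>x\<in>?T. \<Sum>y\<in>?T. f (x - y)) \<le> (\<Sum>x\<in>?T. \<Sum>y\<in>?T. \<epsilon> * g (x - y))"
    by (intro order_trans[OF norm_sum sum_mono] assms)
  also have "\<dots> = \<epsilon> * (\<Sum>x\<in>?T. \<Sum>y\<in>?T. g (x - y))"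
    by (simp add: sum_distrib_left)
  finally have "1 / (pi * R\<^sup>2) * norm (\<Sum>x\<in>?T. \<Sum>y\<in>?T. f (x - y)) \<le> 1 / (pi * R\<^sup>2) * (\<epsilon> * (\<Sum>x\<in>?T. \<Sum>y\<in>?T. g (x - y)))"
    by (intro mult_left_mono) auto
  then show ?thesis
    by (simp add: pair_avg_def mult_ac)
qed

lemma box_set_borel [measurable]: "box_set L \<in> sets borel"
  unfolding box_set_def by measurable

lemma box_set_norm_le: "z \<in> box_set L \<Longrightarrow> cmod z \<le> 2 * real L"
  using cmod_le[of z] by (auto simp: box_set_def abs_le_iff)

lemma bounded_box_set: "bounded (box_set L)"
  unfolding bounded_iff using box_set_norm_le by blast

lemma bounded_cell: "m > 0 \<Longrightarrow> bounded (cell m a b)"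
  using cell_bounded[of m a b] bounded_ball bounded_subset by metis

lemma integrable_indicator_dirac_plus:
  assumes "bounded A" "A \<in> sets borel"
  shows "integrable \<Gamma> (indicator A :: complex \<Rightarrow> real)"
  using emeasure_dirac_plus_bounded[OF assms] assms(2) by simp

text \<open>Uniform continuity approximates a test function by a combination of finitely many cell
  indicators, so only countably many limits are needed.\<close>

lemma autocorrelation_of_cells:
  assumes lim: "\<And>m a b. m > 0 \<Longrightarrow> (pair_avg S (indicator (cell m a b)) \<longlongrightarrow> measure \<Gamma> (cell m a b)) at_top"
  shows "autocorrelation S \<Gamma>"
  unfolding autocorrelation_def
proof (intro conjI allI impI)
  show "sets \<Gamma> = sets borel" by simp
  fix g assume "Cc g"
  then obtain C where cont: "continuous_on UNIV g" and C: "compact C" and g0: "\<And>x. x \<notin> C \<Longrightarrow> g x = 0"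
    by (auto simp: Cc_def)
  obtain \<rho> where \<rho>: "\<And>x. x \<in> C \<Longrightarrow> cmod x \<le> \<rho>"
    using compact_imp_bounded[OF C] by (auto simp: bounded_iff)
  \<comment> \<open>The summand 1 makes the bound on the support strict, as the box is open on its
    upper sides.\<close>
  define L where "L = nat \<lceil>\<rho>\<rceil> + 1"
  have "\<rho> < real L" unfolding L_def by linarith
  have supp: "g x = 0" if "x \<notin> box_set L" for x
  proof (rule g0, rule notI)
    assume "x \<in> C"
    from \<rho>[OF this] \<open>\<rho> < real L\<close> abs_Re_le_cmod[of x] abs_Im_le_cmod[of x] that show False
      by (auto simp: box_set_def abs_le_iff)
  qed
  let ?Q = "box_set L"
  have [measurable]: "g \<in> borel_measurable borel"
    using cont by (rule borel_measurable_continuous_onI)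
  have step_lim: "(pair_avg S (\<lambda>z. \<Sum>a\<in>{- int (L * m)..<int (L * m)}. \<Sum>b\<in>{- int (L * m)..<int (L * m)}. indicator (cell m a b) z *\<^sub>R f a b) \<longlongrightarrow>
        (\<integral>z. (\<Sum>a\<in>{- int (L * m)..<int (L * m)}. \<Sum>b\<in>{- int (L * m)..<int (L * m)}. indicator (cell m a b) z *\<^sub>R f a b) \<partial>\<Gamma>)) at_top"
    and step_int: "integrable \<Gamma> (\<lambda>z. \<Sum>a\<in>{- int (L * m)..<int (L * m)}. \<Sum>b\<in>{- int (L * m)..<int (L * m)}. indicator (cell m a b) z *\<^sub>R f a b)"
    if m: "m > 0" for m and f :: "int \<Rightarrow> int \<Rightarrow> 'b :: {banach, second_countable_topology}"
  proof -
    have int: "integrable \<Gamma> (\<lambda>z. indicator (cell m a b) z *\<^sub>R f a b)" for a b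
      by (intro integrable_scaleR_left integrable_indicator_dirac_plus bounded_cell m cell_borel)
    then show "integrable \<Gamma> (\<lambda>z. \<Sum>a\<in>{- int (L * m)..<int (L * m)}. \<Sum>b\<in>{- int (L * m)..<int (L * m)}. indicator (cell m a b) z *\<^sub>R f a b)"
      by (intro Bochner_Integration.integrable_sum)
    have "(\<integral>z. indicator (cell m a b) z *\<^sub>R f a b \<partial>\<Gamma>) = measure \<Gamma> (cell m a b) *\<^sub>R f a b" for a b
      using integrable_indicator_dirac_plus[OF bounded_cell[OF m] cell_borel, of a b] by simp
    then have "(\<integral>z. (\<Sum>a\<in>{- int (L * m)..<int (L * m)}. \<Sum>b\<in>{- int (L * m)..<int (L * m)}. indicator (cell m a b) z *\<^sub>R f a b) \<partial>\<Gamma>) =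
      (\<Sum>a\<in>{- int (L * m)..<int (L * m)}. \<Sum>b\<in>{- int (L * m)..<int (L * m)}. measure \<Gamma> (cell m a b) *\<^sub>R f a b)"
      by (simp only: Bochner_Integration.integral_sum[OF Bochner_Integration.integrable_sum[OF int]] Bochner_Integration.integral_sum[OF int])
    then show "(pair_avg S (\<lambda>z. \<Sum>a\<in>{- int (L * m)..<int (L * m)}. \<Sum>b\<in>{- int (L * m)..<int (L * m)}. indicator (cell m a b) z *\<^sub>R f a b) \<longlongrightarrow>
        (\<integral>z. (\<Sum>a\<in>{- int (L * m)..<int (L * m)}. \<Sum>b\<in>{- int (L * m)..<int (L * m)}. indicator (cell m a b) z *\<^sub>R f a b) \<partial>\<Gamma>)) at_top"
      unfolding pair_avg_sum pair_avg_scaleR_const by (simp only:) (intro tendsto_intros lim m)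
  qed
  \<comment> \<open>With mesh 1 and constant weight 1 the step function is the indicator of the
    box.\<close>
  have box_lim: "(pair_avg S (indicator ?Q) \<longlongrightarrow> measure \<Gamma> ?Q) at_top"
    using step_lim[of 1 "\<lambda>_ _. 1 :: real"] unfolding sum_cells[OF zero_less_one] by simp
  obtain b where b: "\<And>x. cmod (g x) \<le> b"
  proof -
    have "bounded (g ` C)"
      by (intro compact_imp_bounded compact_continuous_image C continuous_on_subset[OF cont]) simp
    then obtain b where "\<And>x. x \<in> C \<Longrightarrow> cmod (g x) \<le> b" by (auto simp: bounded_iff)
    then have "cmod (g x) \<le> max b 0" for x
      using g0[of x] by (cases "x \<in> C") (auto simp: le_max_iff_disj)
    then show ?thesis by (rule that)
  qed
  have int_Q: "integrable \<Gamma> (indicator ?Q :: complex \<Rightarrow> real)"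
    by (intro integrable_indicator_dirac_plus bounded_box_set box_set_borel)
  show int_g: "integrable \<Gamma> g"
  proof (rule Bochner_Integration.integrable_bound)
    show "integrable \<Gamma> (\<lambda>x. b * indicator ?Q x)"
      using int_Q by simp
    show "AE x in \<Gamma>. cmod (g x) \<le> norm (b * indicator ?Q x)"
    proof (intro AE_I2)
      fix x show "cmod (g x) \<le> norm (b * indicator ?Q x)"
        using b[of x] supp[of x] by (cases "x \<in> ?Q") auto
    qed
  qed simp
  have "(pair_avg S g \<longlongrightarrow> integral\<^sup>L \<Gamma> g) at_top"
  proof (rule tendsto_by_approximation[OF box_lim measure_nonneg])
    fix \<epsilon> :: real assume \<epsilon>: "\<epsilon> > 0"
    \<comment> \<open>Box points have modulus at most \<open>2 * L\<close>, and the corner of a cell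
      is at distance at most 2 from its points, so sample points stay inside this compact
      disc.\<close>
    let ?K = "cball (0 :: complex) (2 * real L + 2)"
    have "uniformly_continuous_on ?K g"
      by (intro compact_uniformly_continuous continuous_on_subset[OF cont]) auto
    then obtain \<delta> where \<delta>: "\<delta> > 0" "\<And>x y. x \<in> ?K \<Longrightarrow> y \<in> ?K \<Longrightarrow> dist y x < \<delta> \<Longrightarrow> dist (g y) (g x) < \<epsilon>"
      unfolding uniformly_continuous_on_def using \<epsilon> by metis
    \<comment> \<open>A point is within \<open>2 / m\<close> of the lower left corner of its cell,
      where the step function samples \<open>g\<close>; this choice makes the distance smaller than
      the modulus of continuity requires.\<close>
    obtain m :: nat where m: "2 / \<delta> < real m"
      using reals_Archimedean2 by blast
    have "0 < 2 / \<delta>" using \<delta>(1) by simp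
    with m have m0: "m > 0" by linarith
    then have m1: "2 / m < \<delta>"
      using m \<delta>(1) by (simp add: field_simps)
    define f where "f a b = g (Complex (real_of_int a / m) (real_of_int b / m))" for a b :: int
    define h where "h z = (\<Sum>a\<in>{- int (L * m)..<int (L * m)}. \<Sum>b\<in>{- int (L * m)..<int (L * m)}. indicator (cell m a b) z *\<^sub>R f a b)" for z
    have close: "cmod (g z - h z) \<le> \<epsilon> * indicator ?Q z" for z
    proof (cases "z \<in> ?Q")
      case True
      let ?a = "\<lfloor>real m * Re z\<rfloor>" and ?b = "\<lfloor>real m * Im z\<rfloor>"
      let ?c = "Complex (real_of_int ?a / m) (real_of_int ?b / m)"
      have "cmod (z - ?c) \<le> 2 / m"
        by (rule cell_norm_le[OF m0]) (simp add: cell_def)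
      moreover have "2 / m \<le> (2 :: real)" using m0 by (simp add: field_simps)
      moreover note box_set_norm_le[OF True] norm_triangle_ineq2[of ?c z]
      ultimately have "z \<in> ?K" "?c \<in> ?K" "dist z ?c < \<delta>"
        using m1 by (auto simp: dist_norm norm_minus_commute)
      from \<delta>(2)[OF this(2,1,3)] have "cmod (g z - g ?c) < \<epsilon>" by (simp add: dist_norm)
      then show ?thesis
        unfolding h_def sum_cells[OF m0] using True by (simp add: f_def)
    next
      case False
      then show ?thesis unfolding h_def sum_cells[OF m0] using supp[OF False] False by simp
    qed
    have "norm (integral\<^sup>L \<Gamma> g - integral\<^sup>L \<Gamma> h) \<le> \<epsilon> * measure \<Gamma> ?Q"
    proof -
      have int_h: "integrable \<Gamma> h"
        unfolding h_def[abs_def] by (rule step_int[OF m0])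
      have "norm (\<integral>z. g z - h z \<partial>\<Gamma>) \<le> (\<integral>z. \<epsilon> * indicator ?Q z \<partial>\<Gamma>)"
        using int_g int_h int_Q by (intro Bochner_Integration.integral_norm_bound_integral close) auto
      then show ?thesis
        using int_g int_h by simp
    qed
    moreover have "(pair_avg S h \<longlongrightarrow> integral\<^sup>L \<Gamma> h) at_top"
      unfolding h_def[abs_def] by (rule step_lim[OF m0])
    moreover have "norm (pair_avg S g R - pair_avg S h R) \<le> \<epsilon> * pair_avg S (indicator ?Q) R" for R
      unfolding pair_avg_diff[symmetric] by (rule norm_pair_avg_le[OF close])
    ultimately show "\<exists>T u. (T \<longlongrightarrow> u) at_top \<and> (\<forall>R. norm (pair_avg S g R - T R) \<le> \<epsilon> * pair_avg S (indicator ?Q) R) \<and>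
        norm (integral\<^sup>L \<Gamma> g - u) \<le> \<epsilon> * measure \<Gamma> ?Q"
      by blast
  qed
  moreover have "\<forall>\<^sub>F R in at_top. pair_avg S g R = (\<Sum>x\<in>S \<inter> ball 0 R. \<Sum>y\<in>S \<inter> ball 0 R. g (x - y)) / of_real (measure lborel (ball (0::complex) R))"
    using eventually_ge_at_top[of "0 :: real"]
    by eventually_elim (simp add: pair_avg_def measure_lborel_disc scaleR_conv_of_real)
  ultimately show "((\<lambda>R. (\<Sum>x\<in>S \<inter> ball 0 R. \<Sum>y\<in>S \<inter> ball 0 R. g (x - y)) / of_real (measure lborel (ball (0::complex) R)))
      \<longlongrightarrow> integral\<^sup>L \<Gamma> g) at_top"
    using tendsto_cong by force
qed

context ginibre
begin

lemma AE_cells: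
  "AE \<omega> in M. \<forall>m a b. m > 0 \<longrightarrow> ((\<lambda>R. pairs (cell m a b) R (X \<omega>) / (pi * R\<^sup>2)) \<longlongrightarrow> measure truncated_density (cell m a b)) at_top"
proof -
  have "AE \<omega> in M. m > 0 \<longrightarrow> ((\<lambda>R. pairs (cell m a b) R (X \<omega>) / (pi * R\<^sup>2)) \<longlongrightarrow> measure truncated_density (cell m a b)) at_top"
    for m a b
  proof (cases "m > 0")
    case True
    then obtain r where "r \<ge> 0" "cell m a b \<subseteq> ball 0 r" using cell_bounded by blast
    then show ?thesis using AE_pairs[of "cell m a b" r] by auto
  qed simp
  then show ?thesis by (simp add: AE_all_countable)
qed

text \<open>The diagonal adds one pair per point to the cell that contains the origin and none to
  the others. Density 1 turns this into the unit atom of \<Gamma>, and the pairs of distinct points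
  supply the rest.\<close>

lemma AE_autocorrelation: "AE \<omega> in M. autocorrelation (X \<omega>) \<Gamma>"
proof -
  have "AE \<omega> in M. locally_finite_set (X \<omega>)"
    using locally_finite by (intro AE_I2)
  with AE_density AE_cells show ?thesis
  proof eventually_elim
    case (elim \<omega>)
    show ?case
    proof (rule autocorrelation_of_cells)
      fix m a b assume m: "(m :: nat) > 0"
      let ?A = "cell m a b"
      let ?T = "\<lambda>R. X \<omega> \<inter> ball 0 R"
      have "(\<Sum>x\<in>?T R. \<Sum>y\<in>?T R. indicator ?A (x - y)) = pairs ?A R (X \<omega>) + indicator ?A 0 * real (card (?T R))" for R
      proof -
        have fin: "finite (?T R)" by (rule finite_Int_ball[OF elim(3)])
        have "(\<Sum>y\<in>?T R. indicator ?A (x - y)) = (\<Sum>y\<in>?T R. of_bool (x \<noteq> y \<and> x - y \<in> ?A)) + (indicator ?A 0 :: real)"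
          if "x \<in> ?T R" for x
        proof -
          have "(\<Sum>y\<in>?T R. indicator ?A (x - y)) = (\<Sum>y\<in>?T R. of_bool (x \<noteq> y \<and> x - y \<in> ?A) + (if x = y then indicator ?A 0 else 0 :: real))"
            by (intro sum.cong) (auto simp: indicator_def)
          then show ?thesis
            using that fin by (simp add: sum.distrib)
        qed
        then show ?thesis by (simp add: pairs_def sum.distrib)
      qed
      then have avg: "pair_avg (X \<omega>) (indicator ?A) R = pairs ?A R (X \<omega>) / (pi * R\<^sup>2) + indicator ?A 0 * (real (card (?T R)) / (pi * R\<^sup>2))" for R
        unfolding pair_avg_def by (simp add: add_divide_distrib)
      have "\<forall>\<^sub>F R in at_top. real (card (?T R)) / measure lborel (ball (0 :: complex) R) = real (card (?T R)) / (pi * R\<^sup>2)"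
        using eventually_ge_at_top[of "0 :: real"] by eventually_elim (simp add: measure_lborel_disc)
      with elim(1) have "((\<lambda>R. real (card (?T R)) / (pi * R\<^sup>2)) \<longlongrightarrow> 1) at_top"
        unfolding has_density_def by (rule Lim_transform_eventually)
      then have "(pair_avg (X \<omega>) (indicator ?A) \<longlongrightarrow> measure truncated_density ?A + indicator ?A 0 * 1) at_top"
        unfolding avg[abs_def] using elim(2) m by (intro tendsto_intros) auto
      moreover have "measure \<Gamma> ?A = measure truncated_density ?A + indicator ?A 0 * 1"
      proof -
        have "emeasure truncated_density ?A < \<infinity>"
          using emeasure_truncated_density_le[of ?A] emeasure_bounded_finite[OF bounded_cell[OF m]] by (rule order.strict_trans1)
        then show ?thesis
          by (simp add: measure_def emeasure_dirac_plus enn2real_plus split: split_indicator)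
      qed
      ultimately show "(pair_avg (X \<omega>) (indicator ?A) \<longlongrightarrow> measure \<Gamma> ?A) at_top" by simp
    qed
  qed
qed

end

section \<open>Fourier transform\<close>

text \<open>Domination by a product of integrable functions of the separate variables, the form in
  which the joint integrability for Fubini mostly arises below.\<close>

lemma (in pair_sigma_finite) integrable_product_bound:
  fixes f :: "'a \<times> 'b \<Rightarrow> 'c :: {banach, second_countable_topology}"
  assumes f [measurable]: "f \<in> borel_measurable (M1 \<Otimes>\<^sub>M M2)"
    and u: "integrable M1 u" and v: "integrable M2 v"
    and bound: "\<And>x y. norm (f (x, y)) \<le> u x * (v y :: real)"
  shows "integrable (M1 \<Otimes>\<^sub>M M2) f"
proof (rule integrableI_bounded[OF f])
  have [measurable]: "u \<in> borel_measurable M1" "v \<in> borel_measurable M2"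
    using u v by auto
  have "(\<integral>\<^sup>+p. ennreal (norm (f p)) \<partial>(M1 \<Otimes>\<^sub>M M2)) = (\<integral>\<^sup>+x. \<integral>\<^sup>+y. ennreal (norm (f (x, y))) \<partial>M2 \<partial>M1)"
    by (rule M2.nn_integral_fst[symmetric]) measurable
  also have "\<dots> \<le> (\<integral>\<^sup>+x. \<integral>\<^sup>+y. ennreal (norm (u x)) * ennreal (norm (v y)) \<partial>M2 \<partial>M1)"
  proof (intro nn_integral_mono)
    fix x y
    have "norm (f (x, y)) \<le> norm (u x) * norm (v y)"
      using bound[of x y] abs_ge_self[of "u x * v y"] by (simp add: abs_mult)
    then show "ennreal (norm (f (x, y))) \<le> ennreal (norm (u x)) * ennreal (norm (v y))"
      by (simp add: ennreal_mult[symmetric] ennreal_leI)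
  qed
  also have "\<dots> = (\<integral>\<^sup>+x. ennreal (norm (u x)) \<partial>M1) * (\<integral>\<^sup>+y. ennreal (norm (v y)) \<partial>M2)"
    by (simp add: nn_integral_cmult nn_integral_multc)
  also have "\<dots> < \<infinity>"
    using u v by (simp add: integrable_iff_bounded ennreal_mult_less_top)
  finally show "(\<integral>\<^sup>+p. ennreal (norm (f p)) \<partial>(M1 \<Otimes>\<^sub>M M2)) < \<infinity>" .
qed

lemma borel_measurable_cnj [measurable]: "cnj \<in> borel_measurable borel"
  by (intro borel_measurable_continuous_onI continuous_on_cnj continuous_intros)

lemma integral_lborel_affine:
  fixes f :: "complex \<Rightarrow> complex"
  assumes [measurable]: "f \<in> borel_measurable borel" and c: "c \<noteq> 0"
  shows "(\<integral>z. f z \<partial>lborel) = c\<^sup>2 *\<^sub>R (\<integral>u. f (t + c *\<^sub>R u) \<partial>lborel)"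
proof -
  have "(\<integral>z. f z \<partial>lborel) = (\<integral>z. f z \<partial>density (distr lborel borel (\<lambda>u. t + c *\<^sub>R u)) (\<lambda>_. \<bar>c\<bar> ^ DIM(complex)))"
    by (subst lborel_affine[OF c, of t]) simp
  also have "\<dots> = (\<integral>u. c\<^sup>2 *\<^sub>R f (t + c *\<^sub>R u) \<partial>lborel)"
    by (simp add: integral_density integral_distr)
  finally show ?thesis by simp
qed

lemma integrable_truncated_density:
  fixes f :: "complex \<Rightarrow> 'b :: {banach, second_countable_topology}"
  assumes f: "integrable lborel f"
  shows "integrable truncated_density f"
    and "integrable lborel (\<lambda>x. exp (- pi * (cmod x)\<^sup>2) *\<^sub>R f x)"
    and "integral\<^sup>L truncated_density f = integral\<^sup>L lborel f - (\<integral>x. exp (- pi * (cmod x)\<^sup>2) *\<^sub>R f x \<partial>lborel)"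
proof -
  have [measurable]: "f \<in> borel_measurable borel" using f by auto
  show int: "integrable lborel (\<lambda>x. exp (- pi * (cmod x)\<^sup>2) *\<^sub>R f x)"
    by (rule Bochner_Integration.integrable_bound[OF f]) (auto intro!: mult_left_le_one_le)
  have eq: "(1 - exp (- pi * (cmod x)\<^sup>2)) *\<^sub>R f x = f x - exp (- pi * (cmod x)\<^sup>2) *\<^sub>R f x" for x
    by (simp add: scaleR_diff_left)
  have "integrable lborel (\<lambda>x. (1 - exp (- pi * (cmod x)\<^sup>2)) *\<^sub>R f x)"
    unfolding eq using f int by (rule Bochner_Integration.integrable_diff)
  then show "integrable truncated_density f"
    unfolding truncated_density_def by (subst integrable_density) simp_all
  show "integral\<^sup>L truncated_density f = integral\<^sup>L lborel f - (\<integral>x. exp (- pi * (cmod x)\<^sup>2) *\<^sub>R f x \<partial>lborel)"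
    unfolding truncated_density_def
    by (subst integral_density) (use f int in \<open>simp_all only: eq Bochner_Integration.integral_diff, simp_all\<close>)
qed

section \<open>Plancherel's identity by Gaussian regularisation\<close>

locale compact_support_fun =
  fixes g :: "complex \<Rightarrow> complex"
  assumes Cc: "Cc g"
begin

definition F :: "complex \<Rightarrow> complex" where
  "F k = fourier g (- k)"

text \<open>By Fubini this is the average of \<open>G (s * u)\<close> over \<open>u\<close> with
  Gaussian weight, where \<open>G\<close> is the autocorrelation of \<open>g\<close> defined below.
  As \<open>s\<close> tends to 0 it tends to \<open>G 0\<close>, which gives Plancherel's identity,
  and \<open>s = 1\<close> gives the Gaussian term of the limit measure.\<close>

definition P :: "real \<Rightarrow> complex" where
  "P s = (\<integral>p. g (fst p) * cnj (g (fst p - s *\<^sub>R snd p)) * of_real (exp (- pi * (cmod (snd p))\<^sup>2)) \<partial>(lborel \<Otimes>\<^sub>M lborel))"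

lemma continuous: "continuous_on UNIV g"
  using Cc by (simp add: Cc_def)

lemma measurable_g [measurable]: "g \<in> borel_measurable borel"
  using continuous by (rule borel_measurable_continuous_onI)

lemma bounded_ex: "\<exists>B\<ge>0. \<forall>x. cmod (g x) \<le> B"
  and integrable_g: "integrable lborel g"
proof -
  obtain C where C: "compact C" and g0: "\<And>x. x \<notin> C \<Longrightarrow> g x = 0"
    using Cc by (auto simp: Cc_def)
  have "bounded (g ` C)"
    by (intro compact_imp_bounded compact_continuous_image C continuous_on_subset[OF continuous]) simp
  then obtain b where b: "\<And>x. x \<in> C \<Longrightarrow> cmod (g x) \<le> b" by (auto simp: bounded_iff)
  have B: "cmod (g x) \<le> max b 0" for x
    using b[of x] g0[of x] by (cases "x \<in> C") (auto simp: le_max_iff_disj)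
  then show "\<exists>B\<ge>0. \<forall>x. cmod (g x) \<le> B" by (intro exI[of _ "max b 0"]) auto
  show "integrable lborel g"
  proof (rule Bochner_Integration.integrable_bound)
    show "integrable lborel (\<lambda>x. max b 0 * indicator C x)"
      using C emeasure_bounded_finite[OF compact_imp_bounded[OF C]]
      by (intro integrable_mult_right integrable_real_indicator) (auto simp: borel_compact)
    show "AE x in lborel. cmod (g x) \<le> norm (max b 0 * indicator C x)"
      using B g0 by (intro AE_I2) (auto simp: indicator_def)
  qed simp
qed

lemma integrable_norm_g: "integrable lborel (\<lambda>x. cmod (g x))"
  using integrable_g by (rule integrable_norm)

lemma F_eq: "F k = (\<integral>x. g x * cis (2 * pi * (k \<bullet> x)) \<partial>lborel)"
  by (simp add: F_def fourier_def inner_minus_left)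

lemma measurable_F [measurable]: "F \<in> borel_measurable borel"
  unfolding F_eq[abs_def] by measurable

text \<open>As an integral over pairs of points the square depends on \<open>k\<close> only through
  a character, so that \<open>k\<close> can be integrated out first.\<close>

lemma norm_F_square:
  "complex_of_real ((cmod (F k))\<^sup>2) =
    (\<integral>p. g (fst p) * cnj (g (snd p)) * cis (2 * pi * (k \<bullet> (fst p - snd p))) \<partial>(lborel \<Otimes>\<^sub>M lborel))"
proof -
  have cis: "cis (2 * pi * (k \<bullet> (y - z))) = cis (2 * pi * (k \<bullet> y)) * cnj (cis (2 * pi * (k \<bullet> z)))" for y z
    by (simp add: cis_cnj cis_mult inner_diff_right algebra_simps)
  have int: "integrable (lborel \<Otimes>\<^sub>M lborel) (\<lambda>p. g (fst p) * cnj (g (snd p)) * cis (2 * pi * (k \<bullet> (fst p - snd p))))"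
    by (rule lborel_pair.integrable_product_bound[OF _ integrable_norm_g integrable_norm_g]) (simp_all add: norm_mult)
  have "(\<integral>p. g (fst p) * cnj (g (snd p)) * cis (2 * pi * (k \<bullet> (fst p - snd p))) \<partial>(lborel \<Otimes>\<^sub>M lborel)) =
     (\<integral>y. \<integral>z. g y * cnj (g z) * cis (2 * pi * (k \<bullet> (y - z))) \<partial>lborel \<partial>lborel)"
    using lborel_pair.integral_fst'[OF int] by simp
  also have "\<dots> = (\<integral>y. (g y * cis (2 * pi * (k \<bullet> y))) * (\<integral>z. cnj (g z * cis (2 * pi * (k \<bullet> z))) \<partial>lborel) \<partial>lborel)"
  proof (rule Bochner_Integration.integral_cong[OF refl])
    fix y
    have "g y * cnj (g z) * cis (2 * pi * (k \<bullet> (y - z))) = (g y * cis (2 * pi * (k \<bullet> y))) * cnj (g z * cis (2 * pi * (k \<bullet> z)))" for z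
      unfolding cis complex_cnj_mult by (simp only: mult_ac)
    then show "(\<integral>z. g y * cnj (g z) * cis (2 * pi * (k \<bullet> (y - z))) \<partial>lborel) =
        (g y * cis (2 * pi * (k \<bullet> y))) * (\<integral>z. cnj (g z * cis (2 * pi * (k \<bullet> z))) \<partial>lborel)"
      by (simp only: integral_mult_right_zero)
  qed
  also have "\<dots> = F k * cnj (F k)"
    by (simp only: Bochner_Integration.integral_cnj[symmetric] F_eq integral_mult_left_zero)
  finally show ?thesis by (simp only: complex_norm_square)
qed

text \<open>The Gaussian factor makes the integrand integrable in \<open>k\<close> and in both
  points jointly. Fubini then applies, and the \<open>k\<close>-integral is the transform of a
  Gaussian.\<close>

lemma gaussian_F_square:
  assumes s: "s > 0"
  shows "(\<integral>k. of_real (exp (- pi * s\<^sup>2 * (cmod k)\<^sup>2) * (cmod (F k))\<^sup>2) \<partial>lborel) = P s"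
proof -
  let ?a = "pi * s\<^sup>2"
  have a: "?a > 0" using s by simp
  let ?H = "\<lambda>k p. g (fst p) * cnj (g (snd p)) * cis (2 * pi * (k \<bullet> (fst p - snd p))) * of_real (exp (- ?a * (cmod k)\<^sup>2))"
  let ?N = "lborel \<Otimes>\<^sub>M lborel :: (complex \<times> complex) measure"
  interpret N: pair_sigma_finite "lborel :: complex measure" ?N
    by (intro pair_sigma_finite.intro sigma_finite_lborel sigma_finite_pair_measure)
  have int_gg: "integrable ?N (\<lambda>p. cmod (g (fst p)) * cmod (g (snd p)))"
    by (rule lborel_pair.integrable_product_bound[OF _ integrable_norm_g integrable_norm_g]) simp_all
  have int_H: "integrable (lborel \<Otimes>\<^sub>M ?N) (\<lambda>(k, p). ?H k p)"
    by (rule N.integrable_product_bound[OF _ integrable_gaussian[OF a] int_gg]) (simp_all add: norm_mult)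
  have "(\<integral>k. of_real (exp (- pi * s\<^sup>2 * (cmod k)\<^sup>2) * (cmod (F k))\<^sup>2) \<partial>lborel) = (\<integral>k. \<integral>p. ?H k p \<partial>?N \<partial>lborel)"
    by (simp add: norm_F_square[simplified] mult.commute)
  also have "\<dots> = (\<integral>p. \<integral>k. ?H k p \<partial>lborel \<partial>?N)"
    by (rule N.Fubini_integral[OF int_H, symmetric])
  also have "\<dots> = (\<integral>p. g (fst p) * cnj (g (snd p)) * of_real (1 / s\<^sup>2 * exp (- pi * (cmod (fst p - snd p))\<^sup>2 / s\<^sup>2)) \<partial>?N)"
  proof (intro Bochner_Integration.integral_cong refl)
    fix p :: "complex \<times> complex"
    let ?d = "(2 * pi) *\<^sub>R (fst p - snd p)"
    have "(\<integral>k. ?H k p \<partial>lborel) = (\<integral>k. (g (fst p) * cnj (g (snd p))) * (of_real (exp (- ?a * (cmod k)\<^sup>2)) * cis (?d \<bullet> k)) \<partial>lborel)"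
    proof (rule Bochner_Integration.integral_cong[OF refl])
      fix k
      have "2 * pi * (k \<bullet> (fst p - snd p)) = ?d \<bullet> k"
        by (simp only: inner_scaleR_left inner_commute[of k])
      then show "?H k p = (g (fst p) * cnj (g (snd p))) * (of_real (exp (- ?a * (cmod k)\<^sup>2)) * cis (?d \<bullet> k))"
        by (simp only: mult_ac)
    qed
    also have "\<dots> = g (fst p) * cnj (g (snd p)) * of_real (pi / ?a * exp (- (cmod ?d)\<^sup>2 / (4 * ?a)))"
      by (simp only: integral_mult_right_zero fourier_gaussian[OF a])
    also have "pi / ?a * exp (- (cmod ?d)\<^sup>2 / (4 * ?a)) = 1 / s\<^sup>2 * exp (- pi * (cmod (fst p - snd p))\<^sup>2 / s\<^sup>2)"
    proof -
      have "cmod ?d = 2 * pi * cmod (fst p - snd p)"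
        by (simp only: norm_scaleR) simp
      then have "(cmod ?d)\<^sup>2 = 4 * pi\<^sup>2 * (cmod (fst p - snd p))\<^sup>2"
        by (simp only: power_mult_distrib) simp
      then show ?thesis
        using s by (simp only:) (simp add: power2_eq_square field_simps)
    qed
    finally show "(\<integral>k. ?H k p \<partial>lborel) = g (fst p) * cnj (g (snd p)) * of_real (1 / s\<^sup>2 * exp (- pi * (cmod (fst p - snd p))\<^sup>2 / s\<^sup>2))" .
  qed
  also have "\<dots> = (\<integral>y. \<integral>z. g y * cnj (g z) * of_real (1 / s\<^sup>2 * exp (- pi * (cmod (y - z))\<^sup>2 / s\<^sup>2)) \<partial>lborel \<partial>lborel)"
  proof -
    have "integrable ?N (\<lambda>p. g (fst p) * cnj (g (snd p)) * of_real (1 / s\<^sup>2 * exp (- pi * (cmod (fst p - snd p))\<^sup>2 / s\<^sup>2)))"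
    proof (rule Bochner_Integration.integrable_bound)
      show "integrable ?N (\<lambda>p. (1 / s\<^sup>2) * (cmod (g (fst p)) * cmod (g (snd p))))"
        using int_gg by simp
      show "AE p in ?N. norm (g (fst p) * cnj (g (snd p)) * of_real (1 / s\<^sup>2 * exp (- pi * (cmod (fst p - snd p))\<^sup>2 / s\<^sup>2))) \<le>
          norm ((1 / s\<^sup>2) * (cmod (g (fst p)) * cmod (g (snd p))))"
        by (intro AE_I2) (auto simp: norm_mult norm_divide norm_power intro!: divide_right_mono mult_left_le)
    qed measurable
    from lborel_pair.integral_fst'[OF this] show ?thesis unfolding fst_conv snd_conv ..
  qed
  \<comment> \<open>Substituting \<open>z = y - s * u\<close> contributes the Jacobian
    \<open>s^2\<close>, which cancels the normalisation \<open>1 / s^2\<close> of the transformed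
    Gaussian.\<close>
  also have "\<dots> = (\<integral>y. \<integral>u. g y * cnj (g (y - s *\<^sub>R u)) * of_real (exp (- pi * (cmod u)\<^sup>2)) \<partial>lborel \<partial>lborel)"
  proof (rule Bochner_Integration.integral_cong[OF refl])
    fix y
    have "(\<integral>z. g y * cnj (g z) * of_real (1 / s\<^sup>2 * exp (- pi * (cmod (y - z))\<^sup>2 / s\<^sup>2)) \<partial>lborel) =
      (-s)\<^sup>2 *\<^sub>R (\<integral>u. g y * cnj (g (y + (-s) *\<^sub>R u)) * of_real (1 / s\<^sup>2 * exp (- pi * (cmod (y - (y + (-s) *\<^sub>R u)))\<^sup>2 / s\<^sup>2)) \<partial>lborel)"
      using s by (intro integral_lborel_affine) simp_all
    also have "\<dots> = (\<integral>u. s\<^sup>2 *\<^sub>R (g y * cnj (g (y - s *\<^sub>R u)) * of_real (1 / s\<^sup>2 * exp (- pi * (cmod u)\<^sup>2))) \<partial>lborel)"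
      using s by (simp add: power_mult_distrib)
    also have "\<dots> = (\<integral>u. g y * cnj (g (y - s *\<^sub>R u)) * of_real (exp (- pi * (cmod u)\<^sup>2)) \<partial>lborel)"
      using s by (intro Bochner_Integration.integral_cong refl) (simp add: scaleR_conv_of_real)
    finally show "(\<integral>z. g y * cnj (g z) * of_real (1 / s\<^sup>2 * exp (- pi * (cmod (y - z))\<^sup>2 / s\<^sup>2)) \<partial>lborel) =
      (\<integral>u. g y * cnj (g (y - s *\<^sub>R u)) * of_real (exp (- pi * (cmod u)\<^sup>2)) \<partial>lborel)" .
  qed
  also have "\<dots> = P s"
  proof -
    obtain B where B: "0 \<le> B" "\<And>x. cmod (g x) \<le> B" using bounded_ex by blast
    have "integrable ?N (\<lambda>p. g (fst p) * cnj (g (fst p - s *\<^sub>R snd p)) * of_real (exp (- pi * (cmod (snd p))\<^sup>2)))"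
    proof (rule lborel_pair.integrable_product_bound)
      show "integrable lborel (\<lambda>x. B * cmod (g x))" using integrable_norm_g by simp
      show "integrable lborel (\<lambda>u. exp (- pi * (cmod u)\<^sup>2))" by (rule integrable_gaussian) simp
      show "norm (g (fst (y, u)) * cnj (g (fst (y, u) - s *\<^sub>R snd (y, u))) * of_real (exp (- pi * (cmod (snd (y, u)))\<^sup>2))) \<le>
          B * cmod (g y) * exp (- pi * (cmod u)\<^sup>2)" for y u
        using mult_left_mono[OF B(2)[of "y - s *\<^sub>R u"] norm_ge_zero[of "g y"]]
        by (simp add: norm_mult mult.commute)
    qed measurable
    from lborel_pair.integral_fst'[OF this] show ?thesis unfolding P_def by simp
  qed
  finally show ?thesis .
qed


text \<open>Continuity of \<open>g\<close> gives pointwise convergence. The bound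
  \<open>B * |g y|\<close> times the Gaussian in \<open>u\<close> does not depend on
  \<open>s\<close>, so dominated convergence applies.\<close>

lemma P_tendsto: "(\<lambda>n. P (1 / real (Suc n))) \<longlonglongrightarrow> (\<integral>y. of_real ((cmod (g y))\<^sup>2) \<partial>lborel)"
proof -
  let ?N = "lborel \<Otimes>\<^sub>M lborel :: (complex \<times> complex) measure"
  obtain B where B: "0 \<le> B" "\<And>x. cmod (g x) \<le> B" using bounded_ex by blast
  let ?e = "\<lambda>u :: complex. exp (- pi * (cmod u)\<^sup>2)"
  let ?h = "\<lambda>s p. g (fst p) * cnj (g (fst p - s *\<^sub>R snd p)) * of_real (?e (snd p))"
  have e: "integrable lborel ?e" by (rule integrable_gaussian) simp
  have bound: "norm (?h s (y, u)) \<le> B * cmod (g y) * ?e u" for s y u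
    using mult_left_mono[OF B(2)[of "y - s *\<^sub>R u"] norm_ge_zero[of "g y"]]
    by (simp add: norm_mult mult.commute)
  have int_Bg: "integrable lborel (\<lambda>x. B * cmod (g x))" using integrable_norm_g by simp
  have "(\<lambda>n. \<integral>p. ?h (1 / real (Suc n)) p \<partial>?N) \<longlonglongrightarrow> (\<integral>p. ?h 0 p \<partial>?N)"
  proof (rule integral_dominated_convergence[where w="\<lambda>p. B * cmod (g (fst p)) * ?e (snd p)"])
    show "integrable ?N (\<lambda>p. B * cmod (g (fst p)) * ?e (snd p))"
      by (rule lborel_pair.integrable_product_bound[OF _ int_Bg e]) (use B in \<open>simp_all add: abs_mult\<close>)
    show "AE p in ?N. (\<lambda>n. ?h (1 / real (Suc n)) p) \<longlonglongrightarrow> ?h 0 p"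
    proof (rule AE_I2)
      fix p :: "complex \<times> complex"
      have "(\<lambda>n. fst p - (1 / real (Suc n)) *\<^sub>R snd p) \<longlonglongrightarrow> fst p - 0 *\<^sub>R snd p"
        using lim_1_over_n LIMSEQ_Suc by (intro tendsto_intros) (auto dest: LIMSEQ_Suc)
      then have "(\<lambda>n. g (fst p - (1 / real (Suc n)) *\<^sub>R snd p)) \<longlonglongrightarrow> g (fst p - 0 *\<^sub>R snd p)"
        using continuous by (intro continuous_on_tendsto_compose[where f=g and s=UNIV]) auto
      then show "(\<lambda>n. ?h (1 / real (Suc n)) p) \<longlonglongrightarrow> ?h 0 p"
        by (intro tendsto_intros)
    qed
    show "AE p in ?N. norm (?h (1 / real (Suc n)) p) \<le> B * cmod (g (fst p)) * ?e (snd p)" for n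
    proof (rule AE_I2)
      fix p :: "complex \<times> complex"
      show "norm (?h (1 / real (Suc n)) p) \<le> B * cmod (g (fst p)) * ?e (snd p)"
        using bound[where s="1 / real (Suc n)" and y="fst p" and u="snd p"] by simp
    qed
  qed measurable
  moreover have "(\<integral>p. ?h 0 p \<partial>?N) = (\<integral>y. of_real ((cmod (g y))\<^sup>2) \<partial>lborel)"
  proof -
    have "integrable ?N (?h 0)"
      by (rule lborel_pair.integrable_product_bound[OF _ int_Bg e bound]) measurable
    from lborel_pair.integral_fst'[OF this]
    have "(\<integral>p. ?h 0 p \<partial>?N) = (\<integral>y. \<integral>u. (g y * cnj (g y)) * of_real (?e u) \<partial>lborel \<partial>lborel)"
      by simp
    also have "\<dots> = (\<integral>y. (g y * cnj (g y)) * (\<integral>u. of_real (?e u) \<partial>lborel) \<partial>lborel)"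
      by (simp only: integral_mult_right_zero)
    \<comment> \<open>Frequency 0 in \<open>fourier_gaussian\<close>: the Gaussian has total mass
      1.\<close>
    also have "(\<integral>u. complex_of_real (?e u) \<partial>lborel) = 1"
      using fourier_gaussian[of pi 0] by simp
    finally show ?thesis by (simp only: mult_1_right complex_norm_square)
  qed
  ultimately show ?thesis unfolding P_def by simp
qed

text \<open>The transform is bounded by the L1 norm of \<open>g\<close>, so a multiple of the
  Gaussian dominates.\<close>

lemma integrable_gaussian_F_square:
  assumes "s > 0"
  shows "integrable lborel (\<lambda>k. exp (- pi * s\<^sup>2 * (cmod k)\<^sup>2) * (cmod (F k))\<^sup>2)"
proof -
  define A where "A = (\<integral>x. cmod (g x) \<partial>lborel)"
  have F: "cmod (F k) \<le> A" for k
    unfolding F_eq A_def using integral_norm_bound[of lborel "\<lambda>x. g x * cis (2 * pi * (k \<bullet> x))"] by (simp add: norm_mult)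
  have "integrable lborel (\<lambda>k. exp (- (pi * s\<^sup>2) * (cmod k)\<^sup>2) * A\<^sup>2)"
    using assms by (intro integrable_mult_left integrable_gaussian) simp
  then show ?thesis
    by (rule Bochner_Integration.integrable_bound) (use F in \<open>auto simp: abs_mult intro!: power_mono\<close>)
qed

text \<open>The Gaussian regularisation is removed by monotone convergence.\<close>

lemma plancherel:
  shows "integrable lborel (\<lambda>k. (cmod (F k))\<^sup>2)"
    and "(\<integral>k. (cmod (F k))\<^sup>2 \<partial>lborel) = (\<integral>y. (cmod (g y))\<^sup>2 \<partial>lborel)"
proof -
  let ?f = "\<lambda>n k. exp (- pi * (1 / real (Suc n))\<^sup>2 * (cmod k)\<^sup>2) * (cmod (F k))\<^sup>2"
  have int: "integrable lborel (?f n)" for n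
    by (rule integrable_gaussian_F_square) simp
  have "complex_of_real (integral\<^sup>L lborel (?f n)) = P (1 / real (Suc n))" for n
    by (subst gaussian_F_square[symmetric]) (simp, rule integral_complex_of_real[symmetric])
  then have "(\<lambda>n. complex_of_real (integral\<^sup>L lborel (?f n))) \<longlonglongrightarrow> complex_of_real (\<integral>y. (cmod (g y))\<^sup>2 \<partial>lborel)"
    using P_tendsto by (simp only: integral_complex_of_real)
  then have lim: "(\<lambda>n. integral\<^sup>L lborel (?f n)) \<longlonglongrightarrow> (\<integral>y. (cmod (g y))\<^sup>2 \<partial>lborel)"
    by (simp only: tendsto_of_real_iff)
  have mono: "mono (\<lambda>n. ?f n k)" for k
  proof (rule monoI)
    fix m n :: nat assume "m \<le> n"
    then have "(1 / real (Suc n))\<^sup>2 \<le> (1 / real (Suc m))\<^sup>2"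
      by (intro power_mono divide_left_mono) auto
    then have "pi * (1 / real (Suc n))\<^sup>2 * (cmod k)\<^sup>2 \<le> pi * (1 / real (Suc m))\<^sup>2 * (cmod k)\<^sup>2"
      by (intro mult_right_mono mult_left_mono) auto
    then show "?f m k \<le> ?f n k"
      by (intro mult_right_mono) auto
  qed
  have pointwise: "(\<lambda>n. ?f n k) \<longlonglongrightarrow> (cmod (F k))\<^sup>2" for k
  proof -
    have "(\<lambda>n. 1 / real (Suc n)) \<longlonglongrightarrow> 0"
      using LIMSEQ_Suc[OF lim_1_over_n] by simp
    then have "(\<lambda>n. ?f n k) \<longlonglongrightarrow> exp (- pi * 0\<^sup>2 * (cmod k)\<^sup>2) * (cmod (F k))\<^sup>2"
      by (intro tendsto_intros)
    then show ?thesis by simp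
  qed
  show "integrable lborel (\<lambda>k. (cmod (F k))\<^sup>2)"
    by (rule integrable_monotone_convergence[OF int _ _ lim]) (use mono pointwise in auto)
  show "(\<integral>k. (cmod (F k))\<^sup>2 \<partial>lborel) = (\<integral>y. (cmod (g y))\<^sup>2 \<partial>lborel)"
    by (rule integral_monotone_convergence[OF int _ _ lim]) (use mono pointwise in auto)
qed

section \<open>The autocorrelation of a test function and the Fourier identity\<close>

definition G :: "complex \<Rightarrow> complex" where
  "G = conv g (reflect_conj g)"

lemma G_eq: "G x = (\<integral>y. g y * cnj (g (y - x)) \<partial>lborel)"
  by (simp add: G_def conv_def reflect_conj_def)

lemma integral_shift_norm_g: "(\<integral>\<^sup>+x. ennreal (cmod (g (y - x))) \<partial>lborel) = (\<integral>\<^sup>+x. ennreal (cmod (g x)) \<partial>lborel)"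
  by (rule nn_integral_lborel_diff) measurable

text \<open>For fixed \<open>y\<close> the map from \<open>x\<close> to \<open>y - x\<close>
  preserves Lebesgue measure, so the double integral of the modulus is the square of the L1 norm of
  \<open>g\<close>.\<close>

lemma integrable_pair_G:
  "integrable (lborel \<Otimes>\<^sub>M lborel) (\<lambda>(y, x). g y * cnj (g (y - x)))"
proof (rule integrableI_bounded)
  show meas: "(\<lambda>(y, x). g y * cnj (g (y - x))) \<in> borel_measurable (lborel \<Otimes>\<^sub>M lborel)"
    by measurable
  have "(\<integral>\<^sup>+p. ennreal (norm (case p of (y, x) \<Rightarrow> g y * cnj (g (y - x)))) \<partial>(lborel \<Otimes>\<^sub>M lborel)) =
      (\<integral>\<^sup>+y. \<integral>\<^sup>+x. ennreal (norm (g y * cnj (g (y - x)))) \<partial>lborel \<partial>lborel)"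
    using lborel.nn_integral_fst[of "\<lambda>p. ennreal (norm (case p of (y, x) \<Rightarrow> g y * cnj (g (y - x))))" lborel] meas by simp
  also have "\<dots> = (\<integral>\<^sup>+y. ennreal (cmod (g y)) * (\<integral>\<^sup>+x. ennreal (cmod (g x)) \<partial>lborel) \<partial>lborel)"
    by (simp add: norm_mult ennreal_mult nn_integral_cmult integral_shift_norm_g)
  also have "\<dots> < \<infinity>"
    using integrable_norm_g by (simp add: nn_integral_multc integrable_iff_bounded ennreal_mult_less_top)
  finally show "(\<integral>\<^sup>+p. ennreal (norm (case p of (y, x) \<Rightarrow> g y * cnj (g (y - x)))) \<partial>(lborel \<Otimes>\<^sub>M lborel)) < \<infinity>" .
qed

lemma integrable_G: "integrable lborel G"
  using lborel_pair.integrable_snd[OF integrable_pair_G] by (simp add: G_eq[abs_def])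

lemma integral_G: "integral\<^sup>L lborel G = of_real ((cmod (F 0))\<^sup>2)"
proof -
  have "integral\<^sup>L lborel G = (\<integral>y. \<integral>x. g y * cnj (g (y - x)) \<partial>lborel \<partial>lborel)"
    using lborel_pair.Fubini_integral[OF integrable_pair_G] by (simp add: G_eq[abs_def])
  also have "\<dots> = (\<integral>y. g y * cnj (\<integral>x. g x \<partial>lborel) \<partial>lborel)"
  proof (rule Bochner_Integration.integral_cong[OF refl])
    fix y
    have "(\<integral>x. g x \<partial>lborel) = (\<integral>x. g (y - x) \<partial>lborel)"
      using integral_lborel_affine[of g "-1" y] by simp
    then show "(\<integral>x. g y * cnj (g (y - x)) \<partial>lborel) = g y * cnj (\<integral>x. g x \<partial>lborel)"
      by simp
  qed
  also have "\<dots> = F 0 * cnj (F 0)"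
    by (simp add: F_eq)
  finally show ?thesis by (simp only: complex_norm_square)
qed

text \<open>The case \<open>s = 1\<close> of \<open>gaussian_F_square\<close>: the Gaussian is its
  own transform, so both sides are \<open>P 1\<close>, on the left after the integration over
  \<open>y\<close> is carried out first.\<close>

lemma integral_gaussian_G:
  "(\<integral>x. exp (- pi * (cmod x)\<^sup>2) *\<^sub>R G x \<partial>lborel) = of_real (\<integral>k. exp (- pi * (cmod k)\<^sup>2) * (cmod (F k))\<^sup>2 \<partial>lborel)"
proof -
  let ?f = "\<lambda>(y, x). g y * cnj (g (y - x)) * of_real (exp (- pi * (cmod x)\<^sup>2))"
  have int: "integrable (lborel \<Otimes>\<^sub>M lborel) ?f"
    by (rule Bochner_Integration.integrable_bound[OF integrable_pair_G])
       (auto simp: norm_mult mult_left_le)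
  have "of_real (\<integral>k. exp (- pi * (cmod k)\<^sup>2) * (cmod (F k))\<^sup>2 \<partial>lborel) = P 1"
    using gaussian_F_square[of 1] by (simp flip: integral_complex_of_real)
  also have "\<dots> = (\<integral>p. ?f p \<partial>(lborel \<Otimes>\<^sub>M lborel))"
    unfolding P_def by (intro Bochner_Integration.integral_cong) auto
  also have "\<dots> = (\<integral>x. \<integral>y. ?f (y, x) \<partial>lborel \<partial>lborel)"
    using lborel_pair.integral_snd[OF int] by simp
  also have "\<dots> = (\<integral>x. exp (- pi * (cmod x)\<^sup>2) *\<^sub>R G x \<partial>lborel)"
    by (simp add: G_eq scaleR_conv_of_real mult.commute)
  finally show ?thesis ..
qed

text \<open>Integrating \<open>G\<close> against \<Gamma> gives its value at 0, plus its Lebesgue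
  integral, minus a Gaussian integral. On the frequency side these become the Lebesgue integral, the
  value at 0 and the same Gaussian integral of the squared transform, so the three terms match after
  exchanging the first two.\<close>

lemma fourier_identity:
  shows "integrable \<Gamma> (conv g (reflect_conj g))"
    and "integrable \<Gamma> (\<lambda>k. (cmod (fourier g (- k)))\<^sup>2)"
    and "integral\<^sup>L \<Gamma> (conv g (reflect_conj g)) = of_real (integral\<^sup>L \<Gamma> (\<lambda>k. (cmod (fourier g (- k)))\<^sup>2))"
proof -
  note tG = integrable_truncated_density[OF integrable_G]
  note tF = integrable_truncated_density[OF plancherel(1)]
  show "integrable \<Gamma> (conv g (reflect_conj g))"
    using dirac_plus_integral(1)[OF tG(1)] by (simp add: G_def)
  show "integrable \<Gamma> (\<lambda>k. (cmod (fourier g (- k)))\<^sup>2)"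
    using dirac_plus_integral(1)[OF tF(1)] by (simp add: F_def)
  have G0: "G 0 = of_real (\<integral>y. (cmod (g y))\<^sup>2 \<partial>lborel)"
    by (simp add: G_eq complex_norm_square[symmetric] flip: integral_complex_of_real)
  have "integral\<^sup>L \<Gamma> G = G 0 + (integral\<^sup>L lborel G - (\<integral>x. exp (- pi * (cmod x)\<^sup>2) *\<^sub>R G x \<partial>lborel))"
    by (simp only: dirac_plus_integral(2)[OF tG(1)] tG(3))
  also have "\<dots> = of_real ((cmod (F 0))\<^sup>2 + ((\<integral>k. (cmod (F k))\<^sup>2 \<partial>lborel) - (\<integral>k. exp (- pi * (cmod k)\<^sup>2) * (cmod (F k))\<^sup>2 \<partial>lborel)))"
    unfolding G0 integral_G integral_gaussian_G plancherel(2) by simp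
  also have "\<dots> = of_real (integral\<^sup>L \<Gamma> (\<lambda>k. (cmod (F k))\<^sup>2))"
    by (simp only: dirac_plus_integral(2)[OF tF(1)] tF(3) real_scaleR_def)
  finally have "integral\<^sup>L \<Gamma> G = of_real (integral\<^sup>L \<Gamma> (\<lambda>k. (cmod (F k))\<^sup>2))" .
  then show "integral\<^sup>L \<Gamma> (conv g (reflect_conj g)) = of_real (integral\<^sup>L \<Gamma> (\<lambda>k. (cmod (fourier g (- k)))\<^sup>2))"
    by (simp add: G_def F_def)
qed

end

lemma fourier_dirac_plus: "measure_fourier_transform \<Gamma> \<Gamma>"
  unfolding measure_fourier_transform_def
proof (intro conjI allI impI)
  fix g assume "Cc g"
  then interpret compact_support_fun g by unfold_locales
  show "integrable \<Gamma> (conv g (reflect_conj g))"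
    and "integrable \<Gamma> (\<lambda>k. (cmod (fourier g (- k)))\<^sup>2)"
    and "integral\<^sup>L \<Gamma> (conv g (reflect_conj g)) = of_real (integral\<^sup>L \<Gamma> (\<lambda>k. (cmod (fourier g (- k)))\<^sup>2))"
    by (fact fourier_identity)+
qed simp_all

theorem theorem4:
  fixes M :: "'w measure" and X :: "'w \<Rightarrow> complex set"
  assumes "ginibre_process M X"
  shows "AE \<omega> in M.
           has_density (X \<omega>) 1 \<and>
           autocorrelation (X \<omega>) dirac_plus_ginibre_density \<and>
           measure_fourier_transform dirac_plus_ginibre_density dirac_plus_ginibre_density"
proof -
  interpret ginibre M X
    using assms by unfold_locales
  show ?thesis
    using AE_density AE_autocorrelation by eventually_elim (simp add: fourier_dirac_plus)
qed

end
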